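(* A finite soluble group $G$ is supersoluble if and only if $G$ has a normal subgroup $E$ with $G/E$ supersoluble such that every maximal subgroup of every Sylow subgroup of $F(E)$ is $\mathfrak U_\tau$-supplemented in $G$ for some $\Phi$-regular (inductive) subgroup functor $\tau$.
   Context: All groups are finite; $\mathfrak U$ is the class of supersoluble groups and $F(E)$ the Fitting subgroup. For a class $\mathfrak F$, a chief factor $H/K$ of $G$ is $\mathfrak F$-central if $(H/K)\rtimes(G/C_G(H/K))\in\mathfrak F$; $Z_{\mathfrak F}(G)$ is the product of all normal subgroups $N$ of $G$ such that every chief factor of $G$ below $N$ is $\mathfrak F$-central. For $K\le H\le G$, the pair $(K,H)$ satisfies the $\mathfrak F$-supplement condition in $G$ if there is $T\le G$ with $HT=G$ and $H\cap T\subseteq KZ_{\mathfrak F}(T)$. A subgroup functor $\tau$ assigns to each group $G$ a set $\tau(G)$ of subgroups with $1\in\tau(G)$ and $\theta(\tau(G))=\tau(\theta(G))$ for all isomorphisms $\theta:G\to G^*$; members are $\tau$-subgroups. $\tau$ is inductive if $HN/N\in\tau(G/N)$ whenever $H\in\tau(G)$, $N\trianglelefteq G$; $\Phi$-regular if for every primitive group $G$ (a group having a maximal subgroup with trivial core), whenever $H\in\tau(G)$ is a $p$-group and $N$ is a minimal normal subgroup of $G$, $|G:N_G(H\cap N)|$ is a power of $p$. With $H_G$ the core of $H$, $H$ is $\mathfrak F_\tau$-supplemented in $G$ if for some $\tau$-subgroup $\bar S$ of $G/H_G$ with $\bar S\le H/H_G$ the pair $(\bar S,H/H_G)$ satisfies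 the $\mathfrak F$-supplement condition in $G/H_G$. *)

theory Defs
  imports "HOL-Algebra.Algebra"
begin

definition supersoluble :: "('a, 'b) monoid_scheme \<Rightarrow> bool" where
  "supersoluble G \<longleftrightarrow> group G \<and>
     (\<exists>Ns :: 'a set list. Ns \<noteq> [] \<and> hd Ns = {\<one>\<^bsub>G\<^esub>} \<and> last Ns = carrier G \<and>
        (\<forall>i < length Ns. Ns ! i \<lhd> G) \<and>
        (\<forall>i. Suc i < length Ns \<longrightarrow> Ns ! i \<subseteq> Ns ! Suc i \<and>
              cyclic_group ((G\<lparr>carrier := Ns ! Suc i\<rparr>) Mod (Ns ! i))))"

definition comm_subgroup :: "('a, 'b) monoid_scheme \<Rightarrow> 'a set \<Rightarrow> 'a set \<Rightarrow> 'a set" where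
  "comm_subgroup G A B = generate G
     {x \<otimes>\<^bsub>G\<^esub> y \<otimes>\<^bsub>G\<^esub> inv\<^bsub>G\<^esub> x \<otimes>\<^bsub>G\<^esub> inv\<^bsub>G\<^esub> y | x y. x \<in> A \<and> y \<in> B}"

fun lower_central :: "('a, 'b) monoid_scheme \<Rightarrow> nat \<Rightarrow> 'a set" where
  "lower_central G 0 = carrier G"
| "lower_central G (Suc n) = comm_subgroup G (lower_central G n) (carrier G)"

definition nilpotent :: "('a, 'b) monoid_scheme \<Rightarrow> bool" where
  "nilpotent G \<longleftrightarrow> group G \<and> (\<exists>n. lower_central G n = {\<one>\<^bsub>G\<^esub>})"

definition fitting :: "('a, 'b) monoid_scheme \<Rightarrow> 'a set" where
  "fitting G = generate G (\<Union>{N. N \<lhd> G \<and> nilpotent (G\<lparr>carrier := N\<rparr>)})"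

definition sylow_subgroup :: "('a, 'b) monoid_scheme \<Rightarrow> nat \<Rightarrow> 'a set \<Rightarrow> bool" where
  "sylow_subgroup G p P \<longleftrightarrow> Factorial_Ring.prime p \<and> subgroup P G \<and>
     card P = p ^ multiplicity p (card (carrier G))"

definition maximal_subgroup :: "('a, 'b) monoid_scheme \<Rightarrow> 'a set \<Rightarrow> bool" where
  "maximal_subgroup G M \<longleftrightarrow> subgroup M G \<and> M \<noteq> carrier G \<and>
     (\<forall>K. subgroup K G \<and> M \<subseteq> K \<longrightarrow> K = M \<or> K = carrier G)"

definition core :: "('a, 'b) monoid_scheme \<Rightarrow> 'a set \<Rightarrow> 'a set" where
  "core G H = carrier G \<inter> (\<Inter>g\<in>carrier G. g <#\<^bsub>G\<^esub> H #>\<^bsub>G\<^esub> inv\<^bsub>G\<^esub> g)"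

definition primitive_group :: "('a, 'b) monoid_scheme \<Rightarrow> bool" where
  "primitive_group G \<longleftrightarrow> (\<exists>M. maximal_subgroup G M \<and> core G M = {\<one>\<^bsub>G\<^esub>})"

definition minimal_normal :: "('a, 'b) monoid_scheme \<Rightarrow> 'a set \<Rightarrow> bool" where
  "minimal_normal G N \<longleftrightarrow> N \<lhd> G \<and> N \<noteq> {\<one>\<^bsub>G\<^esub>} \<and>
     (\<forall>M. M \<lhd> G \<and> M \<subseteq> N \<longrightarrow> M = {\<one>\<^bsub>G\<^esub>} \<or> M = N)"

definition chief_factor :: "('a, 'b) monoid_scheme \<Rightarrow> 'a set \<Rightarrow> 'a set \<Rightarrow> bool" where
  "chief_factor G H K \<longleftrightarrow> H \<lhd> G \<and> K \<lhd> G \<and> K \<subseteq> H \<and> K \<noteq> H \<and>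
     (\<forall>M. M \<lhd> G \<and> K \<subseteq> M \<and> M \<subseteq> H \<longrightarrow> M = K \<or> M = H)"

definition centralizer_factor :: "('a, 'b) monoid_scheme \<Rightarrow> 'a set \<Rightarrow> 'a set \<Rightarrow> 'a set" where
  "centralizer_factor G H K =
     {g \<in> carrier G. \<forall>h\<in>H. inv\<^bsub>G\<^esub> h \<otimes>\<^bsub>G\<^esub> inv\<^bsub>G\<^esub> g \<otimes>\<^bsub>G\<^esub> h \<otimes>\<^bsub>G\<^esub> g \<in> K}"

text \<open>Conjugation action of a coset y of C_G(H/K) on a coset x of K in H.\<close>
definition conj_act :: "('a, 'b) monoid_scheme \<Rightarrow> 'a set \<Rightarrow> 'a set \<Rightarrow> 'a set" where
  "conj_act G y x = (\<lambda>(g, a). g \<otimes>\<^bsub>G\<^esub> a \<otimes>\<^bsub>G\<^esub> inv\<^bsub>G\<^esub> g) ` (y \<times> x)"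

definition chief_semidirect ::
    "('a, 'b) monoid_scheme \<Rightarrow> 'a set \<Rightarrow> 'a set \<Rightarrow> ('a set \<times> 'a set) monoid" where
  "chief_semidirect G H K =
     (let C = centralizer_factor G H K in
      \<lparr> carrier = {K #>\<^bsub>G\<^esub> h | h. h \<in> H} \<times> rcosets\<^bsub>G\<^esub> C,
        monoid.mult = (\<lambda>p q. (fst p <#>\<^bsub>G\<^esub> conj_act G (snd p) (fst q), snd p <#>\<^bsub>G\<^esub> snd q)),
        one = (K, C) \<rparr>)"

definition U_central :: "('a, 'b) monoid_scheme \<Rightarrow> 'a set \<Rightarrow> 'a set \<Rightarrow> bool" where
  "U_central G H K \<longleftrightarrow> supersoluble (chief_semidirect G H K)"

definition U_hypercentre :: "('a, 'b) monoid_scheme \<Rightarrow> 'a set" where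
  "U_hypercentre G = generate G (\<Union>{N. N \<lhd> G \<and>
      (\<forall>H K. chief_factor G H K \<and> H \<subseteq> N \<longrightarrow> U_central G H K)})"

definition U_supplement_cond :: "('a, 'b) monoid_scheme \<Rightarrow> 'a set \<Rightarrow> 'a set \<Rightarrow> bool" where
  "U_supplement_cond G K H \<longleftrightarrow> (\<exists>T. subgroup T G \<and> H <#>\<^bsub>G\<^esub> T = carrier G \<and>
      H \<inter> T \<subseteq> K <#>\<^bsub>G\<^esub> U_hypercentre (G\<lparr>carrier := T\<rparr>))"

text \<open>A subgroup functor is determined (by isomorphism invariance) by its values on finite
  groups whose elements are natural numbers; every finite group is isomorphic to such a group.
  We therefore represent a functor by its restriction to groups on nat, and define the
  tau-subgroups of an arbitrary finite group by transport along isomorphisms.\<close>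
type_synonym subgroup_functor = "nat monoid \<Rightarrow> nat set set"

definition is_subgroup_functor :: "subgroup_functor \<Rightarrow> bool" where
  "is_subgroup_functor \<tau> \<longleftrightarrow>
     (\<forall>K. group K \<and> finite (carrier K) \<longrightarrow>
         {\<one>\<^bsub>K\<^esub>} \<in> \<tau> K \<and> (\<forall>S\<in>\<tau> K. subgroup S K)) \<and>
     (\<forall>K K' \<theta>. group K \<and> finite (carrier K) \<and> group K' \<and> \<theta> \<in> iso K K' \<longrightarrow>
         (\<lambda>S. \<theta> ` S) ` \<tau> K = \<tau> K')"

definition tau_subgroup :: "subgroup_functor \<Rightarrow> ('a, 'b) monoid_scheme \<Rightarrow> 'a set \<Rightarrow> bool" where
  "tau_subgroup \<tau> G S \<longleftrightarrow> S \<subseteq> carrier G \<and>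
     (\<exists>(K :: nat monoid) \<theta>. group K \<and> \<theta> \<in> iso G K \<and> \<theta> ` S \<in> \<tau> K)"

definition inductive_functor :: "subgroup_functor \<Rightarrow> bool" where
  "inductive_functor \<tau> \<longleftrightarrow>
     (\<forall>(K :: nat monoid) N S. group K \<and> finite (carrier K) \<and> N \<lhd> K \<and> S \<in> \<tau> K \<longrightarrow>
        tau_subgroup \<tau> (K Mod N) ((\<lambda>s. N #>\<^bsub>K\<^esub> s) ` S))"

definition Phi_regular :: "subgroup_functor \<Rightarrow> bool" where
  "Phi_regular \<tau> \<longleftrightarrow>
     (\<forall>(K :: nat monoid) S p k N. group K \<and> finite (carrier K) \<and> primitive_group K \<and>
        S \<in> \<tau> K \<and> Factorial_Ring.prime p \<and> card S = p ^ k \<and> minimal_normal K N \<longrightarrow>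
        (\<exists>m. card (rcosets\<^bsub>K\<^esub> (normalizer K (S \<inter> N))) = p ^ m))"

definition U_tau_supplemented ::
    "subgroup_functor \<Rightarrow> ('a, 'b) monoid_scheme \<Rightarrow> 'a set \<Rightarrow> bool" where
  "U_tau_supplemented \<tau> G H \<longleftrightarrow>
     (let C = core G H; Q = G Mod C; HQ = (\<lambda>h. C #>\<^bsub>G\<^esub> h) ` H in
      \<exists>S. tau_subgroup \<tau> Q S \<and> S \<subseteq> HQ \<and> U_supplement_cond Q S HQ)"

end

theory Submission
  imports Defs
begin

text \<open>
  Only the direction from right to left needs an argument. Let \<open>F\<close> be the Fitting subgroup of \<open>E\<close>.

  Let \<open>M\<close> be a maximal subgroup of \<open>G\<close> that does not contain some Sylow subgroup \<open>P\<close> of \<open>F\<close>. Then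
  \<open>D = P \<inter> M\<close> is normal in \<open>G\<close> and \<open>P/D\<close> is a chief factor. Choose a maximal subgroup \<open>H\<close> of \<open>P\<close> that
  contains \<open>D\<close> and is normalised by a Sylow subgroup \<open>Y\<close> of \<open>G\<close>; its core is \<open>D\<close>. In \<open>G/D\<close> the supplement
  of \<open>H/D\<close> is the whole group. By \<open>\<Phi>\<close>-regularity, applied to the primitive quotient of \<open>G\<close> by the core of
  \<open>M\<close>, all conjugates of the \<open>\<tau>\<close>-subgroup \<open>S\<close> are conjugates under \<open>Y\<close>, so they lie in \<open>H/D\<close> and \<open>S = 1\<close>.
  Hence \<open>H/D\<close> lies in the hypercentre, and \<open>P/D\<close> is cyclic.

  It follows that \<open>[F, G']\<close> lies in the Frattini subgroup, and a Frattini argument down the derived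
  series gives \<open>E \<inter> G' \<subseteq> F\<close>. So for every maximal subgroup \<open>M\<close> of \<open>G\<close> there are normal subgroups \<open>A \<subseteq> B\<close>
  of \<open>G\<close> with \<open>B/A\<close> cyclic, \<open>A \<subseteq> M\<close> and not \<open>B \<subseteq> M\<close>. This replaces the prime index condition in
  Huppert's theorem and suffices for supersolubility.
\<close>

section \<open>Commutators, normalisers and products\<close>

text \<open>Sections B/A are mostly handled inside G, and quotient groups appear only where the
  induction, the hypercentre or the functor demands them. The derived subgroup matters because
  automorphisms of a cyclic group commute: it centralises every cyclic factor. The obstacle in the
  condition on maximal subgroups is a minimal normal subgroup N contained in all of them, about
  which the condition says nothing. In a smallest bad quotient N is the only minimal normal
  subgroup, so normal q-subgroups are trivial for all primes q but one, p, and the Sylow p-subgroup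
  Y is normal and contains the derived subgroup. A nontrivial cyclic normal subgroup then comes
  either from a G-endomorphism of an abelian normal subgroup of Z(Y) above N, or from the commutator
  map on Y when Z(Y) = N. Regularity yields a normaliser of p-power index; together with a Sylow
  p-subgroup, whose index is prime to p, it makes up the whole group. In the other direction E = 1
  leaves no maximal subgroups to test, and the functor with only trivial values is the
  witness.\<close>

context group
begin

abbreviation cj :: "'a \<Rightarrow> 'a \<Rightarrow> 'a" where
  "cj g x \<equiv> g \<otimes> x \<otimes> inv g"

abbreviation sub :: "'a set \<Rightarrow> ('a, 'b) monoid_scheme" where
  "sub H \<equiv> G\<lparr>carrier := H\<rparr>"

abbreviation cm :: "'a \<Rightarrow> 'a \<Rightarrow> 'a" where
  "cm x y \<equiv> x \<otimes> y \<otimes> inv x \<otimes> inv y"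

lemma inv_mult_cancel [simp]: "x \<in> carrier G \<Longrightarrow> y \<in> carrier G \<Longrightarrow> inv x \<otimes> (x \<otimes> y) = y"
  by (simp flip: m_assoc)

lemma mult_inv_cancel [simp]: "x \<in> carrier G \<Longrightarrow> y \<in> carrier G \<Longrightarrow> x \<otimes> (inv x \<otimes> y) = y"
  by (simp flip: m_assoc)

lemmas conj_simps = m_assoc inv_mult_group

definition normalizes :: "'a set \<Rightarrow> 'a set \<Rightarrow> bool" where
  "normalizes Y D \<longleftrightarrow> (\<forall>y\<in>Y. \<forall>d\<in>D. cj y d \<in> D)"

lemma normal_iff_normalizes: "N \<lhd> G \<longleftrightarrow> subgroup N G \<and> normalizes (carrier G) N"
  by (auto simp: normal_inv_iff normalizes_def)

lemma normalD: "N \<lhd> G \<Longrightarrow> x \<in> N \<Longrightarrow> g \<in> carrier G \<Longrightarrow> cj g x \<in> N"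
  by (simp add: normal_inv_iff)

lemma normal_subset: "N \<lhd> G \<Longrightarrow> N \<subseteq> carrier G"
  using normal_imp_subgroup subgroup.subset by blast

lemma normalizesD: "normalizes Y D \<Longrightarrow> y \<in> Y \<Longrightarrow> d \<in> D \<Longrightarrow> cj y d \<in> D"
  by (simp add: normalizes_def)

lemma normal_imp_normalizes: "N \<lhd> G \<Longrightarrow> Y \<subseteq> carrier G \<Longrightarrow> normalizes Y N"
  by (auto simp: normalizes_def normal_inv_iff)

lemma subgroup_normalizes: "subgroup H G \<Longrightarrow> normalizes H H"
  by (simp add: normalizes_def subgroup.m_closed subgroup.m_inv_closed)

text \<open>Centralisers of sections, expressed inside \<open>G\<close>:
  \<open>cent_mod Y Y {\<one>}\<close> is the centre of \<open>Y\<close>,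
  \<open>cent_mod Y Y D\<close> the preimage of the centre of Y/D, and
  \<open>cent_mod (carrier G) H K\<close> the centraliser of H/K.\<close>

definition cent_mod :: "'a set \<Rightarrow> 'a set \<Rightarrow> 'a set \<Rightarrow> 'a set" where
  "cent_mod Y B D = {x \<in> Y. \<forall>b\<in>B. cm b x \<in> D}"

lemma cm_sym: "x \<in> carrier G \<Longrightarrow> y \<in> carrier G \<Longrightarrow> subgroup D G \<Longrightarrow> cm x y \<in> D \<Longrightarrow> cm y x \<in> D"
proof -
  assume a: "x \<in> carrier G" "y \<in> carrier G" "subgroup D G" "cm x y \<in> D"
  then have "inv (cm x y) \<in> D" by (simp add: subgroup.m_inv_closed)
  moreover have "inv (cm x y) = cm y x" using a by (simp add: conj_simps)
  ultimately show ?thesis by simp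
qed

lemma cm_in_normal:
  assumes "subgroup D G" "normalizes Y D" "d \<in> D" "y \<in> Y" "Y \<subseteq> carrier G"
  shows "cm d y \<in> D" "cm y d \<in> D"
proof -
  have c: "d \<in> carrier G" "y \<in> carrier G" using assms subgroup.mem_carrier by auto
  have "cj y d \<in> D" using assms normalizesD by blast
  then show 1: "cm y d \<in> D" using assms by (simp add: subgroup.m_closed subgroup.m_inv_closed)
  then show "cm d y \<in> D" using cm_sym c assms by blast
qed

lemma cm_in_normal_subgroup:
  assumes "D \<lhd> G" "x \<in> carrier G" "y \<in> carrier G" "x \<in> D \<or> y \<in> D"
  shows "cm x y \<in> D"
  using assms cm_in_normal[of D "carrier G"] normal_iff_normalizes by blast

text \<open>Closure comes from [b, xy] = [b, x] x[b, y]x^-1 and [b, x^-1] = x^-1 [b, x]^-1 x, which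
  use that \<open>Y\<close> normalises \<open>D\<close>. Later proofs show that a whole subgroup
  centralises something modulo \<open>D\<close> by checking generators against this
  subgroup.\<close>

lemma cent_mod_subgroup:
  assumes "subgroup Y G" "subgroup D G" "normalizes Y D" "B \<subseteq> carrier G"
  shows "subgroup (cent_mod Y B D) G"
proof (rule subgroupI)
  show "cent_mod Y B D \<subseteq> carrier G" using assms by (auto simp: cent_mod_def subgroup.mem_carrier)
  have "\<one> \<in> cent_mod Y B D" using assms by (auto simp: cent_mod_def subgroup.one_closed subsetD)
  then show "cent_mod Y B D \<noteq> {}" by blast
next
  fix x assume x: "x \<in> cent_mod Y B D"
  then have xY: "x \<in> Y" "x \<in> carrier G" using assms by (auto simp: cent_mod_def subgroup.mem_carrier)
  have "cm b (inv x) \<in> D" if b: "b \<in> B" for b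
  proof -
    have bc: "b \<in> carrier G" using b assms by blast
    have "inv (cm b x) \<in> D" using x b assms(2) by (auto simp: cent_mod_def subgroup.m_inv_closed)
    then have "cj (inv x) (inv (cm b x)) \<in> D"
      using assms(1,3) xY by (meson normalizesD subgroup.m_inv_closed)
    moreover have "cj (inv x) (inv (cm b x)) = cm b (inv x)" using xY bc by (simp add: conj_simps)
    ultimately show ?thesis by simp
  qed
  then show "inv x \<in> cent_mod Y B D" using xY assms(1) by (auto simp: cent_mod_def subgroup.m_inv_closed)
next
  fix x y assume x: "x \<in> cent_mod Y B D" and y: "y \<in> cent_mod Y B D"
  then have xY: "x \<in> Y" "x \<in> carrier G" "y \<in> Y" "y \<in> carrier G"
    using assms by (auto simp: cent_mod_def subgroup.mem_carrier)
  have "cm b (x \<otimes> y) \<in> D" if b: "b \<in> B" for b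
  proof -
    have bc: "b \<in> carrier G" using b assms by blast
    have "cm b x \<in> D" "cj x (cm b y) \<in> D" using x y b xY assms(3) normalizesD by (auto simp: cent_mod_def)
    then have "cm b x \<otimes> cj x (cm b y) \<in> D" using assms(2) by (simp add: subgroup.m_closed)
    moreover have "cm b x \<otimes> cj x (cm b y) = cm b (x \<otimes> y)" using xY bc by (simp add: conj_simps)
    ultimately show ?thesis by simp
  qed
  then show "x \<otimes> y \<in> cent_mod Y B D" using xY assms(1) by (auto simp: cent_mod_def subgroup.m_closed)
qed

lemma cj_inv_cancel: "g \<in> carrier G \<Longrightarrow> x \<in> carrier G \<Longrightarrow> cj g (cj (inv g) x) = x"
  by (simp add: conj_simps)

lemma cj_mult: "g \<in> carrier G \<Longrightarrow> x \<in> carrier G \<Longrightarrow> y \<in> carrier G \<Longrightarrow> cj g (x \<otimes> y) = cj g x \<otimes> cj g y"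
  by (simp add: conj_simps)

lemma cj_cm: "g \<in> carrier G \<Longrightarrow> x \<in> carrier G \<Longrightarrow> y \<in> carrier G \<Longrightarrow> cj g (cm x y) = cm (cj g x) (cj g y)"
  by (simp add: conj_simps)

lemma cj_cj: "g \<in> carrier G \<Longrightarrow> h \<in> carrier G \<Longrightarrow> x \<in> carrier G \<Longrightarrow> cj g (cj h x) = cj (g \<otimes> h) x"
  by (simp add: conj_simps)

lemma cj_int_pow:
  assumes "g \<in> carrier G" "x \<in> carrier G"
  shows "cj g (x [^] (i::int)) = (cj g x) [^] i"
proof -
  have "(\<lambda>x. cj g x) \<in> hom G G" using assms by (intro homI) (auto simp: cj_mult)
  then interpret h: group_hom G G "\<lambda>x. cj g x"
    by (simp add: group_hom_def group_hom_axioms_def is_group)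
  show ?thesis using h.hom_int_pow assms by blast
qed

lemma cent_mod_normalizes:
  assumes "subgroup Z G" "normalizes Z Y" "normalizes Z B" "normalizes Z D"
    "Y \<subseteq> carrier G" "B \<subseteq> carrier G"
  shows "normalizes Z (cent_mod Y B D)"
  unfolding normalizes_def
proof (intro ballI)
  fix z x assume z: "z \<in> Z" and x: "x \<in> cent_mod Y B D"
  have zc: "z \<in> carrier G" "inv z \<in> Z" using assms(1) z by (auto simp: subgroup.mem_carrier subgroup.m_inv_closed)
  have xc: "x \<in> Y" "x \<in> carrier G" using x assms by (auto simp: cent_mod_def)
  have "cm b (cj z x) \<in> D" if b: "b \<in> B" for b
  proof -
    have bc: "b \<in> carrier G" using b assms by blast
    let ?b = "cj (inv z) b"
    have "?b \<in> B" using assms(3) zc b normalizesD by blast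
    then have "cm ?b x \<in> D" using x by (simp add: cent_mod_def)
    then have "cj z (cm ?b x) \<in> D" using assms(4) z normalizesD by blast
    moreover have "cj z (cm ?b x) = cm b (cj z x)"
      using zc bc xc by (simp add: conj_simps)
    ultimately show ?thesis by simp
  qed
  then show "cj z x \<in> cent_mod Y B D" using xc z assms(2) normalizesD by (auto simp: cent_mod_def)
qed

lemma cent_mod_normal:
  assumes "Y \<lhd> G" "B \<lhd> G" "D \<lhd> G"
  shows "cent_mod Y B D \<lhd> G"
  using assms cent_mod_subgroup[of Y D B] cent_mod_normalizes[of "carrier G" Y B D]
  by (meson normal_iff_normalizes normal_imp_normalizes normal_subset subgroup_self)

lemmas normal_Int = normal_subgroup_intersect

lemma set_mult_mem: "x \<in> A <#> B \<longleftrightarrow> (\<exists>a\<in>A. \<exists>b\<in>B. x = a \<otimes> b)"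
  by (auto simp: set_mult_def)

lemma set_mult_subgroup:
  assumes A: "subgroup A G" and B: "subgroup B G" and n: "normalizes B A"
  shows "subgroup (A <#> B) G"
proof (rule subgroupI)
  show "A <#> B \<subseteq> carrier G" using A B by (simp add: setmult_subset_G subgroup.subset)
  show "A <#> B \<noteq> {}" using A B by (auto simp: set_mult_def dest: subgroup.one_closed)
next
  fix x assume "x \<in> A <#> B"
  then obtain a b where ab: "a \<in> A" "b \<in> B" "x = a \<otimes> b" by (auto simp: set_mult_mem)
  then have c: "a \<in> carrier G" "b \<in> carrier G" using subgroup.mem_carrier[OF A] subgroup.mem_carrier[OF B] by blast+
  have "cj (inv b) (inv a) \<in> A" using n ab A B by (meson normalizesD subgroup.m_inv_closed)
  moreover have "inv x = cj (inv b) (inv a) \<otimes> inv b" using ab c by (simp add: conj_simps)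
  ultimately show "inv x \<in> A <#> B" using ab B by (metis set_mult_mem subgroup.m_inv_closed)
next
  fix x y assume "x \<in> A <#> B" "y \<in> A <#> B"
  then obtain a b a' b' where ab: "a \<in> A" "b \<in> B" "x = a \<otimes> b" "a' \<in> A" "b' \<in> B" "y = a' \<otimes> b'"
    by (auto simp: set_mult_mem)
  then have c: "a \<in> carrier G" "b \<in> carrier G" "a' \<in> carrier G" "b' \<in> carrier G" using subgroup.mem_carrier[OF A] subgroup.mem_carrier[OF B] by blast+
  have "a \<otimes> cj b a' \<in> A" using n ab A by (meson normalizesD subgroup.m_closed)
  moreover have "x \<otimes> y = (a \<otimes> cj b a') \<otimes> (b \<otimes> b')" using ab c by (simp add: conj_simps)
  ultimately show "x \<otimes> y \<in> A <#> B" using ab B by (metis set_mult_mem subgroup.m_closed)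
qed

lemma set_mult_superset:
  assumes "subgroup A G" "subgroup B G"
  shows "A \<subseteq> A <#> B" "B \<subseteq> A <#> B"
proof -
  show "A \<subseteq> A <#> B"
  proof
    fix x assume "x \<in> A"
    then have "x = x \<otimes> \<one>" using assms subgroup.mem_carrier by force
    then show "x \<in> A <#> B" using \<open>x \<in> A\<close> assms(2) by (metis set_mult_mem subgroup.one_closed)
  qed
  show "B \<subseteq> A <#> B"
  proof
    fix x assume "x \<in> B"
    then have "x = \<one> \<otimes> x" using assms subgroup.mem_carrier by force
    then show "x \<in> A <#> B" using \<open>x \<in> B\<close> assms(1) by (metis set_mult_mem subgroup.one_closed)
  qed
qed

lemma set_mult_normal:
  assumes "A \<lhd> G" "B \<lhd> G"
  shows "A <#> B \<lhd> G"
proof -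
  have s: "subgroup A G" "subgroup B G" using assms normal_imp_subgroup by auto
  have "subgroup (A <#> B) G" using assms s by (meson normal_imp_normalizes set_mult_subgroup subgroup.subset)
  moreover have "cj g x \<in> A <#> B" if g: "g \<in> carrier G" and x: "x \<in> A <#> B" for g x
  proof -
    obtain a b where ab: "a \<in> A" "b \<in> B" "x = a \<otimes> b" using x by (auto simp: set_mult_mem)
    then have "a \<in> carrier G" "b \<in> carrier G" using subgroup.mem_carrier[OF s(1)] subgroup.mem_carrier[OF s(2)] by blast+
    then have "cj g x = cj g a \<otimes> cj g b" using ab g by (simp add: cj_mult)
    then show ?thesis using ab g assms normalD by (metis set_mult_mem)
  qed
  ultimately show ?thesis by (simp add: normal_inv_iff)
qed

end

locale fin_group = group +
  assumes fin: "finite (carrier G)"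

context fin_group
begin

lemma fin_subset: "A \<subseteq> carrier G \<Longrightarrow> finite A"
  using fin finite_subset by blast

lemma fin_subgroup: "subgroup A G \<Longrightarrow> finite A"
  using fin_subset subgroup.subset by blast

lemma card_subgroup_pos: "subgroup A G \<Longrightarrow> card A > 0"
  using fin_subgroup by (metis card_gt_0_iff empty_iff subgroup.one_closed)

lemma fin_group_subgroup: "subgroup H G \<Longrightarrow> fin_group (sub H)"
  by (simp add: fin_group_axioms_def fin_group_def fin_subgroup subgroup_imp_group)

lemma card_subgroup_dvd: 
  assumes "subgroup A G" "subgroup B G" "A \<subseteq> B" shows "card A dvd card B"
proof -
  interpret B: group "sub B" using assms(2) by (rule subgroup_imp_group)
  have "subgroup A (sub B)" using assms subgroup_incl by blast
  then have "card (rcosets\<^bsub>sub B\<^esub> A) * card A = card B" 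
    using B.lagrange by (auto simp: order_def)
  then show ?thesis by (metis dvd_triv_right)
qed

lemma subgroup_eq_card:
  assumes "subgroup A G" "subgroup B G" "A \<subseteq> B" "card B dvd card A"
  shows "A = B"
proof -
  have "card B \<le> card A" using assms card_subgroup_pos dvd_imp_le by blast
  then show ?thesis using assms fin_subgroup card_seteq[of B A] by blast
qed

lemma ex_maximal_set:
  assumes "P A" "\<And>K. P K \<Longrightarrow> K \<subseteq> carrier G"
  obtains M where "P M" "A \<subseteq> M" "\<And>K. P K \<Longrightarrow> M \<subseteq> K \<Longrightarrow> K = M"
proof -
  have "{K. P K} \<subseteq> Pow (carrier G)" using assms(2) by blast
  then have "finite {K. P K}" by (rule finite_subset) (simp add: fin)
  from finite_has_maximal2[OF this, of A] assms(1)
  obtain M where "M \<in> {K. P K}" "A \<subseteq> M" "\<forall>K\<in>{K. P K}. M \<subseteq> K \<longrightarrow> M = K" by auto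
  then show thesis using that[of M] by blast
qed

lemma ex_minimal_set:
  assumes "P A" "\<And>K. P K \<Longrightarrow> K \<subseteq> carrier G"
  obtains M where "P M" "M \<subseteq> A" "\<And>K. P K \<Longrightarrow> K \<subseteq> M \<Longrightarrow> K = M"
proof -
  have "{K. P K} \<subseteq> Pow (carrier G)" using assms(2) by blast
  then have "finite {K. P K}" by (rule finite_subset) (simp add: fin)
  from finite_has_minimal2[OF this, of A] assms(1)
  obtain M where "M \<in> {K. P K}" "M \<subseteq> A" "\<forall>K\<in>{K. P K}. K \<subseteq> M \<longrightarrow> M = K" by auto
  then show thesis using that[of M] by blast
qed

lemma ex_maximal_subgroup:
  assumes "subgroup H G" "H \<noteq> carrier G"
  shows "\<exists>M. maximal_subgroup G M \<and> H \<subseteq> M"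
proof -
  let ?P = "\<lambda>K. subgroup K G \<and> K \<noteq> carrier G"
  obtain M where M: "?P M" "H \<subseteq> M" "\<And>K. ?P K \<Longrightarrow> M \<subseteq> K \<Longrightarrow> K = M"
    using ex_maximal_set[of ?P H] assms subgroup.subset by metis
  then have "maximal_subgroup G M" unfolding maximal_subgroup_def by blast
  then show ?thesis using M(2) by blast
qed

lemma maximal_mult:
  assumes "maximal_subgroup G M" "B \<lhd> G" "\<not> B \<subseteq> M"
  shows "B <#> M = carrier G"
proof -
  have s: "subgroup M G" "subgroup B G" using assms by (auto simp: maximal_subgroup_def normal_imp_subgroup)
  have "subgroup (B <#> M) G" using assms s by (meson normal_imp_normalizes set_mult_subgroup subgroup.subset)
  moreover have "M \<subseteq> B <#> M" "B \<subseteq> B <#> M" using set_mult_superset s by auto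
  ultimately show ?thesis using assms unfolding maximal_subgroup_def by blast
qed

end

section \<open>Actions of \<open>p\<close>-groups and Sylow subgroups\<close>

text \<open>Orbit lengths divide p^k, so without fixed points every orbit length is a multiple of p,
  and so is the size of their disjoint union \<open>S\<close>. The action is a plain function, so
  that it can be instantiated with conjugation and with translation of cosets.\<close>

lemma p_group_fixed_point:
  fixes act :: "'a \<Rightarrow> 's \<Rightarrow> 's"
  assumes "group G" "Factorial_Ring.prime p" "card (carrier G) = p ^ k" "finite S" "\<not> p dvd card S"
    and closed: "\<And>y s. y \<in> carrier G \<Longrightarrow> s \<in> S \<Longrightarrow> act y s \<in> S"
    and one: "\<And>s. s \<in> S \<Longrightarrow> act \<one>\<^bsub>G\<^esub> s = s"
    and mult: "\<And>x y s. x \<in> carrier G \<Longrightarrow> y \<in> carrier G \<Longrightarrow> s \<in> S \<Longrightarrow> act (x \<otimes>\<^bsub>G\<^esub> y) s = act x (act y s)"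
  shows "\<exists>s\<in>S. \<forall>y\<in>carrier G. act y s = s"
proof (rule ccontr)
  assume nofix: "\<not> ?thesis"
  interpret group G by fact
  \<comment> \<open>Members of \<open>BijGroup S\<close> are \<open>undefined\<close> outside
    \<open>S\<close>, hence the restriction.\<close>
  define \<phi> where "\<phi> y = restrict (act y) S" for y
  have inverse: "act (inv\<^bsub>G\<^esub> y) (act y s) = s" "act y (act (inv\<^bsub>G\<^esub> y) s) = s" if "y \<in> carrier G" "s \<in> S" for y s
    using that one by (simp_all flip: mult)
  have bij: "bij_betw (act y) S S" if "y \<in> carrier G" for y
    using that inverse closed by (intro bij_betw_byWitness[where f' = "act (inv\<^bsub>G\<^esub> y)"]) auto
  have Bij: "\<phi> y \<in> carrier (BijGroup S)" if "y \<in> carrier G" for y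
    using bij[OF that] by (simp add: \<phi>_def BijGroup_def Bij_def cong: bij_betw_cong)
  interpret A: group_action G S \<phi>
    unfolding group_action_def group_hom_def group_hom_axioms_def
  proof (intro conjI)
    show "Group.group G" by (rule is_group)
    show "Group.group (BijGroup S)" by (rule group_BijGroup)
    show "\<phi> \<in> hom G (BijGroup S)"
    proof (rule homI)
      fix x y assume xy: "x \<in> carrier G" "y \<in> carrier G"
      show "\<phi> (x \<otimes>\<^bsub>G\<^esub> y) = \<phi> x \<otimes>\<^bsub>BijGroup S\<^esub> \<phi> y"
        using xy Bij[of x] Bij[of y] mult closed
        by (auto simp: \<phi>_def BijGroup_def compose_def restrict_def fun_eq_iff)
    qed (rule Bij)
  qed
  have "p dvd card (orbit G \<phi> s)" if s: "s \<in> S" for s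
  proof -
    have fin: "finite (orbit G \<phi> s)"
    proof (rule finite_subset)
      show "orbit G \<phi> s \<subseteq> S" using s closed by (auto simp: orbit_def \<phi>_def)
    qed fact
    have "card (orbit G \<phi> s) dvd p ^ k"
      using A.orbit_stabilizer_theorem[OF s] assms(3) by (metis dvd_triv_left order_def)
    then obtain j where j: "card (orbit G \<phi> s) = p ^ j" 
      using divides_primepow_nat[OF assms(2)] by blast
    obtain y where y: "y \<in> carrier G" "act y s \<noteq> s" using nofix s by blast
    have "act y s \<in> orbit G \<phi> s" using y s by (force simp: orbit_def \<phi>_def)
    moreover have "s \<in> orbit G \<phi> s" using A.orbit_refl s by blast
    ultimately have "card (orbit G \<phi> s) \<noteq> 1" using y(2) by (metis card_1_singletonE singletonD)
    then show ?thesis using j by (cases j) auto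
  qed
  then have "\<forall>c\<in>orbits G S \<phi>. p dvd card c" by (auto simp: orbits_def)
  moreover have "\<forall>c1\<in>orbits G S \<phi>. \<forall>c2\<in>orbits G S \<phi>. c1 \<noteq> c2 \<longrightarrow> c1 \<inter> c2 = {}"
    using A.disjoint_union by meson
  moreover have "finite (\<Union> (orbits G S \<phi>))" using A.orbits_coverture assms(4) by simp
  ultimately have "p dvd card (\<Union> (orbits G S \<phi>))" by (intro dvd_partition) 
  then show False using assms(5) A.orbits_coverture by simp
qed

context fin_group
begin

lemma card_rcosets_subgroup:
  assumes "subgroup A G" "subgroup B G" "A \<subseteq> B"
  shows "card (rcosets\<^bsub>sub B\<^esub> A) * card A = card B"
proof -
  interpret B: group "sub B" using assms(2) by (rule subgroup_imp_group)
  have "subgroup A (sub B)" using assms subgroup_incl by blast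
  then show ?thesis using B.lagrange by (auto simp: order_def)
qed

lemma cj_image_rcoset:
  assumes A: "subgroup A G" and Y: "subgroup Y G" and n: "normalizes Y A" and y: "y \<in> Y" and b: "b \<in> carrier G"
  shows "cj y ` (A #> b) = A #> cj y b"
proof -
  have yc: "y \<in> carrier G" by (rule subgroup.mem_carrier[OF Y y])
  show ?thesis
  proof
    show "cj y ` (A #> b) \<subseteq> A #> cj y b"
    proof
      fix x assume "x \<in> cj y ` (A #> b)"
      then obtain a where a: "a \<in> A" "x = cj y (a \<otimes> b)" by (auto simp: r_coset_def)
      have "x = cj y a \<otimes> cj y b" using a yc b A by (simp add: cj_mult subgroup.mem_carrier)
      then show "x \<in> A #> cj y b" using a y n normalizesD by (auto simp: r_coset_def)
    qed
    show "A #> cj y b \<subseteq> cj y ` (A #> b)"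
    proof
      fix x assume "x \<in> A #> cj y b"
      then obtain a where a: "a \<in> A" "x = a \<otimes> cj y b" by (auto simp: r_coset_def)
      have ac: "a \<in> carrier G" using subgroup.mem_carrier[OF A a(1)] .
      let ?a = "cj (inv y) a"
      have "?a \<in> A" using a y n Y by (meson normalizesD subgroup.m_inv_closed)
      moreover have "x = cj y (?a \<otimes> b)" using a yc b ac by (simp add: conj_simps)
      ultimately show "x \<in> cj y ` (A #> b)" by (auto simp: r_coset_def)
    qed
  qed
qed

text \<open>\<open>Y\<close> permutes the cosets of \<open>A\<close> in \<open>B\<close>, whose
  number is a positive power of p. The coset \<open>A\<close> is fixed, so another coset
  \<open>A #> b\<close> is fixed too, and this means that [b, y] lies in \<open>A\<close> for all y
  in \<open>Y\<close>.\<close>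

lemma p_group_central_step:
  assumes p: "Factorial_Ring.prime p" and Y: "subgroup Y G" "card Y = p ^ k"
    and A: "subgroup A G" "normalizes Y A" and B: "subgroup B G" "normalizes Y B"
    and AB: "A \<subset> B" "B \<subseteq> Y"
  shows "\<exists>x\<in>B - A. \<forall>y\<in>Y. cm x y \<in> A"
proof -
  interpret Yg: group "sub Y" using Y(1) by (rule subgroup_imp_group)
  note Bc = subgroup.subset[OF B(1)]
  note Yc = subgroup.subset[OF Y(1)]
  define R where "R = rcosets\<^bsub>sub B\<^esub> A"
  have R: "R = (\<lambda>b. A #> b) ` B" by (auto simp: R_def RCOSETS_def r_coset_def)
  have cR: "card R * card A = card B" using card_rcosets_subgroup[OF A(1) B(1)] AB(1) unfolding R_def by blast
  have finR: "finite R" using R fin_subgroup[OF B(1)] by simp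
  have AR: "A \<in> R"
  proof -
    have "A = A #> \<one>" using A(1) by (simp add: subgroup.subset)
    then show ?thesis using R subgroup.one_closed[OF B(1)] by blast
  qed
  have eqA: "A #> b = A \<longleftrightarrow> b \<in> A" if "b \<in> carrier G" for b
    using that A(1) by (metis coset_join1 coset_join2 subgroup.subset)
  have "card B dvd p ^ k" using card_subgroup_dvd B(1) Y AB(2) by metis
  then have "card R dvd p ^ k" using cR by (metis dvd_trans dvd_triv_left)
  then obtain j where j: "card R = p ^ j" using divides_primepow_nat[OF p] by blast
  have "card R \<noteq> 1"
  proof
    assume "card R = 1"
    then have "card A = card B" using cR by simp
    then show False using AB(1) fin_subgroup[OF B(1)] by (metis psubset_card_mono less_irrefl)
  qed
  then have pR: "p dvd card R" using j by (cases j) auto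
  \<comment> \<open>Without the fixed coset \<open>A\<close> the number of cosets is -1 modulo p, so
    the fixed point found below is a nontrivial one.\<close>
  define S where "S = R - {A}"
  have cS: "card R = Suc (card S)" using AR finR unfolding S_def by (metis card.remove)
  have npS: "\<not> p dvd card S"
  proof
    assume "p dvd card S"
    then have "p dvd 1" using pR cS by (metis Suc_eq_plus1 dvd_add_right_iff)
    then show False using p by (simp add: prime_nat_iff)
  qed
  have inS: "s \<in> S \<longleftrightarrow> (\<exists>b\<in>B - A. s = A #> b)" for s using eqA Bc by (auto simp: S_def R)
  have "\<exists>s\<in>S. \<forall>y\<in>carrier (sub Y). (\<lambda>y Z. cj y ` Z) y s = s"
  proof (rule p_group_fixed_point[where p = p and k = k])
    show "group (sub Y)" by (rule Yg.is_group)
    show "Factorial_Ring.prime p" "card (carrier (sub Y)) = p ^ k" "finite S" "\<not> p dvd card S"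
      using p Y npS finR by (auto simp: S_def)
  next
    fix y s assume "y \<in> carrier (sub Y)" "s \<in> S"
    then obtain b where b: "y \<in> Y" "b \<in> B - A" "s = A #> b" using inS by auto
    then have "cj y ` s = A #> cj y b" using cj_image_rcoset[OF A(1) Y(1) A(2), of y b] Bc by blast
    moreover have "cj y b \<in> B" using normalizesD[OF B(2), of y b] b by simp
    moreover have "cj y b \<notin> A"
    proof
      assume "cj y b \<in> A"
      then have "cj (inv y) (cj y b) \<in> A" using A(2) Y(1) b by (meson normalizesD subgroup.m_inv_closed)
      moreover have "cj (inv y) (cj y b) = b" using b Bc Yc by (simp add: conj_simps subsetD)
      ultimately show False using b by simp
    qed
    ultimately show "cj y ` s \<in> S" using inS by blast
  next
    fix s assume "s \<in> S"
    then have "s \<subseteq> carrier G" using inS A(1) Bc by (auto simp: r_coset_def subgroup.mem_carrier)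
    then show "cj \<one>\<^bsub>sub Y\<^esub> ` s = s" by (force simp: image_def)
  next
    fix x y s assume xy: "x \<in> carrier (sub Y)" "y \<in> carrier (sub Y)" "s \<in> S"
    then have "s \<subseteq> carrier G" using inS A(1) Bc by (auto simp: r_coset_def subgroup.mem_carrier)
    then show "cj (x \<otimes>\<^bsub>sub Y\<^esub> y) ` s = cj x ` cj y ` s"
      using xy Yc unfolding image_image by (intro image_cong) (auto simp: conj_simps subsetD)
  qed
  then obtain b where b: "b \<in> B - A" "\<forall>y\<in>Y. cj y ` (A #> b) = A #> b" using inS by auto
  have bc: "b \<in> carrier G" using b Bc by blast
  have "cm b y \<in> A" if y: "y \<in> Y" for y
  proof -
    have yc: "y \<in> carrier G" using y Yc by blast
    have "A #> cj y b = A #> b" using b y cj_image_rcoset[OF A(1) Y(1) A(2) y bc] by simp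
    then have "cj y b \<in> A #> b" using rcos_self[of "cj y b" A] A(1) yc bc by simp
    then obtain a where "a \<in> A" "cj y b = a \<otimes> b" by (auto simp: r_coset_def)
    then have "cm y b = a" using bc yc A(1) by (simp add: conj_simps subgroup.mem_carrier)
    then show ?thesis using \<open>a \<in> A\<close> cm_sym yc bc A(1) by blast
  qed
  then show ?thesis using b by blast
qed

text \<open>\<open>R\<close> acts on the right cosets of \<open>Y\<close> by multiplication with
  \<open>inv r\<close> from the right, and their number is prime to p; a fixed coset
  \<open>Y #> g\<close> says that g conjugates \<open>R\<close> into \<open>Y\<close>.\<close>

lemma sylow_contains_conjugate:
  assumes p: "Factorial_Ring.prime p" and R: "subgroup R G" "card R = p ^ k" and Y: "subgroup Y G"
    and index: "\<not> p dvd card (rcosets Y)"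
  shows "\<exists>g\<in>carrier G. \<forall>r\<in>R. cj g r \<in> Y"
proof -
  interpret Rg: group "sub R" using R(1) by (rule subgroup_imp_group)
  note Rc = subgroup.subset[OF R(1)]
  note Yc = subgroup.subset[OF Y(1)]
  have "\<exists>s\<in>rcosets Y. \<forall>r\<in>carrier (sub R). (\<lambda>r Z. Z #> inv r) r s = s"
  proof (rule p_group_fixed_point[where p = p and k = k])
    show "group (sub R)" by (rule Rg.is_group)
    show "finite (rcosets Y)" using fin by (simp add: RCOSETS_def)
  next
    fix r s assume "r \<in> carrier (sub R)" "s \<in> rcosets Y"
    then show "s #> inv r \<in> rcosets Y" using Rc Yc by (auto simp: RCOSETS_def coset_mult_assoc subsetD)
  next
    fix s assume "s \<in> rcosets Y"
    then show "s #> inv \<one>\<^bsub>sub R\<^esub> = s" using subgroup.rcosets_carrier[OF Y is_group] by simp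
  next
    fix x y s assume xy: "x \<in> carrier (sub R)" "y \<in> carrier (sub R)" "s \<in> rcosets Y"
    then have "s \<subseteq> carrier G" using xy(3) subgroup.rcosets_carrier[OF Y is_group] by blast
    then show "s #> inv (x \<otimes>\<^bsub>sub R\<^esub> y) = s #> inv y #> inv x"
      using xy Rc by (auto simp: coset_mult_assoc inv_mult_group subsetD)
  qed (use assms in auto)
  then obtain g where g: "g \<in> carrier G" "\<And>r. r \<in> R \<Longrightarrow> Y #> g #> inv r = Y #> g"
    by (auto simp: RCOSETS_def)
  have "cj g r \<in> Y" if r: "r \<in> R" for r
  proof -
    have rc: "inv r \<in> R" "r \<in> carrier G" using r R(1) by (auto simp: subgroup.mem_carrier subgroup.m_inv_closed)
    have "Y #> (g \<otimes> r) = Y #> g" using g(2)[OF rc(1)] rc g(1) Yc by (simp add: coset_mult_assoc)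
    then have "g \<otimes> r \<in> Y #> g" using rcos_self[of "g \<otimes> r" Y] Y rc g(1) by simp
    then obtain y where "y \<in> Y" "g \<otimes> r = y \<otimes> g" by (auto simp: r_coset_def)
    then have "cj g r = y" using rc g(1) Yc by (simp add: conj_simps subsetD)
    then show ?thesis using \<open>y \<in> Y\<close> by simp
  qed
  then show ?thesis using g(1) by blast
qed

lemma sylow_index:
  assumes "sylow_subgroup G p P"
  shows "\<not> p dvd card (rcosets P)"
proof
  assume d: "p dvd card (rcosets P)"
  have P: "subgroup P G" "card P = p ^ multiplicity p (card (carrier G))" "Factorial_Ring.prime p"
    using assms by (auto simp: sylow_subgroup_def)
  have "card (rcosets P) * card P = card (carrier G)" using lagrange[OF P(1)] by (simp add: order_def)
  then have "p ^ Suc (multiplicity p (card (carrier G))) dvd card (carrier G)"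
    using d P(2) by (metis mult_dvd_mono dvd_refl power_Suc)
  moreover have "card (carrier G) \<noteq> 0" using fin by (metis card_eq_0_iff empty_iff one_closed)
  moreover have "\<not> is_unit p" using P(3) by (simp add: prime_nat_iff)
  ultimately show False by (metis multiplicity_geI not_less_eq_eq order_refl)
qed

lemma ex_sylow:
  assumes p: "Factorial_Ring.prime p"
  shows "\<exists>P. sylow_subgroup G p P"
proof -
  have "card (carrier G) = p ^ multiplicity p (card (carrier G)) * (card (carrier G) div p ^ multiplicity p (card (carrier G)))"
    by (simp add: multiplicity_dvd)
  then obtain P where "subgroup P G" "card P = p ^ multiplicity p (card (carrier G))"
    using sylow_thm[OF p is_group _ fin] unfolding order_def by blast
  then show ?thesis using p by (auto simp: sylow_subgroup_def)
qed

lemma sylow_subgroup_carrierD: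
  assumes "subgroup K G" "sylow_subgroup (sub K) p Q"
  shows "Factorial_Ring.prime p" "subgroup Q G" "Q \<subseteq> K" "card Q = p ^ multiplicity p (card K)"
  using assms incl_subgroup[of K Q] subgroup.subset[of Q "sub K"] by (auto simp: sylow_subgroup_def)

lemma normal_p_subgroup_in_sylow:
  assumes "sylow_subgroup G p Y" "R \<lhd> G" "card R = p ^ k"
  shows "R \<subseteq> Y"
proof -
  have Y: "Factorial_Ring.prime p" "subgroup Y G" using assms by (auto simp: sylow_subgroup_def)
  have R: "subgroup R G" by (rule normal_imp_subgroup[OF assms(2)])
  obtain g where g: "g \<in> carrier G" "\<forall>r\<in>R. cj g r \<in> Y"
    using sylow_contains_conjugate[OF Y(1) R assms(3) Y(2) sylow_index[OF assms(1)]] by blast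
  show ?thesis
  proof
    fix r assume r: "r \<in> R"
    then have "cj (inv g) r \<in> R" using normalD[OF assms(2) r, of "inv g"] g(1) by simp
    then have "cj g (cj (inv g) r) \<in> Y" using g by blast
    then show "r \<in> Y" using cj_inv_cancel[of g r] g(1) r R subgroup.mem_carrier by metis
  qed
qed

lemma cj_image_eq:
  assumes Q: "subgroup Q G" and g: "g \<in> carrier G" and sub: "\<And>x. x \<in> Q \<Longrightarrow> cj g x \<in> Q"
  shows "cj g ` Q = Q"
proof (rule card_seteq)
  show "finite Q" using Q by (rule fin_subgroup)
  show "cj g ` Q \<subseteq> Q" using sub by blast
  have "inj_on (cj g) Q" using g Q by (auto intro!: inj_onI simp: subgroup.mem_carrier)
  then show "card Q \<le> card (cj g ` Q)" by (simp add: card_image)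
qed

lemma normalizer_iff:
  assumes Q: "subgroup Q G"
  shows "g \<in> normalizer G Q \<longleftrightarrow> g \<in> carrier G \<and> (\<forall>x\<in>Q. cj g x \<in> Q)"
proof -
  have "g <# Q #> inv g = cj g ` Q" by (auto simp: l_coset_def r_coset_def)
  moreover have "Q \<subseteq> carrier G" by (rule subgroup.subset[OF Q])
  ultimately have "g \<in> normalizer G Q \<longleftrightarrow> g \<in> carrier G \<and> cj g ` Q = Q"
    by (auto simp: normalizer_def stabilizer_def)
  then show ?thesis using cj_image_eq[OF Q] by blast
qed

lemma normalizer_subgroup: "subgroup Q G \<Longrightarrow> subgroup (normalizer G Q) G"
  by (simp add: normalizer_imp_subgroup subgroup.subset)

text \<open>The conjugate of \<open>Q\<close> by g is again a Sylow subgroup of \<open>K\<close>, so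
  some k in \<open>K\<close> conjugates it back into \<open>Q\<close>, and
  \<open>k \<otimes> g\<close> normalises \<open>Q\<close>.\<close>

lemma frattini:
  assumes K: "K \<lhd> G" and Q: "sylow_subgroup (sub K) p Q" and g: "g \<in> carrier G"
  shows "\<exists>k\<in>K. \<exists>n\<in>normalizer G Q. g = k \<otimes> n"
proof -
  have Ks: "subgroup K G" by (rule normal_imp_subgroup[OF K])
  interpret Kg: fin_group "sub K" using Ks by (rule fin_group_subgroup)
  note Qs = sylow_subgroup_carrierD[OF Ks Q]
  note Qc = subgroup.subset[OF Qs(2)]
  note Kc = subgroup.subset[OF Ks]
  let ?R = "cj g ` Q"
  have hom: "group_hom G G (cj g)"
    unfolding group_hom_def group_hom_axioms_def using g by (auto intro!: homI simp: is_group cj_mult)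
  have R: "subgroup ?R G" by (rule group_hom.subgroup_img_is_subgroup[OF hom Qs(2)])
  have RK: "?R \<subseteq> K" using normalD[OF K _ g] Qs(3) by blast
  have "inj_on (cj g) Q" using g Qc by (auto intro!: inj_onI simp: subsetD)
  then have cR: "card ?R = p ^ multiplicity p (card K)" using Qs(4) by (simp add: card_image)
  have RKs: "subgroup ?R (sub K)" by (rule subgroup_incl[OF R Ks RK])
  have QKs: "subgroup Q (sub K)" using Q by (auto simp: sylow_subgroup_def)
  obtain k where k: "k \<in> K" "\<forall>r\<in>?R. k \<otimes>\<^bsub>sub K\<^esub> r \<otimes>\<^bsub>sub K\<^esub> inv\<^bsub>sub K\<^esub> k \<in> Q"
    using Kg.sylow_contains_conjugate[OF Qs(1) RKs cR QKs Kg.sylow_index[OF Q]] by auto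
  have kc: "k \<in> carrier G" using k Kc by blast
  have "cj k r \<in> Q" if "r \<in> ?R" for r using k that m_inv_consistent[OF Ks k(1)] by auto
  then have "cj k (cj g x) \<in> Q" if "x \<in> Q" for x using that by blast
  then have "cj (k \<otimes> g) x \<in> Q" if "x \<in> Q" for x using that cj_cj[of k g x] kc g Qc by (metis subsetD)
  then have "k \<otimes> g \<in> normalizer G Q" using normalizer_iff[OF Qs(2)] kc g by simp
  moreover have "inv k \<in> K" using subgroup.m_inv_closed[OF Ks k(1)] .
  moreover have "g = inv k \<otimes> (k \<otimes> g)" using kc g by simp
  ultimately show ?thesis by blast
qed

end

section \<open>Normal Sylow subgroups and the Fitting subgroup\<close>

context group
begin

section \<open>Cores, and intersections of normal subgroups with supplements\<close>

lemma mem_core_iff: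
  assumes "H \<subseteq> carrier G"
  shows "x \<in> core G H \<longleftrightarrow> x \<in> carrier G \<and> (\<forall>g\<in>carrier G. cj g x \<in> H)"
proof -
  have eq: "x \<in> g <# H #> inv g \<longleftrightarrow> cj (inv g) x \<in> H" if g: "g \<in> carrier G" and x: "x \<in> carrier G" for g
  proof
    assume "x \<in> g <# H #> inv g"
    then obtain h where "h \<in> H" "x = cj g h" by (auto simp: l_coset_def r_coset_def)
    then show "cj (inv g) x \<in> H" using g assms by (simp add: conj_simps subsetD)
  next
    assume "cj (inv g) x \<in> H"
    moreover have "x = cj g (cj (inv g) x)" using cj_inv_cancel[OF g x] by (rule sym)
    ultimately show "x \<in> g <# H #> inv g" by (auto simp: l_coset_def r_coset_def)
  qed
  show ?thesis
  proof
    assume "x \<in> core G H"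
    then have x: "x \<in> carrier G" "\<forall>g\<in>carrier G. cj (inv g) x \<in> H" using eq by (auto simp: core_def)
    then have "cj (inv (inv g)) x \<in> H" if "g \<in> carrier G" for g using that inv_closed by blast
    then show "x \<in> carrier G \<and> (\<forall>g\<in>carrier G. cj g x \<in> H)" using x by simp
  next
    assume "x \<in> carrier G \<and> (\<forall>g\<in>carrier G. cj g x \<in> H)"
    then have x: "x \<in> carrier G" "\<And>g. g \<in> carrier G \<Longrightarrow> cj g x \<in> H" by auto
    then have "x \<in> g <# H #> inv g" if "g \<in> carrier G" for g using eq[OF that x(1)] x(2)[of "inv g"] that by simp
    then show "x \<in> core G H" using x by (simp add: core_def)
  qed
qed

lemma core_subset: "H \<subseteq> carrier G \<Longrightarrow> core G H \<subseteq> H"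
proof
  fix x assume "H \<subseteq> carrier G" "x \<in> core G H"
  then have "x \<in> carrier G" "cj \<one> x \<in> H" using mem_core_iff by blast+
  then show "x \<in> H" by simp
qed

lemma core_normal:
  assumes H: "subgroup H G"
  shows "core G H \<lhd> G"
proof (rule normal_invI)
  note c = mem_core_iff[OF subgroup.subset[OF H]]
  show "subgroup (core G H) G"
  proof (rule subgroupI)
    show "core G H \<subseteq> carrier G" by (auto simp: core_def)
    have "\<one> \<in> core G H" using H by (simp add: c subgroup.one_closed)
    then show "core G H \<noteq> {}" by blast
  next
    fix x assume "x \<in> core G H"
    then have x: "x \<in> carrier G" "\<forall>g\<in>carrier G. cj g x \<in> H" by (auto simp: c)
    have "cj g (inv x) = inv (cj g x)" if "g \<in> carrier G" for g using that x by (simp add: conj_simps)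
    then show "inv x \<in> core G H" using x H by (simp add: c subgroup.m_inv_closed)
  next
    fix x y assume "x \<in> core G H" "y \<in> core G H"
    then show "x \<otimes> y \<in> core G H" using H by (simp add: c cj_mult subgroup.m_closed)
  qed
next
  note c = mem_core_iff[OF subgroup.subset[OF H]]
  fix g x assume g: "g \<in> carrier G" and "x \<in> core G H"
  then have x: "x \<in> carrier G" "\<forall>g\<in>carrier G. cj g x \<in> H" by (auto simp: c)
  have "cj h (cj g x) \<in> H" if "h \<in> carrier G" for h using cj_cj[OF that g x(1)] x that g by simp
  then show "cj g x \<in> core G H" using g x by (simp add: c)
qed

lemma normal_subset_core:
  assumes "N \<lhd> G" "N \<subseteq> H" "H \<subseteq> carrier G" shows "N \<subseteq> core G H"
proof
  fix x assume x: "x \<in> N"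
  then have "cj g x \<in> H" if "g \<in> carrier G" for g using normalD[OF assms(1) x that] assms(2) by blast
  then show "x \<in> core G H" unfolding mem_core_iff[OF assms(3)] using x normal_subset[OF assms(1)] by blast
qed

text \<open>Since G = BM and \<open>M\<close> normalises \<open>K \<inter> M\<close>, only
  conjugation by b in \<open>B\<close> has to be checked; it sends y to [b, y]y, which stays in
  \<open>M\<close>.\<close>

lemma maximal_Int_normal:
  assumes M: "subgroup M G" "B <#> M = carrier G" and K: "K \<lhd> G" and B: "B \<subseteq> K"
    and c: "\<And>b k. b \<in> B \<Longrightarrow> k \<in> K \<inter> M \<Longrightarrow> cm b k \<in> M"
  shows "K \<inter> M \<lhd> G"
proof (rule normal_invI)
  show "subgroup (K \<inter> M) G" by (rule subgroups_Inter_pair[OF normal_imp_subgroup[OF K] M(1)])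
next
  fix g x assume g: "g \<in> carrier G" and x: "x \<in> K \<inter> M"
  have Kc: "K \<subseteq> carrier G" and Mc: "M \<subseteq> carrier G" using normal_subset[OF K] subgroup.subset[OF M(1)] by auto
  obtain b m where bm: "b \<in> B" "m \<in> M" "g = b \<otimes> m" using g M(2) set_mult_mem by blast
  have cc: "b \<in> carrier G" "m \<in> carrier G" "x \<in> carrier G" using bm x Kc Mc B by auto
  let ?y = "cj m x"
  have y: "?y \<in> K \<inter> M" 
    using normalD[OF K _ cc(2), of x] x normalizesD[OF subgroup_normalizes[OF M(1)] bm(2), of x] by blast
  have "cm b ?y \<otimes> ?y \<in> M" using subgroup.m_closed[OF M(1) c[OF bm(1) y], of ?y] y by blast
  moreover have "cm b ?y \<otimes> ?y = cj g x" using bm cc by (simp add: conj_simps)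
  moreover have "cj g x \<in> K" using normalD[OF K _ g] x by blast
  ultimately show "cj g x \<in> K \<inter> M" by simp
qed

text \<open>This holds if \<open>K\<close> is nilpotent modulo the Frattini subgroup of \<open>G\<close>. It is what the Frattini argument
  needs to make the Sylow subgroups of \<open>K\<close> normal in \<open>G\<close>.\<close>

definition nilp_over_maximal :: "'a set \<Rightarrow> bool" where
  "nilp_over_maximal K \<longleftrightarrow> (\<forall>M. maximal_subgroup G M \<and> \<not> K \<subseteq> M \<longrightarrow>
     (\<exists>B. B \<lhd> G \<and> B \<subseteq> K \<and> \<not> B \<subseteq> M \<and> (\<forall>b\<in>B. \<forall>k\<in>K. cm b k \<in> M)))"

lemma cm_in_comm_subgroup: "x \<in> A \<Longrightarrow> y \<in> B \<Longrightarrow> cm x y \<in> comm_subgroup G A B"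
  unfolding comm_subgroup_def by (rule generate.incl) blast

lemma cm_in_derived: "x \<in> H \<Longrightarrow> y \<in> H \<Longrightarrow> cm x y \<in> derived G H"
  unfolding derived_def by (rule generate.incl) blast

lemma comm_subgroup_subset:
  assumes "subgroup S G" "\<And>x y. x \<in> A \<Longrightarrow> y \<in> B \<Longrightarrow> cm x y \<in> S"
  shows "comm_subgroup G A B \<subseteq> S"
  unfolding comm_subgroup_def by (rule generate_subgroup_incl[OF _ assms(1)]) (use assms(2) in blast)

lemma comm_subgroup_normal:
  assumes A: "A \<lhd> G" and B: "B \<lhd> G"
  shows "comm_subgroup G A B \<lhd> G"
  unfolding comm_subgroup_def
proof (rule normal_generateI)
  have c: "A \<subseteq> carrier G" "B \<subseteq> carrier G" using normal_subset[OF A] normal_subset[OF B] by auto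
  then show "{cm x y |x y. x \<in> A \<and> y \<in> B} \<subseteq> carrier G" by blast
  fix h g assume "h \<in> {cm x y |x y. x \<in> A \<and> y \<in> B}" and g: "g \<in> carrier G"
  then obtain x y where xy: "x \<in> A" "y \<in> B" "h = cm x y" by blast
  then have "cj g h = cm (cj g x) (cj g y)" using cj_cm g c by blast
  then show "cj g h \<in> {cm x y |x y. x \<in> A \<and> y \<in> B}" using normalD[OF A xy(1) g] normalD[OF B xy(2) g] by blast
qed

lemma comm_subgroup_consistent:
  assumes "subgroup K G" "A \<subseteq> K" "B \<subseteq> K"
  shows "comm_subgroup (sub K) A B = comm_subgroup G A B"
proof -
  have e: "inv\<^bsub>sub K\<^esub> x = inv x" if "x \<in> A \<or> x \<in> B" for x
    using m_inv_consistent[OF assms(1)] that assms by blast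
  have "{x \<otimes> y \<otimes> inv\<^bsub>sub K\<^esub> x \<otimes> inv\<^bsub>sub K\<^esub> y | x y. x \<in> A \<and> y \<in> B} = {cm x y |x y. x \<in> A \<and> y \<in> B}"
    using e by (intro Collect_cong arg_cong[where f = Ex] ext) auto
  moreover have "{cm x y |x y. x \<in> A \<and> y \<in> B} \<subseteq> K"
    using assms by (auto intro!: subgroup.m_closed[OF assms(1)] subgroup.m_inv_closed[OF assms(1)])
  ultimately show ?thesis unfolding comm_subgroup_def using generate_consistent[OF _ assms(1)] by simp
qed

lemma lower_central_normal:
  assumes K: "K \<lhd> G"
  shows "lower_central (sub K) n \<lhd> G \<and> lower_central (sub K) n \<subseteq> K"
proof (induction n)
  case (Suc n)
  note s = normal_imp_subgroup[OF K]
  have eq: "lower_central (sub K) (Suc n) = comm_subgroup G (lower_central (sub K) n) K"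
    using comm_subgroup_consistent[OF s] Suc by simp
  have "comm_subgroup G (lower_central (sub K) n) K \<subseteq> K"
  proof (rule comm_subgroup_subset[OF s])
    fix x y assume "x \<in> lower_central (sub K) n" "y \<in> K"
    then show "cm x y \<in> K" using Suc by (auto intro!: subgroup.m_closed[OF s] subgroup.m_inv_closed[OF s])
  qed
  then show ?case unfolding eq using comm_subgroup_normal Suc K by blast
qed (use K in simp)

text \<open>The witness is the term of the lower central series of \<open>K\<close> just before the
  series enters \<open>M\<close>; its commutators with \<open>K\<close> generate the next term,
  which lies in \<open>M\<close>.\<close>

lemma nilpotent_imp_nilp_over_maximal:
  assumes K: "K \<lhd> G" and nil: "nilpotent (sub K)"
  shows "nilp_over_maximal K"
  unfolding nilp_over_maximal_def
proof (intro allI impI)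
  fix M assume "maximal_subgroup G M \<and> \<not> K \<subseteq> M"
  then have M: "subgroup M G" "\<not> K \<subseteq> M" by (auto simp: maximal_subgroup_def)
  let ?L = "lower_central (sub K)"
  obtain n where n: "?L n = {\<one>}" using nil by (auto simp: nilpotent_def)
  then have nM: "?L n \<subseteq> M" using subgroup.one_closed[OF M(1)] by auto
  define i where "i = (LEAST i. ?L i \<subseteq> M)"
  have i: "?L i \<subseteq> M" unfolding i_def using nM by (rule LeastI)
  have "i \<noteq> 0" using i M(2) by (metis lower_central.simps(1) partial_object.select_convs(1) partial_object.update_convs(1) partial_object.surjective)
  then obtain j where j: "i = Suc j" using not0_implies_Suc by blast
  have jM: "\<not> ?L j \<subseteq> M" using j not_less_Least[of j "\<lambda>i. ?L i \<subseteq> M"] unfolding i_def by auto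
  have Lj: "?L j \<lhd> G" "?L j \<subseteq> K" using lower_central_normal[OF K] by auto
  have "cm b k \<in> M" if "b \<in> ?L j" "k \<in> K" for b k
  proof -
    have "?L i = comm_subgroup G (?L j) K"
      using comm_subgroup_consistent[OF normal_imp_subgroup[OF K]] Lj(2) j by simp
    then show ?thesis using cm_in_comm_subgroup[OF that] i by blast
  qed
  then show "\<exists>B. B \<lhd> G \<and> B \<subseteq> K \<and> \<not> B \<subseteq> M \<and> (\<forall>b\<in>B. \<forall>k\<in>K. cm b k \<in> M)"
    using Lj jM by blast
qed

end

context fin_group
begin

text \<open>For a maximal proper \<open>Y\<close>-invariant \<open>V\<close>, the elements of
  \<open>P\<close> that commute with \<open>Y\<close> modulo \<open>V\<close> form a larger
  \<open>Y\<close>-invariant subgroup, hence all of \<open>P\<close>. Since [P, Y] then lies in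
  \<open>V\<close>, every subgroup between \<open>V\<close> and \<open>P\<close> is
  \<open>Y\<close>-invariant.\<close>

lemma p_group_descent:
  assumes p: "Factorial_Ring.prime p" and Y: "subgroup Y G" "card Y = p ^ k"
    and D: "subgroup D G" "normalizes Y D" and P: "subgroup P G" "normalizes Y P"
    and DP: "D \<subset> P" "P \<subseteq> Y"
  obtains V where "subgroup V G" "normalizes Y V" "D \<subseteq> V" "V \<subset> P" "\<And>x y. x \<in> P \<Longrightarrow> y \<in> Y \<Longrightarrow> cm x y \<in> V"
proof -
  let ?Pr = "\<lambda>V. subgroup V G \<and> normalizes Y V \<and> D \<subseteq> V \<and> V \<subset> P"
  have "?Pr D" using D DP by blast
  then obtain V where V: "?Pr V" and max: "\<And>K. ?Pr K \<Longrightarrow> V \<subseteq> K \<Longrightarrow> K = V"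
    using ex_maximal_set[of ?Pr D] subgroup.subset by metis
  note Yc = subgroup.subset[OF Y(1)]
  note Pc = subgroup.subset[OF P(1)]
  obtain x where x: "x \<in> P - V" "\<forall>y\<in>Y. cm x y \<in> V"
    using p_group_central_step[OF p Y, of V P] V P DP by blast
  have PV: "normalizes P V" using V DP(2) by (auto simp: normalizes_def)
  let ?W = "cent_mod P Y V"
  have W: "subgroup ?W G" using cent_mod_subgroup[OF P(1) _ PV Yc] V by blast
  have nW: "normalizes Y ?W" 
    using cent_mod_normalizes[OF Y(1) P(2) subgroup_normalizes[OF Y(1)] _ Pc Yc] V by blast
  have VW: "V \<subseteq> ?W"
    using V cm_in_normal(2)[of V Y] Yc by (auto simp: cent_mod_def)
  have xW: "x \<in> ?W" using x V Yc Pc cm_sym[of x _ V] by (auto simp: cent_mod_def subset_iff)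
  have "?W = P"
  proof (rule ccontr)
    assume "?W \<noteq> P"
    moreover have "?W \<subseteq> P" by (auto simp: cent_mod_def)
    ultimately have "?Pr ?W" using W nW VW V by blast
    then show False using max[of ?W] VW xW x by blast
  qed
  then have "cm x y \<in> V" if "x \<in> P" "y \<in> Y" for x y
    using that V cm_sym[of y x V] Yc Pc by (auto simp: cent_mod_def subset_iff)
  then show thesis using V that by blast
qed

text \<open>Induction on the index of \<open>A\<close>: some term of the lower central series lies
  in the preimage of the centre of G/A, so the next term lies in \<open>A\<close>. The case A = 1 is
  the claim.\<close>

lemma p_group_nilpotent:
  assumes p: "Factorial_Ring.prime p" and Y: "card (carrier G) = p ^ k"
  shows "nilpotent G"
proof -
  have "\<exists>n. lower_central G n \<subseteq> A" if "A \<lhd> G" for A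
    using that
  proof (induction "card (carrier G) - card A" arbitrary: A rule: less_induct)
    case less
    have A: "subgroup A G" "normalizes (carrier G) A" using less(2) normal_iff_normalizes by auto
    show ?case
    proof (cases "A = carrier G")
      case True
      then have "lower_central G 0 \<subseteq> A" by simp
      then show ?thesis by blast
    next
      case False
      then have "A \<subset> carrier G" using A(1) subgroup.subset by blast
      then obtain x where x: "x \<in> carrier G - A" "\<forall>y\<in>carrier G. cm x y \<in> A"
        using p_group_central_step[OF p subgroup_self Y A subgroup_self] subgroup_normalizes[OF subgroup_self] by blast
      let ?B = "cent_mod (carrier G) (carrier G) A"
      have B: "?B \<lhd> G" using cent_mod_normal[OF _ _ less(2)] normal_self by blast
      have "A \<subseteq> ?B" using cm_in_normal(2)[OF A] subgroup.subset[OF A(1)] by (auto simp: cent_mod_def)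
      moreover have "x \<in> ?B" using x cm_sym[of x _ A] A(1) by (auto simp: cent_mod_def)
      ultimately have "A \<subset> ?B" using x by blast
      then have "card A < card ?B" using fin_subgroup[OF normal_imp_subgroup[OF B]] by (simp add: psubset_card_mono)
      moreover have "card ?B \<le> card (carrier G)" using fin normal_subset[OF B] by (simp add: card_mono)
      ultimately obtain n where n: "lower_central G n \<subseteq> ?B" using less(1)[OF _ B] by fastforce
      have "lower_central G (Suc n) \<subseteq> A"
      proof (simp, rule comm_subgroup_subset[OF A(1)])
        fix x y assume "x \<in> lower_central G n" "y \<in> carrier G"
        then show "cm x y \<in> A" using n cm_sym[of y x A] A(1) by (auto simp: cent_mod_def subset_iff)
      qed
      then show ?thesis by blast
    qed
  qed
  from this[OF one_is_normal] obtain n where n: "lower_central G n \<subseteq> {\<one>}" by blast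
  have "\<one> \<in> lower_central G n" by (cases n) (auto simp: comm_subgroup_def intro: generate.one)
  then have "lower_central G n = {\<one>}" using n by blast
  then show ?thesis using is_group by (auto simp: nilpotent_def)
qed

lemma nilpotent_p_subgroup:
  assumes "Factorial_Ring.prime p" "subgroup Q G" "card Q = p ^ k"
  shows "nilpotent (sub Q)"
  using fin_group.p_group_nilpotent[OF fin_group_subgroup[OF assms(2)] assms(1)] assms(3) by simp

text \<open>If the normaliser of \<open>Q\<close> were proper, it would lie in a maximal subgroup
  \<open>M\<close>. By the Frattini argument \<open>K\<close> is not contained in \<open>M\<close>,
  so \<open>K \<inter> M\<close> is normal in \<open>G\<close>; it still has \<open>Q\<close> as a
  Sylow subgroup, and a second Frattini argument puts \<open>G\<close> into
  \<open>M\<close>.\<close>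

lemma sylow_normal:
  assumes K: "K \<lhd> G" and nil: "nilp_over_maximal K" and Q: "sylow_subgroup (sub K) p Q"
  shows "Q \<lhd> G"
proof -
  note Ks = normal_imp_subgroup[OF K]
  note Qs = sylow_subgroup_carrierD[OF Ks Q]
  let ?N = "normalizer G Q"
  have N: "subgroup ?N G" using Qs(2) by (rule normalizer_subgroup)
  have QN: "Q \<subseteq> ?N"
    using normalizer_iff[OF Qs(2)] subgroup_normalizes[OF Qs(2)] subgroup.subset[OF Qs(2)] by (auto simp: normalizes_def)
  have "?N = carrier G"
  proof (rule ccontr)
    assume "?N \<noteq> carrier G"
    then obtain M where M: "maximal_subgroup G M" "?N \<subseteq> M" using ex_maximal_subgroup N by blast
    then have Ms: "subgroup M G" "M \<noteq> carrier G" by (auto simp: maximal_subgroup_def)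
    have prod: "\<not> L \<subseteq> M" if L: "L \<lhd> G" "sylow_subgroup (sub L) p Q" for L
    proof
      assume LM: "L \<subseteq> M"
      have "g \<in> M" if g: "g \<in> carrier G" for g
      proof -
        obtain k n where "k \<in> L" "n \<in> ?N" "g = k \<otimes> n" using frattini[OF L g] by blast
        then show ?thesis using LM M(2) subgroup.m_closed[OF Ms(1), of k n] by blast
      qed
      then show False using Ms subgroup.subset by blast
    qed
    have "\<not> K \<subseteq> M" using prod K Q by blast
    then obtain B where B: "B \<lhd> G" "B \<subseteq> K" "\<not> B \<subseteq> M" "\<forall>b\<in>B. \<forall>k\<in>K. cm b k \<in> M"
      using nil M(1) \<open>\<not> K \<subseteq> M\<close> unfolding nilp_over_maximal_def by blast
    have D: "K \<inter> M \<lhd> G" using maximal_Int_normal[OF Ms(1) maximal_mult[OF M(1) B(1,3)] K B(2)] B(4) by blast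
    then have Ds: "subgroup (K \<inter> M) G" by (rule normal_imp_subgroup)
    have QD: "Q \<subseteq> K \<inter> M" using Qs(3) QN M(2) by blast
    have "card (K \<inter> M) dvd card K" using card_subgroup_dvd[OF Ds Ks] by blast
    moreover have "card K \<noteq> 0" using card_subgroup_pos[OF Ks] by simp
    ultimately have le: "multiplicity p (card (K \<inter> M)) \<le> multiplicity p (card K)" by (rule dvd_imp_multiplicity_le)
    have "p ^ multiplicity p (card K) dvd card (K \<inter> M)" using card_subgroup_dvd[OF Qs(2) Ds QD] Qs(4) by simp
    moreover have "card (K \<inter> M) \<noteq> 0" "\<not> is_unit p" using card_subgroup_pos[OF Ds] Qs(1) by (auto simp: prime_nat_iff)
    ultimately have "multiplicity p (card K) \<le> multiplicity p (card (K \<inter> M))" using multiplicity_geI by blast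
    then have "sylow_subgroup (sub (K \<inter> M)) p Q"
      using Qs le subgroup_incl[OF Qs(2) Ds QD] by (simp add: sylow_subgroup_def)
    then show False using prod D by blast
  qed
  then have "cj g x \<in> Q" if "g \<in> carrier G" "x \<in> Q" for g x
    using normalizer_iff[OF Qs(2), of g] that by simp
  then show ?thesis by (rule normal_invI[OF Qs(2)])
qed

text \<open>For every prime the full p-part of the order of \<open>K\<close> divides the order of
  \<open>K \<inter> S\<close>, so the two orders agree.\<close>

lemma subgroup_subset_if_sylow_subset:
  assumes K: "subgroup K G" and S: "subgroup S G"
    and sub: "\<And>p. Factorial_Ring.prime p \<Longrightarrow> \<exists>Q. sylow_subgroup (sub K) p Q \<and> Q \<subseteq> S"
  shows "K \<subseteq> S"
proof -
  have KS: "subgroup (K \<inter> S) G" using K S by (rule subgroups_Inter_pair)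
  have nz: "card K \<noteq> 0" "card (K \<inter> S) \<noteq> 0" using card_subgroup_pos[OF K] card_subgroup_pos[OF KS] by simp_all
  have "multiplicity p (card K) \<le> multiplicity p (card (K \<inter> S))" if p: "Factorial_Ring.prime p" for p
  proof -
    obtain Q where Q: "sylow_subgroup (sub K) p Q" "Q \<subseteq> S" using sub p by blast
    note Qs = sylow_subgroup_carrierD[OF K Q(1)]
    have "p ^ multiplicity p (card K) dvd card (K \<inter> S)" using card_subgroup_dvd[OF Qs(2) KS] Qs(3,4) Q(2) by simp
    moreover have "\<not> is_unit p" using p by (auto simp: prime_nat_iff)
    ultimately show ?thesis using nz multiplicity_geI by blast
  qed
  then have "card K dvd card (K \<inter> S)" using nz(1) by (intro multiplicity_le_imp_dvd) auto
  then have "K \<inter> S = K" using subgroup_eq_card[OF KS K] by blast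
  then show ?thesis by blast
qed

lemma ex_sylow_in: "subgroup K G \<Longrightarrow> Factorial_Ring.prime p \<Longrightarrow> \<exists>Q. sylow_subgroup (sub K) p Q"
  using fin_group.ex_sylow[OF fin_group_subgroup] by blast

lemma fitting_normal: "fitting G \<lhd> G"
  unfolding fitting_def
proof (rule normal_generateI)
  show "\<Union> {N. N \<lhd> G \<and> nilpotent (sub N)} \<subseteq> carrier G" using normal_subset by blast
qed (use normalD in blast)

lemma normal_nilpotent_subset_fitting: "N \<lhd> G \<Longrightarrow> nilpotent (sub N) \<Longrightarrow> N \<subseteq> fitting G"
  unfolding fitting_def by (auto intro: generate.incl)

lemma normal_p_subgroup_subset_fitting:
  "N \<lhd> G \<Longrightarrow> Factorial_Ring.prime p \<Longrightarrow> card N = p ^ k \<Longrightarrow> N \<subseteq> fitting G"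
  using normal_nilpotent_subset_fitting nilpotent_p_subgroup normal_imp_subgroup by blast

text \<open>The Sylow subgroups of a nilpotent normal subgroup are normal in \<open>G\<close>, so
  \<open>fitting G\<close> is generated by the normal subgroups of prime power order. The lemma
  serves as the induction principle for \<open>fitting G\<close>.\<close>

lemma fitting_subset:
  assumes S: "subgroup S G"
    and sub: "\<And>N p k. N \<lhd> G \<Longrightarrow> Factorial_Ring.prime p \<Longrightarrow> card N = p ^ k \<Longrightarrow> N \<subseteq> S"
  shows "fitting G \<subseteq> S"
  unfolding fitting_def
proof (rule generate_subgroup_incl[OF _ S], rule Union_least)
  fix N assume "N \<in> {N. N \<lhd> G \<and> nilpotent (sub N)}"
  then have N: "N \<lhd> G" "nilpotent (sub N)" by auto
  note Ns = normal_imp_subgroup[OF N(1)]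
  show "N \<subseteq> S"
  proof (rule subgroup_subset_if_sylow_subset[OF Ns S])
    fix p :: nat assume p: "Factorial_Ring.prime p"
    obtain Q where Q: "sylow_subgroup (sub N) p Q" using ex_sylow_in[OF Ns p] by blast
    have "Q \<lhd> G" using sylow_normal[OF N(1) nilpotent_imp_nilp_over_maximal[OF N] Q] .
    then have "Q \<subseteq> S" using sub[OF _ p] sylow_subgroup_carrierD(4)[OF Ns Q] by blast
    then show "\<exists>Q. sylow_subgroup (sub N) p Q \<and> Q \<subseteq> S" using Q by blast
  qed
qed

lemma coprime_Int_trivial:
  assumes "subgroup A G" "subgroup B G" "coprime (card A) (card B)"
  shows "A \<inter> B = {\<one>}"
proof -
  have s: "subgroup (A \<inter> B) G" using assms subgroups_Inter_pair by blast
  have "card (A \<inter> B) dvd card A" "card (A \<inter> B) dvd card B" using card_subgroup_dvd s assms by auto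
  then have "card (A \<inter> B) = 1" using assms(3) coprime_common_divisor_nat by blast
  then show ?thesis using subgroup.one_closed[OF s] by (metis card_1_singletonE singletonD)
qed

text \<open>Among the normal subgroups of prime power order outside \<open>M\<close> take a minimal
  \<open>B\<close>, for the prime p. A normal q-subgroup \<open>N\<close> commutes with
  \<open>B\<close> if q differs from p. If q = p, then [B, N] is a normal p-subgroup properly
  contained in \<open>B\<close>, so it lies in \<open>M\<close> by minimality. Hence [B, N] always
  lies in the core of \<open>M\<close>.\<close>

lemma fitting_nilp_over_maximal: "nilp_over_maximal (fitting G)"
  unfolding nilp_over_maximal_def
proof (intro allI impI)
  fix M assume "maximal_subgroup G M \<and> \<not> fitting G \<subseteq> M"
  then have M: "subgroup M G" "\<not> fitting G \<subseteq> M" by (auto simp: maximal_subgroup_def)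
  let ?Pr = "\<lambda>B. B \<lhd> G \<and> (\<exists>p k. Factorial_Ring.prime p \<and> card B = p ^ k) \<and> \<not> B \<subseteq> M"
  obtain B0 where "?Pr B0" using fitting_subset[OF M(1)] M(2) by blast
  then obtain B where B: "?Pr B" and min: "\<And>K. ?Pr K \<Longrightarrow> K \<subseteq> B \<Longrightarrow> K = B"
    using ex_minimal_set[of ?Pr B0] normal_subset by metis
  then obtain p k where pk: "Factorial_Ring.prime p" "card B = p ^ k" by blast
  have Bn: "B \<lhd> G" "\<not> B \<subseteq> M" using B by auto
  note Bs = normal_imp_subgroup[OF Bn(1)]
  \<comment> \<open>The core replaces \<open>M\<close> because the elements centralising
    \<open>B\<close> modulo a normal subgroup form a subgroup, to which
    \<open>fitting_subset\<close> applies.\<close>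
  let ?C = "core G M"
  have C: "?C \<lhd> G" using M(1) by (rule core_normal)
  note Cs = normal_imp_subgroup[OF C]
  have "fitting G \<subseteq> cent_mod (carrier G) B ?C"
  proof (rule fitting_subset)
    show "subgroup (cent_mod (carrier G) B ?C) G"
      using cent_mod_normal[OF normal_self Bn(1) C] by (rule normal_imp_subgroup)
  next
    fix N q j assume N: "N \<lhd> G" and q: "Factorial_Ring.prime (q::nat)" "card N = q ^ j"
    note Ns = normal_imp_subgroup[OF N]
    have "cm b x \<in> ?C" if b: "b \<in> B" and x: "x \<in> N" for b x
    proof (cases "q = p")
      case False
      have bc: "b \<in> carrier G" "x \<in> carrier G" using b x Bs Ns subgroup.mem_carrier by metis+
      have "cm b x \<in> B \<inter> N" using cm_in_normal_subgroup[OF Bn(1) bc] cm_in_normal_subgroup[OF N bc] b x by blast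
      moreover have "B \<inter> N = {\<one>}"
        using coprime_Int_trivial[OF Bs Ns] pk q False primes_coprime[of p q] by (simp add: coprime_power_left_iff coprime_power_right_iff)
      ultimately show ?thesis using subgroup.one_closed[OF Cs] by auto
    next
      case True
      obtain Y where Y: "sylow_subgroup G p Y" using ex_sylow pk(1) by blast
      then have Ys: "subgroup Y G" "card Y = p ^ multiplicity p (card (carrier G))" by (auto simp: sylow_subgroup_def)
      have sub: "B \<subseteq> Y" "N \<subseteq> Y" using normal_p_subgroup_in_sylow[OF Y] Bn(1) N pk q True by blast+
      have "\<one> \<in> B" "B \<noteq> {\<one>}" using Bs Bn(2) M(1) subgroup.one_closed by auto
      then have B1: "{\<one>} \<subset> B" by blast
      have n1: "normalizes Y {\<one>}" "normalizes Y B"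
        using normal_imp_normalizes one_is_normal Bn(1) subgroup.subset[OF Ys(1)] by auto
      obtain V where V: "subgroup V G" "V \<subset> B" "\<And>x y. x \<in> B \<Longrightarrow> y \<in> Y \<Longrightarrow> cm x y \<in> V"
        using p_group_descent[OF pk(1) Ys triv_subgroup n1(1) Bs n1(2) B1 sub(1)] by metis
      let ?B = "comm_subgroup G B N"
      have B': "?B \<lhd> G" using comm_subgroup_normal Bn(1) N by blast
      have B'V: "?B \<subseteq> V" by (rule comm_subgroup_subset[OF V(1)]) (use V(3) sub in blast)
      then have "card ?B dvd p ^ k" using card_subgroup_dvd[OF normal_imp_subgroup[OF B'] Bs] V(2) pk(2) by auto
      then obtain i where "card ?B = p ^ i" using divides_primepow_nat[OF pk(1)] by blast
      then have "?B \<subseteq> M" using min[of ?B] B' B'V V(2) pk(1) by blast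
      then have "?B \<subseteq> ?C" using normal_subset_core[OF B'] M(1) subgroup.subset by blast
      then show ?thesis using cm_in_comm_subgroup[OF b x] by blast
    qed
    then show "N \<subseteq> cent_mod (carrier G) B ?C" using normal_subset[OF N] by (auto simp: cent_mod_def)
  qed
  then have "\<forall>b\<in>B. \<forall>k\<in>fitting G. cm b k \<in> M"
    using core_subset[OF subgroup.subset[OF M(1)]] by (auto simp: cent_mod_def)
  moreover have "B \<subseteq> fitting G" using normal_p_subgroup_subset_fitting Bn(1) pk by blast
  ultimately show "\<exists>B. B \<lhd> G \<and> B \<subseteq> fitting G \<and> \<not> B \<subseteq> M \<and> (\<forall>b\<in>B. \<forall>k\<in>fitting G. cm b k \<in> M)"
    using Bn by blast
qed

lemma sylow_fitting_normal:
  "sylow_subgroup (sub (fitting G)) p Q \<Longrightarrow> Q \<lhd> G"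
  using sylow_normal[OF fitting_normal fitting_nilp_over_maximal] .

end

section \<open>Cyclic factors and chains\<close>

context group
begin

lemma rcos_eq_iff:
  assumes "subgroup A G" "x \<in> carrier G" "y \<in> carrier G"
  shows "A #> x = A #> y \<longleftrightarrow> x \<otimes> inv y \<in> A"
proof
  assume "A #> x = A #> y"
  then have "x \<in> A #> y" using rcos_self[OF assms(2,1)] by simp
  then obtain a where "a \<in> A" "x = a \<otimes> y" by (auto simp: r_coset_def)
  then show "x \<otimes> inv y \<in> A" using assms by (simp add: m_assoc subgroup.mem_carrier)
next
  assume "x \<otimes> inv y \<in> A"
  moreover have "x = (x \<otimes> inv y) \<otimes> y" using assms by (simp add: m_assoc)
  ultimately have "x \<in> A #> y" by (auto simp: r_coset_def)
  then show "A #> x = A #> y" using repr_independence[of x A y] assms by simp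
qed

lemma rcos_group_hom: "A \<lhd> G \<Longrightarrow> group_hom G (G Mod A) (\<lambda>x. A #> x)"
  by (simp add: group_hom_def group_hom_axioms_def is_group normal.factorgroup_is_group normal.r_coset_hom_Mod)

text \<open>For \<open>A\<close> normal in \<open>B\<close>: the factor \<open>B/A\<close> is cyclic.\<close>

definition cyc :: "'a set \<Rightarrow> 'a set \<Rightarrow> bool" where
  "cyc A B \<longleftrightarrow> (\<exists>b\<in>B. B \<subseteq> A <#> generate G {b})"

lemma mem_generate_singleton: "b \<in> carrier G \<Longrightarrow> x \<in> generate G {b} \<longleftrightarrow> (\<exists>i::int. x = b [^] i)"
  by (auto simp: generate_pow)

lemma generate_singleton_subgroup: "b \<in> carrier G \<Longrightarrow> subgroup (generate G {b}) G"
  by (rule generate_is_subgroup) simp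

lemma subset_of_cyc_gen:
  assumes "B \<subseteq> A <#> generate G {b}" "subgroup S G" "A \<subseteq> S" "b \<in> S"
  shows "B \<subseteq> S"
proof -
  have "generate G {b} \<subseteq> S" using assms by (simp add: generate_subgroup_incl)
  then have "A <#> generate G {b} \<subseteq> S <#> S" using assms(3) by (rule mono_set_mult[rotated])
  also have "S <#> S = S" using assms(2) by (rule subgroup_mult_id)
  finally show ?thesis using assms(1) by blast
qed

lemma rcos_int_pow:
  assumes "A \<lhd> G" "x \<in> carrier G"
  shows "A #> (x [^] (i::int)) = (A #> x) [^]\<^bsub>G Mod A\<^esub> i"
  using normal.FactGroup_int_pow[OF assms] by simp

lemma mem_cyc_gen_iff:
  assumes A: "A \<lhd> G" and c: "b \<in> carrier G" "x \<in> carrier G"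
  shows "x \<in> A <#> generate G {b} \<longleftrightarrow> (\<exists>i::int. A #> x = A #> (b [^] i))"
proof -
  note As = normal_imp_subgroup[OF A]
  have eq: "A #> x = A #> (b [^] (i::int)) \<longleftrightarrow> (\<exists>a\<in>A. x = a \<otimes> b [^] i)" for i
  proof -
    have "A #> x = A #> (b [^] i) \<longleftrightarrow> x \<otimes> inv (b [^] i) \<in> A"
      using rcos_eq_iff[OF As c(2)] c(1) by simp
    also have "\<dots> \<longleftrightarrow> (\<exists>a\<in>A. x = a \<otimes> b [^] i)"
    proof
      assume "x \<otimes> inv (b [^] i) \<in> A"
      moreover have "x = x \<otimes> inv (b [^] i) \<otimes> b [^] i" using c by (simp add: m_assoc)
      ultimately show "\<exists>a\<in>A. x = a \<otimes> b [^] i" by blast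
    next
      assume "\<exists>a\<in>A. x = a \<otimes> b [^] i"
      then obtain a where "a \<in> A" "x = a \<otimes> b [^] i" by blast
      then show "x \<otimes> inv (b [^] i) \<in> A" using c subgroup.mem_carrier[OF As] by (simp add: m_assoc)
    qed
    finally show ?thesis .
  qed
  have "x \<in> A <#> generate G {b} \<longleftrightarrow> (\<exists>i::int. \<exists>a\<in>A. x = a \<otimes> b [^] i)"
    unfolding set_mult_mem generate_pow[OF c(1)] by auto
  then show ?thesis by (simp only: eq)
qed

lemma cyc_gen_subgroup: "A \<lhd> G \<Longrightarrow> b \<in> carrier G \<Longrightarrow> subgroup (A <#> generate G {b}) G"
  by (rule set_mult_subgroup) 
    (use normal_imp_subgroup generate_singleton_subgroup normal_imp_normalizes subgroup.subset in metis)+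

lemma cyc_one_generate: "b \<in> carrier G \<Longrightarrow> cyc {\<one>} (generate G {b})"
proof -
  assume b: "b \<in> carrier G"
  have "generate G {b} \<subseteq> {\<one>} <#> generate G {b}"
    using set_mult_superset(2)[OF triv_subgroup generate_singleton_subgroup[OF b]] .
  moreover have "b \<in> generate G {b}" by (rule generate.incl) simp
  ultimately show ?thesis by (auto simp: cyc_def)
qed

text \<open>(B \<inter> C)/(A \<inter> C) embeds into the cyclic group B/A. As for subgroups of the
  integers, an element of \<open>B \<inter> C\<close> with least positive exponent k generates
  modulo \<open>A \<inter> C\<close>.\<close>

lemma cyc_Int:
  assumes A: "A \<lhd> G" and B: "subgroup B G" and AB: "cyc A B" and C: "subgroup C G"
  shows "cyc (A \<inter> C) (B \<inter> C)"
proof -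
  note As = normal_imp_subgroup[OF A]
  interpret h: group_hom G "G Mod A" "\<lambda>x. A #> x" using A by (rule rcos_group_hom)
  obtain b where b: "b \<in> B" "B \<subseteq> A <#> generate G {b}" using AB by (auto simp: cyc_def)
  have bc: "b \<in> carrier G" using b(1) subgroup.mem_carrier[OF B] by blast
  have BC: "subgroup (B \<inter> C) G" using B C by (rule subgroups_Inter_pair)
  note Bc = subgroup.subset[OF BC]
  let ?b = "A #> b"
  have pw: "\<exists>i::int. A #> x = ?b [^]\<^bsub>G Mod A\<^esub> i" if "x \<in> B \<inter> C" for x
  proof -
    have "x \<in> carrier G" "x \<in> A <#> generate G {b}" using that Bc b(2) by auto
    then show ?thesis using mem_cyc_gen_iff[OF A bc] rcos_int_pow[OF A bc] by auto
  qed
  \<comment> \<open>Multiplying x by y^q changes the exponent i to i + kq; with q = -(i div k) this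
    is division with remainder, and with x = 1 and q = -1 it is inversion.\<close>
  have pm: "A #> (x \<otimes> y [^] (q::int)) = ?b [^]\<^bsub>G Mod A\<^esub> (i + k * q)"
    if "x \<in> carrier G" "y \<in> carrier G" "A #> x = ?b [^]\<^bsub>G Mod A\<^esub> i" "A #> y = ?b [^]\<^bsub>G Mod A\<^esub> k" for x y i k q
  proof -
    have "A #> (x \<otimes> y [^] q) = (A #> x) \<otimes>\<^bsub>G Mod A\<^esub> (A #> y) [^]\<^bsub>G Mod A\<^esub> q"
      using that h.hom_mult[of x "y [^] q"] rcos_int_pow[OF A] by simp
    also have "\<dots> = ?b [^]\<^bsub>G Mod A\<^esub> (i + k * q)"
      unfolding that using h.hom_closed[OF bc] by (simp only: h.H.int_pow_mult h.H.int_pow_pow)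
    finally show ?thesis .
  qed
  have inA: "x \<in> A" if "x \<in> carrier G" "A #> x = ?b [^]\<^bsub>G Mod A\<^esub> (0::int)" for x
  proof -
    have "A #> x = A #> \<one>" using that As by (simp add: coset_mult_one subgroup.subset)
    then show ?thesis using rcos_eq_iff[OF As that(1) one_closed] that(1) by simp
  qed
  let ?I = "\<lambda>k::nat. k > 0 \<and> (\<exists>c\<in>B \<inter> C. A #> c = ?b [^]\<^bsub>G Mod A\<^esub> int k)"
  show ?thesis
  proof (cases "\<exists>k. ?I k")
    case True
    define k where "k = (LEAST k. ?I k)"
    have "?I k" unfolding k_def using True by (rule LeastI_ex)
    then obtain c where k: "k > 0" and c: "c \<in> B \<inter> C" "A #> c = ?b [^]\<^bsub>G Mod A\<^esub> int k" by blast
    have least: "\<not> ?I j" if "j < k" for j using that not_less_Least unfolding k_def by blast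
    have cc: "c \<in> carrier G" using c Bc by blast
    have "x \<in> (A \<inter> C) <#> generate G {c}" if x: "x \<in> B \<inter> C" for x
    proof -
      have xc: "x \<in> carrier G" using x Bc by blast
      obtain i :: int where i: "A #> x = ?b [^]\<^bsub>G Mod A\<^esub> i" using pw[OF x] by blast
      define q where "q = i div int k"
      define y where "y = x \<otimes> c [^] (- q)"
      have yBC: "y \<in> B \<inter> C" unfolding y_def
        using subgroup.m_closed[OF BC x subgroup_int_pow_closed[OF BC c(1)]] .
      have "A #> y = ?b [^]\<^bsub>G Mod A\<^esub> (i + int k * (- q))" unfolding y_def by (rule pm[OF xc cc i c(2)])
      also have "i + int k * (- q) = int (nat (i mod int k))"
        using k minus_mult_div_eq_mod[of i "int k"] by (simp add: q_def)
      finally have y: "A #> y = ?b [^]\<^bsub>G Mod A\<^esub> int (nat (i mod int k))" .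
      have "nat (i mod int k) < k" using k by (simp add: nat_less_iff)
      then have "\<not> ?I (nat (i mod int k))" by (rule least)
      then have "nat (i mod int k) = 0" using y yBC by (metis gr_zeroI)
      then have "y \<in> A" using inA[of y] y yBC Bc by auto
      then have "y \<in> A \<inter> C" using yBC by blast
      moreover have "x = y \<otimes> c [^] q" unfolding y_def using xc cc by (simp add: m_assoc int_pow_neg)
      ultimately show ?thesis using mem_generate_singleton[OF cc] by (auto simp: set_mult_mem)
    qed
    then show ?thesis using c(1) unfolding cyc_def by blast
  next
    case False
    have "x \<in> A" if x: "x \<in> B \<inter> C" for x
    proof -
      have xc: "x \<in> carrier G" using x Bc by blast
      obtain i :: int where i: "A #> x = ?b [^]\<^bsub>G Mod A\<^esub> i" using pw[OF x] by blast
      have "\<not> i > 0"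
      proof
        assume "i > 0"
        then obtain n where "0 < n" "i = int n" using zero_less_imp_eq_int by blast
        then show False using False x i by blast
      qed
      moreover have "\<not> i < 0"
      proof
        assume neg: "i < 0"
        have "A #> (\<one> \<otimes> x [^] (-1::int)) = ?b [^]\<^bsub>G Mod A\<^esub> (0 + i * (-1))"
          by (rule pm[OF one_closed xc _ i]) (use As in \<open>simp add: subgroup.subset\<close>)
        then have "A #> (x [^] (-1::int)) = ?b [^]\<^bsub>G Mod A\<^esub> (- i)" using xc by simp
        moreover have "x [^] (-1::int) \<in> B \<inter> C" using subgroup_int_pow_closed[OF BC x] .
        moreover obtain n where "0 < n" "- i = int n" using neg zero_less_imp_eq_int[of "- i"] by auto
        ultimately show False using False by metis
      qed
      ultimately have "i = 0" by simp
      then show ?thesis using inA[OF xc] i by simp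
    qed
    then have sub: "B \<inter> C \<subseteq> A \<inter> C" by blast
    have AC: "subgroup (A \<inter> C) G" using As C by (rule subgroups_Inter_pair)
    have "B \<inter> C \<subseteq> (A \<inter> C) <#> generate G {\<one>}"
      using set_mult_superset(1)[OF AC generate_singleton_subgroup[OF one_closed]] sub by blast
    then show ?thesis using subgroup.one_closed[OF BC] unfolding cyc_def by blast
  qed
qed

lemma cyc_join:
  assumes A: "A \<lhd> G" and B: "B \<lhd> G" and W: "W \<lhd> G" and AB: "cyc A B"
  shows "cyc (W <#> A) (W <#> B)"
proof -
  obtain b where b: "b \<in> B" "B \<subseteq> A <#> generate G {b}" using AB by (auto simp: cyc_def)
  have s: "subgroup W G" "subgroup A G" "subgroup B G" using A B W by (simp_all add: normal_imp_subgroup)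
  have c: "W \<subseteq> carrier G" "A \<subseteq> carrier G" "B \<subseteq> carrier G" using s by (simp_all add: subgroup.subset)
  have bc: "b \<in> carrier G" using b c by blast
  have "W <#> B \<subseteq> W <#> (A <#> generate G {b})" by (rule mono_set_mult) (use b(2) in auto)
  also have "\<dots> = (W <#> A) <#> generate G {b}"
    using set_mult_assoc[OF c(1,2), of "generate G {b}"] generate_incl[of "{b}"] bc by simp
  finally show ?thesis using set_mult_superset(2)[OF s(1,3)] b(1) unfolding cyc_def by blast
qed

text \<open>The exponent m is read off from a generator b of B/A; since conjugation is a
  homomorphism, the same m serves for every power of b.\<close>

lemma cyc_conj_power:
  assumes A: "A \<lhd> G" and B: "B \<lhd> G" and AB: "cyc A B" and g: "g \<in> carrier G"
  obtains m :: int where "\<And>x. x \<in> B \<Longrightarrow> A #> cj g x = A #> (x [^] m)"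
proof -
  interpret h: group_hom G "G Mod A" "\<lambda>x. A #> x" using A by (rule rcos_group_hom)
  obtain b where b: "b \<in> B" "B \<subseteq> A <#> generate G {b}" using AB by (auto simp: cyc_def)
  note Bc = normal_subset[OF B]
  have bc: "b \<in> carrier G" using b Bc by blast
  let ?b = "A #> b"
  have pw: "\<exists>i::int. A #> x = A #> (b [^] i)" if "x \<in> B" for x
    using mem_cyc_gen_iff[OF A bc, of x] that b(2) Bc by blast
  obtain m :: int where m: "A #> cj g b = A #> (b [^] m)" using pw[OF normalD[OF B b(1) g]] by blast
  have "A #> cj g x = A #> (x [^] m)" if x: "x \<in> B" for x
  proof -
    have xc: "x \<in> carrier G" using x Bc by blast
    obtain i :: int where i: "A #> x = A #> (b [^] i)" using pw[OF x] by blast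
    have "A #> cj g x = (A #> g) \<otimes>\<^bsub>G Mod A\<^esub> (A #> x) \<otimes>\<^bsub>G Mod A\<^esub> (A #> inv g)"
      using g xc by (simp only: h.hom_mult m_closed inv_closed)
    also have "\<dots> = A #> cj g (b [^] i)"
      unfolding i using g bc by (simp only: h.hom_mult m_closed inv_closed int_pow_closed)
    also have "\<dots> = (A #> cj g b) [^]\<^bsub>G Mod A\<^esub> i"
      using cj_int_pow[OF g bc] rcos_int_pow[OF A, of "cj g b" i] g bc by simp
    also have "\<dots> = (?b [^]\<^bsub>G Mod A\<^esub> m) [^]\<^bsub>G Mod A\<^esub> i" using m rcos_int_pow[OF A bc] by simp
    also have "\<dots> = (?b [^]\<^bsub>G Mod A\<^esub> i) [^]\<^bsub>G Mod A\<^esub> m"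
      using h.hom_closed[OF bc] by (simp only: h.H.int_pow_pow mult.commute)
    also have "\<dots> = A #> (x [^] m)" using i rcos_int_pow[OF A bc] rcos_int_pow[OF A xc] by simp
    finally show ?thesis .
  qed
  then show thesis using that by blast
qed

text \<open>Conjugations act on the cyclic group B/A as power maps, and power maps commute, so
  commutators act trivially.\<close>

lemma derived_centralizes_cyc:
  assumes A: "A \<lhd> G" and B: "B \<lhd> G" and AB: "cyc A B" 
    and x: "x \<in> B" and d: "d \<in> derived G (carrier G)"
  shows "cm x d \<in> A"
proof -
  note As = normal_imp_subgroup[OF A]
  note Bc = normal_subset[OF B]
  let ?W = "cent_mod (carrier G) B A"
  have W: "subgroup ?W G" using cent_mod_normal[OF normal_self B A] by (rule normal_imp_subgroup)
  interpret h: group_hom G "G Mod A" "\<lambda>x. A #> x" using A by (rule rcos_group_hom)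
  have "cm x (cm g k) \<in> A" if g: "g \<in> carrier G" and k: "k \<in> carrier G" and x: "x \<in> B" for g k x
  proof -
    obtain m :: int where m: "\<And>x. x \<in> B \<Longrightarrow> A #> cj g x = A #> (x [^] m)" using cyc_conj_power[OF A B AB g] by blast
    obtain n :: int where n: "\<And>x. x \<in> B \<Longrightarrow> A #> cj k x = A #> (x [^] n)" using cyc_conj_power[OF A B AB k] by blast
    \<comment> \<open>Chosen so that acting by k after g returns x, whereas acting by g after k
      gives the conjugate of x by [g, k].\<close>
    let ?x = "cj (inv (k \<otimes> g)) x"
    have xB: "?x \<in> B" using normalD[OF B x, of "inv (k \<otimes> g)"] g k by simp
    have c: "x \<in> carrier G" "?x \<in> carrier G" using x xB Bc by auto
    have "A #> cj g (cj k ?x) = A #> (cj k ?x [^] m)" using m normalD[OF B xB k] by blast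
    also have "\<dots> = (A #> (?x [^] n)) [^]\<^bsub>G Mod A\<^esub> m" using rcos_int_pow[OF A, of "cj k ?x"] n[OF xB] k c by simp
    also have "\<dots> = (A #> (?x [^] m)) [^]\<^bsub>G Mod A\<^esub> n"
      using rcos_int_pow[OF A c(2)] h.hom_closed[OF c(2)] by (simp only: h.H.int_pow_pow mult.commute)
    also have "\<dots> = A #> (cj g ?x [^] n)" using rcos_int_pow[OF A, of "cj g ?x"] m[OF xB] g c by simp
    also have "\<dots> = A #> cj k (cj g ?x)" using n normalD[OF B xB g] by blast
    also have "cj k (cj g ?x) = x" using cj_cj[OF k g c(2)] cj_inv_cancel[of "k \<otimes> g" x] g k c(1) by simp
    also have "cj g (cj k ?x) = cj (cm g k) x" using g k c(1) by (simp add: conj_simps)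
    finally have "A #> cj (cm g k) x = A #> x" .
    then have "cm (cm g k) x \<in> A" using rcos_eq_iff[OF As, of "cj (cm g k) x" x] g k c by simp
    then show ?thesis using cm_sym[OF _ _ As, of "cm g k" x] g k c by simp
  qed
  then have "derived_set G (carrier G) \<subseteq> ?W" by (auto simp: cent_mod_def)
  then have "derived G (carrier G) \<subseteq> ?W" unfolding derived_def by (rule generate_subgroup_incl[OF _ W])
  then show ?thesis using d x by (auto simp: cent_mod_def)
qed

text \<open>Chains of normal subgroups of \<open>G\<close> with cyclic factors. With
  \<open>C\<close> the whole group this expresses that G/A is supersoluble; with \<open>A\<close>
  trivial it says that \<open>C\<close> is built from cyclic factors invariant under
  \<open>G\<close>, as the hypercentre is. Links are added at the lower end.\<close>

inductive cyc_chain :: "'a set \<Rightarrow> 'a set \<Rightarrow> bool" where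
  cyc_chain_refl: "A \<lhd> G \<Longrightarrow> cyc_chain A A"
| cyc_chain_step: "A \<lhd> G \<Longrightarrow> B \<lhd> G \<Longrightarrow> A \<subseteq> B \<Longrightarrow> cyc A B \<Longrightarrow> cyc_chain B C \<Longrightarrow> cyc_chain A C"

lemma cyc_chain_normal: "cyc_chain A C \<Longrightarrow> A \<lhd> G \<and> C \<lhd> G \<and> A \<subseteq> C"
  by (induction rule: cyc_chain.induct) auto

lemma cyc_chain_trans: "cyc_chain A B \<Longrightarrow> cyc_chain B C \<Longrightarrow> cyc_chain A C"
  by (induction rule: cyc_chain.induct) (auto intro: cyc_chain_step)

lemma cyc_chain_join: "cyc_chain A C \<Longrightarrow> W \<lhd> G \<Longrightarrow> cyc_chain (W <#> A) (W <#> C)"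
proof (induction rule: cyc_chain.induct)
  case (cyc_chain_refl A)
  then show ?case by (simp add: cyc_chain.cyc_chain_refl set_mult_normal)
next
  case (cyc_chain_step A B C)
  show ?case
    using cyc_chain.cyc_chain_step[OF set_mult_normal[OF cyc_chain_step(7,1)] set_mult_normal[OF cyc_chain_step(7,2)]
        mono_set_mult[OF subset_refl cyc_chain_step(3)] cyc_join[OF cyc_chain_step(1,2,7,4)]] cyc_chain_step(6,7) by blast
qed

text \<open>A discrete intermediate value principle: the property \<open>Q\<close> must get lost at
  some link. This is the tool for picking out of a chain the cyclic factor at which a given subgroup
  starts to be met.\<close>

lemma cyc_chain_jump:
  assumes "cyc_chain A C" "Q A" "\<not> Q C"
  shows "\<exists>A' B'. A' \<lhd> G \<and> B' \<lhd> G \<and> A \<subseteq> A' \<and> A' \<subseteq> B' \<and> B' \<subseteq> C \<and> cyc A' B' \<and> Q A' \<and> \<not> Q B'"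
  using assms
proof (induction rule: cyc_chain.induct)
  case (cyc_chain_step A B C)
  show ?case
  proof (cases "Q B")
    case True
    then obtain A' B' where h: "A' \<lhd> G" "B' \<lhd> G" "B \<subseteq> A'" "A' \<subseteq> B'" "B' \<subseteq> C" "cyc A' B'" "Q A'" "\<not> Q B'"
      using cyc_chain_step by blast
    have "A \<subseteq> A'" using cyc_chain_step(3) h(3) by (rule subset_trans)
    then show ?thesis using h by blast
  next
    case False
    then show ?thesis using cyc_chain_step cyc_chain_normal[OF cyc_chain_step(5)] by blast
  qed
qed simp

lemma minimal_normalD:
  assumes "minimal_normal G N" "R \<lhd> G" "\<not> N \<subseteq> R"
  shows "N \<inter> R = {\<one>}"
proof -
  have "N \<inter> R \<lhd> G" using assms normal_Int by (auto simp: minimal_normal_def)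
  then show ?thesis using assms unfolding minimal_normal_def by blast
qed

text \<open>At the link where the chain starts to meet \<open>N\<close>, minimality puts all of
  \<open>N\<close> into the upper group B', while N \<inter> A' = 1; so \<open>N\<close> embeds into
  the cyclic group B'/A'.\<close>

lemma minimal_normal_cyc:
  assumes N: "minimal_normal G N" and cyc_chain: "cyc_chain A C" and "N \<inter> A = {\<one>}" "N \<subseteq> C"
  shows "cyc {\<one>} N"
proof -
  have Nn: "N \<lhd> G" "N \<noteq> {\<one>}" using N by (auto simp: minimal_normal_def)
  have "\<not> N \<inter> C = {\<one>}" using assms(4) Nn by blast
  with cyc_chain_jump[of A C "\<lambda>Z. N \<inter> Z = {\<one>}"] cyc_chain assms(3)
  obtain A' B' where AB: "A' \<lhd> G" "B' \<lhd> G" "cyc A' B'" "N \<inter> A' = {\<one>}" "N \<inter> B' \<noteq> {\<one>}" by blast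
  have "N \<subseteq> B'" using minimal_normalD[OF N AB(2)] AB(5) by blast
  then have "B' \<inter> N = N" by blast
  moreover have "A' \<inter> N = {\<one>}" using AB(4) by blast
  ultimately show ?thesis using cyc_Int[OF AB(1) normal_imp_subgroup[OF AB(2)] AB(3) normal_imp_subgroup[OF Nn(1)]] by simp
qed

end

section \<open>Huppert's theorem\<close>

context group
begin

lemma cyc_normal_of_power_action:
  assumes N: "N \<lhd> G" and n: "n \<in> N"
    and pw: "\<And>g. g \<in> carrier G \<Longrightarrow> \<exists>m::int. cj g n = n [^] m"
  shows "generate G {n} \<lhd> G"
proof (rule normal_invI)
  have nc: "n \<in> carrier G" using n normal_subset[OF N] by blast
  show "subgroup (generate G {n}) G" using nc by (rule generate_singleton_subgroup)
  fix g x assume g: "g \<in> carrier G" and "x \<in> generate G {n}"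
  then obtain i :: int where "x = n [^] i" using mem_generate_singleton[OF nc] by blast
  then have "cj g x = (cj g n) [^] i" using cj_int_pow[OF g nc] by simp
  moreover obtain m :: int where "cj g n = n [^] m" using pw[OF g] by blast
  ultimately have "cj g x = n [^] (m * i)" using nc by (simp add: int_pow_pow)
  then show "cj g x \<in> generate G {n}" using mem_generate_singleton[OF nc] by blast
qed

text \<open>If \<open>M\<close> avoids the minimal normal subgroup \<open>N\<close> and a cyclic factor \<open>B/A\<close> is not covered by \<open>M\<close>,
  then \<open>N\<close> embeds into \<open>B/A\<close>, or into \<open>BN/(BN \<inter> M)\<close>, which is a quotient of \<open>B/A\<close>.\<close>

lemma cyc_of_avoiding_maximal:
  assumes N: "minimal_normal G N" and ab: "\<And>x y. x \<in> N \<Longrightarrow> y \<in> N \<Longrightarrow> cm x y = \<one>"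
    and M: "subgroup M G" "N <#> M = carrier G" "B <#> M = carrier G" "\<not> N \<subseteq> M"
    and A: "A \<lhd> G" "A \<subseteq> M" and B: "B \<lhd> G" "A \<subseteq> B" and AB: "cyc A B"
  shows "cyc {\<one>} N"
proof -
  have Nn: "N \<lhd> G" "N \<noteq> {\<one>}" using N by (auto simp: minimal_normal_def)
  have Ns: "subgroup N G" and Bs: "subgroup B G" and As: "subgroup A G"
    using Nn(1) B(1) A(1) by (simp_all add: normal_imp_subgroup)
  have sub: "N \<subseteq> carrier G" "B \<subseteq> carrier G" "A \<subseteq> carrier G" "M \<subseteq> carrier G"
    using Ns Bs As M(1) by (simp_all add: subgroup.subset)
  have NM: "N \<inter> M = {\<one>}"
  proof -
    have "N \<inter> M \<lhd> G"
      by (rule maximal_Int_normal[OF M(1,2) Nn(1)]) (use ab subgroup.one_closed[OF M(1)] in auto)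
    then show ?thesis using N M(4) unfolding minimal_normal_def by blast
  qed
  show ?thesis
  proof (cases "N \<subseteq> B")
    case True
    have "A \<inter> N = {\<one>}" using NM A(2) subgroup.one_closed[OF As] subgroup.one_closed[OF Ns] by blast
    moreover have "B \<inter> N = N" using True by blast
    ultimately show ?thesis using cyc_Int[OF A(1) Bs AB Ns] by simp
  next
    case False
    have NB: "N \<inter> B = {\<one>}" using minimal_normalD[OF N B(1) False] .
    let ?BN = "B <#> N"
    have BN: "?BN \<lhd> G" using B(1) Nn(1) by (rule set_mult_normal)
    have comm: "cm b n = \<one>" if "b \<in> B" "n \<in> N" for b n
    proof -
      have c: "b \<in> carrier G" "n \<in> carrier G" using that sub by auto
      have "cm b n \<in> N \<inter> B"
        using cm_in_normal_subgroup[OF B(1) c] cm_in_normal_subgroup[OF Nn(1) c] that by blast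
      then show ?thesis using NB by blast
    qed
    have NBN: "N \<subseteq> ?BN" using set_mult_superset(2)[OF Bs Ns] .
    \<comment> \<open>\<open>N\<close> centralises \<open>B\<close>, because they meet trivially,
      and it centralises itself; so conjugation by G = NM preserves BN \<inter> M.\<close>
    have E: "?BN \<inter> M \<lhd> G"
    proof (rule maximal_Int_normal[OF M(1,2) BN NBN])
      fix n k assume n: "n \<in> N" and k: "k \<in> ?BN \<inter> M"
      then obtain b n' where bn: "b \<in> B" "n' \<in> N" "k = b \<otimes> n'" by (auto simp: set_mult_mem)
      have c: "n \<in> carrier G" "b \<in> carrier G" "n' \<in> carrier G" using n bn sub by auto
      have "cm b n = \<one>" "cm n' n = \<one>" using comm[OF bn(1) n] ab[OF bn(2) n] .
      then have "cm k n = \<one>"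
      proof -
        have "cm k n = b \<otimes> cm n' n \<otimes> inv b \<otimes> cm b n" using c bn(3) by (simp add: conj_simps)
        then show ?thesis using \<open>cm b n = \<one>\<close> \<open>cm n' n = \<one>\<close> c by simp
      qed
      then show "cm n k \<in> M"
        using cm_sym[of k n M] c bn(3) M(1) subgroup.one_closed[OF M(1)] by simp
    qed
    obtain b where b: "b \<in> B" "B \<subseteq> A <#> generate G {b}" using AB by (auto simp: cyc_def)
    have bc: "b \<in> carrier G" using b sub by blast
    let ?E = "?BN \<inter> M"
    let ?J = "?E <#> generate G {b}"
    have J: "subgroup ?J G" using cyc_gen_subgroup[OF E bc] .
    have EJ: "?E \<subseteq> ?J" and bJ: "b \<in> ?J"
      using set_mult_superset[OF normal_imp_subgroup[OF E] generate_singleton_subgroup[OF bc]]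
      by (auto intro: generate.incl)
    have AE: "A \<subseteq> ?E" using A(2) B(2) set_mult_superset(1)[OF Bs Ns] by blast
    have BJ: "B \<subseteq> ?J" using subset_of_cyc_gen[OF b(2) J _ bJ] AE EJ by blast
    \<comment> \<open>Write n = b'm; then m = b'^-1 n lies in BN \<inter> M. So \<open>N\<close>
      lies in \<open>?J\<close>, which is cyclic over BN \<inter> M, and meets the latter
      trivially.\<close>
    have "N \<subseteq> ?J"
    proof
      fix n assume n: "n \<in> N"
      then obtain b' m where bm: "b' \<in> B" "m \<in> M" "n = b' \<otimes> m" using M(3) sub set_mult_mem by blast
      have c: "b' \<in> carrier G" "m \<in> carrier G" using bm sub by auto
      have "m = inv b' \<otimes> n" using bm c by simp
      then have "m \<in> ?BN" using n subgroup.m_inv_closed[OF Bs bm(1)] by (auto simp: set_mult_mem)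
      then have "m \<in> ?J" using bm(2) EJ by blast
      then show "n \<in> ?J" using bm BJ subgroup.m_closed[OF J, of b' m] by blast
    qed
    then have "?J \<inter> N = N" by blast
    moreover have "?E \<inter> N = {\<one>}"
      using NM subgroup.one_closed[OF normal_imp_subgroup[OF E]] subgroup.one_closed[OF Ns] by blast
    moreover have "cyc ?E ?J" using bJ unfolding cyc_def by blast
    ultimately show ?thesis using cyc_Int[OF E J _ Ns] by simp
  qed
qed

end

context fin_group
begin

text \<open>An element \<open>g\<close> acts on \<open>B/N\<close> as a power map \<open>x \<mapsto> x\<^sup>m\<close>. The endomorphism
  \<open>x \<mapsto> gxg\<inverse>x\<^sup>-\<^sup>m\<close> of \<open>B\<close> commutes with \<open>G\<close> and maps \<open>B\<close> into the smaller group \<open>N\<close>;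
  so its kernel is a nontrivial normal subgroup of \<open>G\<close> and contains \<open>N\<close>.\<close>

lemma cyc_of_central_extension:
  assumes N: "N \<lhd> G" "N \<noteq> {\<one>}" and uniq: "\<And>R. R \<lhd> G \<Longrightarrow> R \<noteq> {\<one>} \<Longrightarrow> N \<subseteq> R"
    and B: "B \<lhd> G" "N \<subset> B" and ab: "\<And>x y. x \<in> B \<Longrightarrow> y \<in> B \<Longrightarrow> x \<otimes> y = y \<otimes> x"
    and cyc: "cyc N B" and cent: "\<And>x d. x \<in> B \<Longrightarrow> d \<in> derived G (carrier G) \<Longrightarrow> cm x d = \<one>"
  shows "cyc {\<one>} N"
proof -
  have Bs: "subgroup B G" and Ns: "subgroup N G" using B(1) N(1) by (simp_all add: normal_imp_subgroup)
  note Bc = subgroup.subset[OF Bs]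
  interpret Bg: comm_group "sub B"
    by (rule group.group_comm_groupI[OF subgroup_imp_group[OF Bs]]) (simp add: ab)
  have act: "\<exists>m::int. \<forall>n\<in>N. cj g n = n [^] m" if g: "g \<in> carrier G" for g
  proof -
    obtain m :: int where m: "\<And>x. x \<in> B \<Longrightarrow> N #> cj g x = N #> (x [^] m)"
      using cyc_conj_power[OF N(1) B(1) cyc g] by blast
    define f where "f x = cj g x \<otimes> inv (x [^] m)" for x
    have pB: "x [^] m \<in> B" if "x \<in> B" for x using subgroup_int_pow_closed[OF Bs that] .
    have fN: "f x \<in> N" if x: "x \<in> B" for x
      using m[OF x] rcos_eq_iff[OF Ns, of "cj g x" "x [^] m"] x g Bc by (auto simp: f_def)
    have pow_mult: "(x \<otimes> y) [^] m = x [^] m \<otimes> y [^] m" if "x \<in> B" "y \<in> B" for x y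
    proof -
      have "x \<in> carrier G" "y \<in> carrier G" using that Bc by auto
      then show ?thesis using int_pow_mult_distrib[OF ab[OF that]] by simp
    qed
    let ?K = "{x \<in> B. cj g x = x [^] m}"
    have Ks: "subgroup ?K G"
    proof (rule subgroupI)
      show "?K \<subseteq> carrier G" using Bc by blast
      have "\<one> \<in> ?K" using subgroup.one_closed[OF Bs] g by simp
      then show "?K \<noteq> {}" by blast
    next
      fix x assume "x \<in> ?K"
      then have x: "x \<in> B" "x \<in> carrier G" "cj g x = x [^] m" using Bc by auto
      have "cj g (inv x) = inv (cj g x)" using x(2) g by (simp add: conj_simps)
      also have "\<dots> = (inv x) [^] m" using x by (simp add: int_pow_inv)
      finally show "inv x \<in> ?K" using x subgroup.m_inv_closed[OF Bs] by blast
    next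
      fix x y assume "x \<in> ?K" "y \<in> ?K"
      then have xy: "x \<in> B" "x \<in> carrier G" "cj g x = x [^] m" "y \<in> B" "y \<in> carrier G" "cj g y = y [^] m" using Bc by auto
      have "cj g (x \<otimes> y) = (x \<otimes> y) [^] m" using xy cj_mult[OF g] pow_mult by simp
      then show "x \<otimes> y \<in> ?K" using xy subgroup.m_closed[OF Bs] by blast
    qed
    have Kn: "?K \<lhd> G"
    proof (rule normal_invI[OF Ks])
      fix h x assume h: "h \<in> carrier G" and "x \<in> ?K"
      then have x: "x \<in> B" "x \<in> carrier G" "cj g x = x [^] m" using Bc by auto
      \<comment> \<open>hg = d gh with d = [h, g] in the derived subgroup, which centralises
        \<open>B\<close>; so g and h commute in their action on \<open>B\<close>, and h maps the
        kernel of \<open>f\<close> to itself.\<close>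
      let ?d = "cm h g"
      have d: "?d \<in> derived G (carrier G)" using h g by (rule cm_in_derived)
      have dc: "?d \<in> carrier G" using h g by simp
      let ?y = "cj (g \<otimes> h) x"
      have yB: "?y \<in> B" using normalD[OF B(1) x(1)] g h by simp
      have yc: "?y \<in> carrier G" using yB Bc by blast
      have "cm ?y ?d = \<one>" using cent[OF yB d] .
      then have "cj ?d ?y = ?y" using cm_sym[OF yc dc triv_subgroup] inv_solve_right'[of \<one> "cj ?d ?y" ?y] yc dc
        by (simp add: m_assoc)
      moreover have "cj ?d ?y = cj h (cj g x)" using h g x(2) by (simp add: conj_simps)
      moreover have "?y = cj g (cj h x)" using h g x(2) by (simp add: conj_simps)
      moreover have "cj h (cj g x) = (cj h x) [^] m" using x cj_int_pow[OF h] by simp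
      ultimately have "cj g (cj h x) = (cj h x) [^] m" by simp
      then show "cj h x \<in> ?K" using normalD[OF B(1) x(1) h] by blast
    qed
    \<comment> \<open>With a trivial kernel \<open>f\<close> would embed \<open>B\<close> into its
      proper subgroup \<open>N\<close>.\<close>
    have "?K \<noteq> {\<one>}"
    proof
      assume K1: "?K = {\<one>}"
      have "inj_on f B"
      proof (rule inj_onI)
        fix x y assume x: "x \<in> B" and y: "y \<in> B" and "f x = f y"
        then have e: "cj g x \<otimes> inv (x [^] m) = cj g y \<otimes> inv (y [^] m)" by (simp add: f_def)
        have c: "x \<in> carrier G" "y \<in> carrier G" using x y Bc by auto
        let ?z = "x \<otimes> inv y"
        have iy: "inv y \<in> B" using subgroup.m_inv_closed[OF Bs y] .
        have z: "?z \<in> B" using subgroup.m_closed[OF Bs x iy] .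
        have gB: "cj g x \<in> B" "cj g y \<in> B" using normalD[OF B(1) _ g] x y by auto
        have gc: "cj g x \<in> carrier G" "cj g y \<in> carrier G" using gB Bc by auto
        have "cj g x = (cj g x \<otimes> inv (x [^] m)) \<otimes> x [^] m" using gc c by (simp add: m_assoc del: inv_closed)
        also have "\<dots> = cj g y \<otimes> (inv (y [^] m) \<otimes> x [^] m)" unfolding e using gc c by (simp add: m_assoc)
        finally have 1: "cj g x = cj g y \<otimes> (inv (y [^] m) \<otimes> x [^] m)" .
        have "cj g ?z = cj g x \<otimes> inv (cj g y)" using c g by (simp add: conj_simps)
        also have "\<dots> = inv (cj g y) \<otimes> cj g x" using ab[OF gB(1) subgroup.m_inv_closed[OF Bs gB(2)]] .
        also have "\<dots> = inv (y [^] m) \<otimes> x [^] m" unfolding 1 using gc c by (simp add: m_assoc)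
        also have "\<dots> = x [^] m \<otimes> inv (y [^] m)" using ab[OF subgroup.m_inv_closed[OF Bs pB[OF y]] pB[OF x]] .
        also have "\<dots> = ?z [^] m" using pow_mult[OF x iy] c by (simp add: int_pow_inv)
        finally have "?z \<in> ?K" using z by blast
        then have "?z = \<one>" using K1 by blast
        then show "x = y" using c inv_equality[of x "inv y"] by simp
      qed
      then have "card B = card (f ` B)" by (simp add: card_image)
      also have "\<dots> \<le> card N" using fN fin_subgroup[OF Ns] by (intro card_mono) auto
      also have "\<dots> < card B" using B(2) fin_subgroup[OF Bs] by (simp add: psubset_card_mono)
      finally show False by simp
    qed
    then have "N \<subseteq> ?K" using uniq[OF Kn] by blast
    then show ?thesis by blast
  qed
  obtain n where n: "n \<in> N" "n \<noteq> \<one>" using N(2) subgroup.one_closed[OF Ns] by blast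
  have nc: "n \<in> carrier G" using n(1) subgroup.mem_carrier[OF Ns] by blast
  \<comment> \<open>Every g acts on \<open>N\<close> by a power map, so each cyclic subgroup of
    \<open>N\<close> is normal in \<open>G\<close>; one that is nontrivial contains
    \<open>N\<close>, hence equals it.\<close>
  have L: "generate G {n} \<lhd> G"
    by (rule cyc_normal_of_power_action[OF N(1) n(1)]) (use act n(1) in blast)
  have "n \<in> generate G {n}" by (rule generate.incl) simp
  then have "N \<subseteq> generate G {n}" using uniq[OF L] n(2) by blast
  moreover have "generate G {n} \<subseteq> N" using n(1) by (intro generate_subgroup_incl[OF _ Ns]) simp
  ultimately show ?thesis using cyc_one_generate[OF nc] by simp
qed

text \<open>Commutation induces a bilinear map \<open>B/N \<times> Y/C\<^sub>Y(B) \<rightarrow> N\<close>; restricted to cyclic factors on both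
  sides its image is a cyclic normal subgroup.\<close>

lemma cyc_normal_of_commutators:
  assumes Y: "Y \<lhd> G" and N: "N \<lhd> G" "N \<subseteq> Y" and B: "B \<lhd> G" "N \<subseteq> B" "B \<subseteq> Y" 
    and cyc: "cyc N B" and cyc_chain: "cyc_chain N (carrier G)"
    and cent: "\<And>n y. n \<in> N \<Longrightarrow> y \<in> Y \<Longrightarrow> cm n y = \<one>"
    and comm: "\<And>b y. b \<in> B \<Longrightarrow> y \<in> Y \<Longrightarrow> cm b y \<in> N"
    and ne: "\<exists>b\<in>B. \<exists>y\<in>Y. cm b y \<noteq> \<one>"
  shows "\<exists>L. L \<lhd> G \<and> L \<noteq> {\<one>} \<and> cyc {\<one>} L"
proof -
  have Ys: "subgroup Y G" and Bs: "subgroup B G" and Ns: "subgroup N G"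
    using Y B(1) N(1) by (simp_all add: normal_imp_subgroup)
  have c: "Y \<subseteq> carrier G" "B \<subseteq> carrier G" using Ys Bs by (simp_all add: subgroup.subset)
  obtain b where b: "b \<in> B" "B \<subseteq> N <#> generate G {b}" using cyc by (auto simp: cyc_def)
  let ?C = "cent_mod Y B {\<one>}"
  have mC: "u \<in> ?C \<longleftrightarrow> u \<in> Y \<and> (\<forall>x\<in>B. cm x u = \<one>)" for u by (simp add: cent_mod_def)
  have cent': "cm y n = \<one>" if "n \<in> N" "y \<in> Y" for n y
    using cm_sym[OF _ _ triv_subgroup, of n y] cent[OF that] that N(2) c by auto
  have NC: "N \<inter> Y \<subseteq> ?C"
  proof
    fix n assume n: "n \<in> N \<inter> Y"
    then have "cm x n = \<one>" if "x \<in> B" for x using cent'[of n x] B(3) that by blast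
    then show "n \<in> ?C" using n mC by blast
  qed
  have nYC: "\<not> carrier G \<inter> Y \<subseteq> ?C" using ne c by (auto simp: mC)
  \<comment> \<open>The second cyclic factor: at this link the part of the chain inside
    \<open>Y\<close> stops centralising \<open>B\<close>.\<close>
  from cyc_chain_jump[OF cyc_chain, of "\<lambda>Z. Z \<inter> Y \<subseteq> ?C"] NC nYC
  obtain A' B' where AB: "A' \<lhd> G" "B' \<lhd> G" "A' \<subseteq> B'" "cyc A' B'" "A' \<inter> Y \<subseteq> ?C" "\<not> B' \<inter> Y \<subseteq> ?C" by blast
  have cy: "cyc (A' \<inter> Y) (B' \<inter> Y)" using cyc_Int[OF AB(1) normal_imp_subgroup[OF AB(2)] AB(4) Ys] .
  let ?B = "B' \<inter> Y"
  have Bn': "?B \<lhd> G" using AB(2) Y by (rule normal_Int)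
  have Bs': "subgroup ?B G" using Bn' by (rule normal_imp_subgroup)
  obtain y where y: "y \<in> ?B" "?B \<subseteq> (A' \<inter> Y) <#> generate G {y}" using cy unfolding cyc_def by blast
  have bc: "b \<in> carrier G" and yc: "y \<in> carrier G" using b y c by auto
  \<comment> \<open>The value of the pairing at the two generators; by bilinearity every commutator
    of \<open>B\<close> with B' \<inter> Y is a power of it.\<close>
  define d where "d = cm b y"
  have dN: "d \<in> N" using comm b(1) y(1) by (auto simp: d_def)
  have dc: "d \<in> carrier G" using dN subgroup.mem_carrier[OF Ns] by blast
  let ?L = "generate G {d}"
  have Ls: "subgroup ?L G" using dc by (rule generate_singleton_subgroup)
  have LN: "?L \<subseteq> N" using dN by (intro generate_subgroup_incl[OF _ Ns]) simp
  have YL: "normalizes Y ?L" unfolding normalizes_def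
  proof (intro ballI)
    fix u l assume u: "u \<in> Y" and l: "l \<in> ?L"
    have ul: "u \<in> carrier G" "l \<in> carrier G" using u l c Ls subgroup.mem_carrier by auto
    have "cm u l = \<one>" using cent'[of l u] u l LN by blast
    then have "cj u l = l" using inv_equality[of "cj u l" "inv l"] ul by simp
    then show "cj u l \<in> ?L" using l by simp
  qed
  \<comment> \<open>First variable: the x in \<open>B\<close> with [y, x] in \<open>?L\<close> form
    a subgroup that contains \<open>N\<close> and b.\<close>
  have 1: "cm x y \<in> ?L" if x: "x \<in> B" for x
  proof -
    have S: "subgroup (cent_mod B {y} ?L) G"
      using cent_mod_subgroup[OF Bs Ls _, of "{y}"] YL B(3) yc by (auto simp: normalizes_def)
    have "N \<subseteq> cent_mod B {y} ?L"
      using cent' y(1) B(2) subgroup.one_closed[OF Ls] by (auto simp: cent_mod_def)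
    moreover have "cm y b \<in> ?L"
      using cm_sym[OF bc yc Ls] generate.incl[of d "{d}" G] by (simp add: d_def)
    then have "b \<in> cent_mod B {y} ?L" using b(1) by (simp add: cent_mod_def)
    ultimately have "B \<subseteq> cent_mod B {y} ?L" using subset_of_cyc_gen[OF b(2) S] by blast
    then have "cm y x \<in> ?L" using x by (auto simp: cent_mod_def)
    then show ?thesis using cm_sym[OF yc _ Ls] x c(2) by blast
  qed
  \<comment> \<open>Second variable: the u with [x, u] in \<open>?L\<close> for all x in
    \<open>B\<close> form a subgroup that contains A' \<inter> Y and y.\<close>
  have 2: "cm x u \<in> ?L" if x: "x \<in> B" and u: "u \<in> ?B" for x u
  proof -
    have S: "subgroup (cent_mod ?B B ?L) G"
      using cent_mod_subgroup[OF Bs' Ls _ c(2)] YL by (auto simp: normalizes_def)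
    have "A' \<inter> Y \<subseteq> cent_mod ?B B ?L"
      using AB(3,5) subgroup.one_closed[OF Ls] by (auto simp: cent_mod_def)
    moreover have "y \<in> cent_mod ?B B ?L" using 1 y(1) by (simp add: cent_mod_def)
    ultimately have "?B \<subseteq> cent_mod ?B B ?L" using subset_of_cyc_gen[OF y(2) S] by blast
    then show ?thesis using x u by (auto simp: cent_mod_def)
  qed
  have "?L \<lhd> G"
  proof (rule cyc_normal_of_power_action[OF N(1) dN])
    fix g assume g: "g \<in> carrier G"
    have "cj g d = cm (cj g b) (cj g y)" unfolding d_def using cj_cm[OF g bc yc] .
    then have "cj g d \<in> ?L" using 2[OF normalD[OF B(1) b(1) g] normalD[OF Bn' y(1) g]] by simp
    then show "\<exists>m::int. cj g d = d [^] m" using mem_generate_singleton[OF dc] by blast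
  qed
  moreover have "?L \<noteq> {\<one>}"
  proof
    assume "?L = {\<one>}"
    then have "cm x u = \<one>" if "x \<in> B" "u \<in> ?B" for x u using 2[OF that] by blast
    then show False using AB(6) by (auto simp: mC)
  qed
  ultimately show ?thesis using cyc_one_generate[OF dc] by blast
qed

lemma ex_minimal_normal:
  assumes "R \<lhd> G" "R \<noteq> {\<one>}"
  obtains N where "minimal_normal G N" "N \<subseteq> R"
proof -
  let ?P = "\<lambda>N. N \<lhd> G \<and> N \<noteq> {\<one>}"
  obtain N where "?P N" "N \<subseteq> R" "\<And>K. ?P K \<Longrightarrow> K \<subseteq> N \<Longrightarrow> K = N"
    using ex_minimal_set[of ?P R] assms normal_subset by metis
  then show thesis using that[of N] unfolding minimal_normal_def by blast
qed

text \<open>If \<open>N\<close> were equal to its derived subgroup, it would lie in every term of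
  the derived series of \<open>G\<close>, which reaches 1.\<close>

lemma minimal_normal_abelian:
  assumes N: "minimal_normal G N" and sol: "solvable G" and x: "x \<in> N" and y: "y \<in> N"
  shows "cm x y = \<one>"
proof -
  have Nn: "N \<lhd> G" "N \<noteq> {\<one>}" using N by (auto simp: minimal_normal_def)
  note Ns = normal_imp_subgroup[OF Nn(1)]
  have C: "comm_subgroup G N N \<lhd> G" using comm_subgroup_normal Nn(1) by blast
  have CN: "comm_subgroup G N N \<subseteq> N"
    by (rule comm_subgroup_subset[OF Ns]) (simp add: subgroup.m_closed[OF Ns] subgroup.m_inv_closed[OF Ns])
  have "comm_subgroup G N N \<noteq> N"
  proof
    assume eq: "comm_subgroup G N N = N"
    obtain n where n: "(derived G ^^ n) (carrier G) = {\<one>}" using sol solvable_iff_trivial_derived_seq by blast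
    have "N \<subseteq> (derived G ^^ n) (carrier G)" for n
    proof (induction n)
      case 0
      then show ?case using subgroup.subset[OF Ns] by simp
    next
      case (Suc n)
      have "derived_set G N \<subseteq> derived_set G ((derived G ^^ n) (carrier G))" using Suc by blast
      then have "derived G N \<subseteq> (derived G ^^ Suc n) (carrier G)" by (simp add: derived_def mono_generate)
      moreover have "comm_subgroup G N N \<subseteq> derived G N"
        unfolding comm_subgroup_def derived_def by (rule mono_generate) blast
      ultimately show ?case using eq by blast
    qed
    then show False using n Nn subgroup.one_closed[OF Ns] by blast
  qed
  then have "comm_subgroup G N N = {\<one>}" using N C CN unfolding minimal_normal_def by blast
  then show ?thesis using cm_in_comm_subgroup[OF x y] by blast
qed

end

context fin_group
begin

text \<open>The inductive step of the criterion. In a counterexample no nontrivial normal subgroup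
  is cyclic, since the chain above it would extend down to 1; most configurations below are excluded
  by exhibiting such a subgroup.\<close>

theorem cyc_chain_if_proper_quotients:
  assumes sol: "solvable G"
    and good: "\<And>M. maximal_subgroup G M \<Longrightarrow>
      \<exists>A B. A \<lhd> G \<and> B \<lhd> G \<and> A \<subseteq> M \<and> A \<subseteq> B \<and> \<not> B \<subseteq> M \<and> cyc A B"
    and sub: "\<And>N. N \<lhd> G \<Longrightarrow> N \<noteq> {\<one>} \<Longrightarrow> cyc_chain N (carrier G)"
  shows "cyc_chain {\<one>} (carrier G)"
proof (rule ccontr)
  assume no: "\<not> cyc_chain {\<one>} (carrier G)"
  have nocyc: False if L: "L \<lhd> G" "L \<noteq> {\<one>}" "cyc {\<one>} L" for L
  proof -
    have "{\<one>} \<subseteq> L" using subgroup.one_closed[OF normal_imp_subgroup[OF L(1)]] by blast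
    then show False using cyc_chain_step[OF one_is_normal L(1) _ L(3) sub[OF L(1,2)]] no by blast
  qed
  have c1: "carrier G \<noteq> {\<one>}" using no cyc_chain_refl[OF one_is_normal] by auto
  obtain N where N: "minimal_normal G N" using ex_minimal_normal[OF normal_self c1] by blast
  have Nn: "N \<lhd> G" "N \<noteq> {\<one>}" using N by (auto simp: minimal_normal_def)
  note Ns = normal_imp_subgroup[OF Nn(1)]
  have ueN: "cyc_chain N (carrier G)" using sub Nn by blast
  note Nc = subgroup.subset[OF Ns]
  have noN: "\<not> cyc {\<one>} N" using nocyc Nn by blast
  \<comment> \<open>If \<open>M\<close> avoided \<open>N\<close>, the cyclic factor that
    \<open>good\<close> provides for \<open>M\<close> would make \<open>N\<close> cyclic.\<close>
  have NM: "N \<subseteq> M" if M: "maximal_subgroup G M" for M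
  proof (rule ccontr)
    assume n: "\<not> N \<subseteq> M"
    obtain A B where AB: "A \<lhd> G" "B \<lhd> G" "A \<subseteq> M" "A \<subseteq> B" "\<not> B \<subseteq> M" "cyc A B" using good[OF M] by blast
    have Ms: "subgroup M G" using M by (simp add: maximal_subgroup_def)
    show False
      using cyc_of_avoiding_maximal[OF N minimal_normal_abelian[OF N sol] Ms maximal_mult[OF M Nn(1) n]
          maximal_mult[OF M AB(2,5)] n AB(1,3,2,4,6)] noN by blast
  qed
  \<comment> \<open>Otherwise \<open>N\<close> embeds into G/R, where the chain of cyclic factors
    makes it cyclic.\<close>
  have uniq: "N \<subseteq> R" if R: "R \<lhd> G" "R \<noteq> {\<one>}" for R
  proof (rule ccontr)
    assume n: "\<not> N \<subseteq> R"
    show False using minimal_normal_cyc[OF N sub[OF R] minimal_normalD[OF N R(1) n] Nc] noN by blast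
  qed
  have "card N \<noteq> 1" using Nn(2) subgroup.one_closed[OF Ns] by (metis card_1_singletonE singletonD)
  then obtain p where p: "Factorial_Ring.prime p" "p dvd card N" using prime_factor_nat by blast
  have pq: "q = p" if q: "Q \<lhd> G" "Q \<noteq> {\<one>}" "card Q = q ^ k" "Factorial_Ring.prime q" for Q q k
  proof -
    have "card N dvd card Q" using card_subgroup_dvd[OF Ns normal_imp_subgroup[OF q(1)] uniq[OF q(1,2)]] .
    then have "p dvd q ^ k" using p(2) q(3) dvd_trans by metis
    then have "p dvd q" using p(1) prime_dvd_power_nat by blast
    then show ?thesis using p(1) q(4) primes_dvd_imp_eq by blast
  qed
  obtain Y where Y: "sylow_subgroup G p Y" using ex_sylow[OF p(1)] by blast
  then have Ys: "subgroup Y G" and Yk: "card Y = p ^ multiplicity p (card (carrier G))"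
    by (auto simp: sylow_subgroup_def)
  \<comment> \<open>The Sylow subgroups of \<open>Z\<close> are normal in \<open>G\<close>; those
    for primes other than p are trivial by \<open>pq\<close>.\<close>
  have inY: "Z \<subseteq> Y" if Z: "Z \<lhd> G" "nilp_over_maximal Z" for Z
  proof (rule subgroup_subset_if_sylow_subset[OF normal_imp_subgroup[OF Z(1)] Ys])
    fix q :: nat assume q: "Factorial_Ring.prime q"
    obtain Q where Q: "sylow_subgroup (sub Z) q Q" using ex_sylow_in[OF normal_imp_subgroup[OF Z(1)] q] by blast
    have Qn: "Q \<lhd> G" using sylow_normal[OF Z Q] .
    note Qs = sylow_subgroup_carrierD[OF normal_imp_subgroup[OF Z(1)] Q]
    have "Q \<subseteq> Y"
    proof (cases "Q = {\<one>}")
      case True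
      then show ?thesis using subgroup.one_closed[OF Ys] by blast
    next
      case False
      then have "q = p" using pq[OF Qn _ Qs(4) Qs(1)] by blast
      then show ?thesis using normal_p_subgroup_in_sylow[OF Y Qn] Qs(4) by blast
    qed
    then show "\<exists>Q. sylow_subgroup (sub Z) q Q \<and> Q \<subseteq> Y" using Q by blast
  qed
  let ?K = "derived G (carrier G)"
  have K: "?K \<lhd> G" by (rule derived_self_is_normal)
  \<comment> \<open>Along the chain above \<open>N\<close> take the link at which the part inside
    the derived subgroup leaves \<open>M\<close>; the derived subgroup centralises this
    factor.\<close>
  have "nilp_over_maximal ?K"
    unfolding nilp_over_maximal_def
  proof (intro allI impI)
    fix M assume M: "maximal_subgroup G M \<and> \<not> ?K \<subseteq> M"
    have "N \<inter> ?K \<subseteq> M" using NM M by blast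
    moreover have "\<not> carrier G \<inter> ?K \<subseteq> M" using M normal_subset[OF K] by blast
    ultimately obtain A B where AB: "A \<lhd> G" "B \<lhd> G" "cyc A B" "A \<inter> ?K \<subseteq> M" "\<not> B \<inter> ?K \<subseteq> M"
      using cyc_chain_jump[OF ueN, of "\<lambda>Z. Z \<inter> ?K \<subseteq> M"] by blast
    have "cm b k \<in> M" if b: "b \<in> B \<inter> ?K" and k: "k \<in> ?K" for b k
    proof -
      have "cm b k \<in> A" using derived_centralizes_cyc[OF AB(1,2,3)] b k by blast
      moreover have "cm b k \<in> ?K"
        using cm_in_normal_subgroup[OF K, of b k] b k normal_subset[OF K] by blast
      ultimately show ?thesis using AB(4) by blast
    qed
    then show "\<exists>B. B \<lhd> G \<and> B \<subseteq> ?K \<and> \<not> B \<subseteq> M \<and> (\<forall>b\<in>B. \<forall>k\<in>?K. cm b k \<in> M)"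
      using normal_Int[OF AB(2) K] AB(5) by blast
  qed
  then have KY: "?K \<subseteq> Y" using inY K by blast
  have cmK: "cm x y \<in> ?K" if "x \<in> carrier G" "y \<in> carrier G" for x y
    using that by (rule cm_in_derived)
  have Yn: "Y \<lhd> G"
  proof (rule normal_invI[OF Ys])
    fix g y assume g: "g \<in> carrier G" and y: "y \<in> Y"
    have yc: "y \<in> carrier G" using y subgroup.mem_carrier[OF Ys] by blast
    have "cm g y \<otimes> y \<in> Y" using subgroup.m_closed[OF Ys _ y] KY cmK[OF g yc] by blast
    then show "cj g y \<in> Y" using g yc by (simp add: m_assoc)
  qed
  note Yc = subgroup.subset[OF Ys]
  have N1: "{\<one>} \<subset> N" using Nn(2) subgroup.one_closed[OF Ns] by blast
  \<comment> \<open>Vacuously true, as \<open>N\<close> lies in every maximal subgroup.\<close>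
  have "nilp_over_maximal N" using NM by (auto simp: nilp_over_maximal_def)
  then have NY: "N \<subseteq> Y" using inY Nn(1) by blast
  have nY: "normalizes Y {\<one>}" "normalizes Y N" "normalizes Y Y"
    using normal_imp_normalizes[OF one_is_normal Yc] normal_imp_normalizes[OF Nn(1) Yc] normal_imp_normalizes[OF Yn Yc] .
  let ?Z = "cent_mod Y Y {\<one>}"
  have Z: "?Z \<lhd> G" using cent_mod_normal[OF Yn Yn one_is_normal] .
  have memZ: "x \<in> ?Z \<longleftrightarrow> x \<in> Y \<and> (\<forall>y\<in>Y. cm y x = \<one>)" for x by (simp add: cent_mod_def)
  have sym1: "cm y x = \<one>" if "cm x y = \<one>" "x \<in> Y" "y \<in> Y" for x y
    using cm_sym[OF _ _ triv_subgroup, of x y] that Yc by auto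
  obtain x where x: "x \<in> N - {\<one>}" "\<forall>y\<in>Y. cm x y \<in> {\<one>}"
    using p_group_central_step[OF p(1) Ys Yk triv_subgroup nY(1) Ns nY(2) N1 NY] by blast
  then have "x \<in> ?Z" using NY sym1[of x] by (auto simp: memZ)
  then have "?Z \<noteq> {\<one>}" using x by blast
  then have NZ: "N \<subseteq> ?Z" using uniq[OF Z] by blast
  \<comment> \<open>A cyclic factor sitting directly on \<open>N\<close> inside \<open>W\<close>
    arises by intersecting with \<open>W\<close> a link at which the intersection grows beyond
    \<open>N\<close>.\<close>
  have jump: "\<exists>B. B \<lhd> G \<and> N \<subset> B \<and> B \<subseteq> W \<and> cyc N B" if W: "W \<lhd> G" "N \<subset> W" for W
  proof -
    have "\<not> carrier G \<inter> W \<subseteq> N" using W normal_subset[OF W(1)] by blast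
    then obtain A B where AB: "A \<lhd> G" "B \<lhd> G" "N \<subseteq> A" "A \<subseteq> B" "cyc A B" "A \<inter> W \<subseteq> N" "\<not> B \<inter> W \<subseteq> N"
      using cyc_chain_jump[OF ueN, of "\<lambda>Z. Z \<inter> W \<subseteq> N"] by blast
    have "A \<inter> W = N" using AB(3,6) W(2) by blast
    then have "cyc N (B \<inter> W)"
      using cyc_Int[OF AB(1) normal_imp_subgroup[OF AB(2)] AB(5) normal_imp_subgroup[OF W(1)]] by simp
    moreover have "N \<subset> B \<inter> W" using AB(3,4,7) W(2) by blast
    ultimately show ?thesis using normal_Int[OF AB(2) W(1)] by blast
  qed
  show False
  \<comment> \<open>Either there is room above \<open>N\<close> in the centre of \<open>Y\<close>,
    where the power maps can be compared, or Z(Y) = N, so that nothing above \<open>N\<close>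
    commutes with \<open>Y\<close>.\<close>
  proof (cases "?Z = N")
    case False
    then obtain B where B: "B \<lhd> G" "N \<subset> B" "B \<subseteq> ?Z" "cyc N B" using jump[OF Z] NZ by blast
    have BY: "B \<subseteq> Y" using B(3) by (auto simp: cent_mod_def)
    have "x \<otimes> y = y \<otimes> x" if "x \<in> B" "y \<in> B" for x y
    proof -
      have c: "x \<in> carrier G" "y \<in> carrier G" using that BY Yc by auto
      have "cm x y = \<one>" using that B(3) BY memZ by blast
      then have "x \<otimes> y \<otimes> inv (y \<otimes> x) = \<one>" using c by (simp add: conj_simps)
      then show ?thesis using c inv_solve_right'[of "x \<otimes> y" \<one> "y \<otimes> x"] inv_equality by (metis inv_closed inv_inv m_closed)
    qed
    moreover have "cm x d = \<one>" if "x \<in> B" "d \<in> ?K" for x d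
      using that B(3) KY memZ sym1[of d x] BY by blast
    ultimately have "cyc {\<one>} N" using cyc_of_central_extension[OF Nn uniq B(1,2) _ B(4)] by blast
    then show False using noN by blast
  next
    case ZN: True
    show False
    proof (cases "Y = N")
      case False
      then have NYs: "N \<subset> Y" using NY by blast
      \<comment> \<open>The second centre of \<open>Y\<close>, since Z(Y) = N here; its commutators
        with \<open>Y\<close> lie in \<open>N\<close>, which is central in \<open>Y\<close>.\<close>
      let ?Z2 = "cent_mod Y Y N"
      have Z2: "?Z2 \<lhd> G" using cent_mod_normal[OF Yn Yn Nn(1)] .
      obtain x where x: "x \<in> Y - N" "\<forall>y\<in>Y. cm x y \<in> N"
        using p_group_central_step[OF p(1) Ys Yk Ns nY(2) Ys nY(3) NYs subset_refl] by blast
      have symN: "cm y x \<in> N" if "cm x y \<in> N" "x \<in> Y" "y \<in> Y" for x y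
        using cm_sym[OF _ _ Ns, of x y] that Yc by auto
      have "x \<in> ?Z2" using x symN[of x] by (auto simp: cent_mod_def)
      moreover have "N \<subseteq> ?Z2"
        using cm_in_normal(2)[OF Ns nY(2) _ _ Yc] NY by (auto simp: cent_mod_def)
      ultimately have "N \<subset> ?Z2" using x by blast
      then obtain B where B: "B \<lhd> G" "N \<subset> B" "B \<subseteq> ?Z2" "cyc N B" using jump[OF Z2] by blast
      have BY: "B \<subseteq> Y" using B(3) by (auto simp: cent_mod_def)
      have bY: "cm b y \<in> N" if "b \<in> B" "y \<in> Y" for b y
      proof -
        have "cm y b \<in> N" using that B(3) by (auto simp: cent_mod_def)
        then show ?thesis using symN[of y b] that BY by blast
      qed
      have ne: "\<exists>b\<in>B. \<exists>y\<in>Y. cm b y \<noteq> \<one>"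
      proof -
        obtain b where b: "b \<in> B" "b \<notin> ?Z" using B(2) ZN by blast
        then obtain y where "y \<in> Y" "cm y b \<noteq> \<one>" using BY memZ by blast
        then show ?thesis using b(1) sym1[of b y] BY by blast
      qed
      have cN: "cm n y = \<one>" if "n \<in> N" "y \<in> Y" for n y
      proof -
        have "cm y n = \<one>" using NZ that memZ by blast
        then show ?thesis using sym1[of y n] that NY by blast
      qed
      have NB: "N \<subseteq> B" using B(2) by blast
      show False
        using cyc_normal_of_commutators[OF Yn Nn(1) NY B(1) NB BY B(4) ueN cN bY ne] nocyc by blast
    next
      case True
      \<comment> \<open>Now the derived subgroup lies in \<open>N\<close>, hence in every maximal
        subgroup, so \<open>inY\<close> applies to \<open>G\<close> itself and gives G = N, which
        lies in each \<open>M\<close>.\<close>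
      have "nilp_over_maximal (carrier G)"
        unfolding nilp_over_maximal_def
      proof (intro allI impI)
        fix M assume M: "maximal_subgroup G M \<and> \<not> carrier G \<subseteq> M"
        have "cm b k \<in> M" if "b \<in> carrier G" "k \<in> carrier G" for b k
          using cmK[OF that] KY True NM M by blast
        then show "\<exists>B. B \<lhd> G \<and> B \<subseteq> carrier G \<and> \<not> B \<subseteq> M \<and> (\<forall>b\<in>B. \<forall>k\<in>carrier G. cm b k \<in> M)"
          using normal_self M by blast
      qed
      then have "carrier G \<subseteq> N" using inY[OF normal_self] True by blast
      moreover obtain M where M: "maximal_subgroup G M"
        using ex_maximal_subgroup[OF triv_subgroup] c1 by blast
      ultimately have "carrier G \<subseteq> M" using NM by blast
      then show False using M subgroup.subset[of M G] by (auto simp: maximal_subgroup_def)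
    qed
  qed
qed

end

section \<open>Images and preimages under surjective homomorphisms\<close>

locale surj_hom = group_hom +
  assumes surj: "h ` carrier G = carrier H"

context surj_hom
begin

abbreviation preim :: "'c set \<Rightarrow> 'a set" where
  "preim N \<equiv> {x \<in> carrier G. h x \<in> N}"

lemma preim_subgroup: "subgroup N H \<Longrightarrow> subgroup (preim N) G"
proof -
  assume N: "subgroup N H"
  show ?thesis
  proof (rule G.subgroupI)
    have "\<one>\<^bsub>G\<^esub> \<in> preim N" using subgroup.one_closed[OF N] by simp
    then show "preim N \<noteq> {}" by blast
  qed (auto simp: subgroup.m_closed[OF N] subgroup.m_inv_closed[OF N])
qed

lemma preim_normal: "N \<lhd> H \<Longrightarrow> preim N \<lhd> G"
proof (rule G.normal_invI)
  assume N: "N \<lhd> H"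
  then show "subgroup (preim N) G" using normal_imp_subgroup preim_subgroup by blast
  fix g x assume "g \<in> carrier G" "x \<in> preim N"
  then show "G.cj g x \<in> preim N" using H.normalD[OF N, of "h x" "h g"] by simp
qed

lemma image_preim: "N \<subseteq> carrier H \<Longrightarrow> h ` preim N = N"
  using surj by (auto simp: image_iff set_eq_iff subset_iff) (metis image_iff)

lemma preim_image:
  assumes K: "subgroup K G" and ker: "kernel G H h \<subseteq> K"
  shows "preim (h ` K) = K"
proof
  show "K \<subseteq> preim (h ` K)" using subgroup.subset[OF K] by blast
  show "preim (h ` K) \<subseteq> K"
  proof
    fix x assume "x \<in> preim (h ` K)"
    then obtain k where k: "x \<in> carrier G" "k \<in> K" "h x = h k" by auto
    have kc: "k \<in> carrier G" using subgroup.mem_carrier[OF K k(2)] .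
    have "h (x \<otimes>\<^bsub>G\<^esub> inv\<^bsub>G\<^esub> k) = \<one>\<^bsub>H\<^esub>" using k kc by simp
    then have "x \<otimes>\<^bsub>G\<^esub> inv\<^bsub>G\<^esub> k \<in> K" using ker k kc by (auto simp: kernel_def)
    then have "x \<otimes>\<^bsub>G\<^esub> inv\<^bsub>G\<^esub> k \<otimes>\<^bsub>G\<^esub> k \<in> K" using subgroup.m_closed[OF K] k(2) by blast
    then show "x \<in> K" using k(1) kc by (simp add: G.m_assoc)
  qed
qed

lemma image_normal: "N \<lhd> G \<Longrightarrow> h ` N \<lhd> H"
  using normal.surj_hom_normal_subgroup[OF _ group_hom_axioms surj] .

lemma kernel_subset_preim: "subgroup N H \<Longrightarrow> kernel G H h \<subseteq> preim N"
  using subgroup.one_closed by (auto simp: kernel_def)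

lemma preim_maximal:
  assumes M: "maximal_subgroup H M"
  shows "maximal_subgroup G (preim M)"
proof -
  have Ms: "subgroup M H" "M \<noteq> carrier H" using M by (auto simp: maximal_subgroup_def)
  have Mc: "M \<subseteq> carrier H" using Ms(1) by (rule subgroup.subset)
  have "preim M \<noteq> carrier G" using image_preim[OF Mc] surj Ms(2) by auto
  moreover have "K = preim M \<or> K = carrier G" if K: "subgroup K G" "preim M \<subseteq> K" for K
  proof -
    have "M \<subseteq> h ` K" using image_preim[OF Mc] K(2) by blast
    then have "h ` K = M \<or> h ` K = carrier H"
      using M subgroup_img_is_subgroup[OF K(1)] by (auto simp: maximal_subgroup_def)
    moreover have "preim (h ` K) = K" using preim_image[OF K(1)] kernel_subset_preim[OF Ms(1)] K(2) by blast
    ultimately show ?thesis using hom_closed by auto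
  qed
  ultimately show ?thesis using preim_subgroup[OF Ms(1)] by (simp add: maximal_subgroup_def)
qed

lemma cyc_image:
  assumes "A \<subseteq> carrier G" "B \<subseteq> carrier G" "G.cyc A B"
  shows "H.cyc (h ` A) (h ` B)"
proof -
  obtain b where b: "b \<in> B" "B \<subseteq> A <#>\<^bsub>G\<^esub> generate G {b}" using assms(3) by (auto simp: G.cyc_def)
  have bc: "b \<in> carrier G" using b assms by blast
  have "h ` B \<subseteq> h ` A <#>\<^bsub>H\<^esub> generate H {h b}"
  proof
    fix y assume "y \<in> h ` B"
    then obtain x where x: "x \<in> B" "y = h x" by blast
    then have "x \<in> A <#>\<^bsub>G\<^esub> generate G {b}" using b(2) by blast
    then obtain a u where au: "a \<in> A" "u \<in> generate G {b}" "y = h (a \<otimes>\<^bsub>G\<^esub> u)" using x(2) by (auto simp: G.set_mult_mem)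
    have "a \<in> carrier G" "u \<in> carrier G" using au assms(1) G.generate_in_carrier[of "{b}" u] bc by auto
    moreover have "h u \<in> generate H {h b}" using generate_img[of "{b}"] bc au(2) by auto
    ultimately show "y \<in> h ` A <#>\<^bsub>H\<^esub> generate H {h b}" using au by (auto simp: H.set_mult_mem)
  qed
  then show ?thesis using b(1) by (auto simp: H.cyc_def)
qed

lemma cyc_preim:
  assumes A: "A \<lhd> H" and B: "B \<lhd> H" and cyc: "H.cyc A B"
  shows "G.cyc (preim A) (preim B)"
proof -
  obtain b' where b': "b' \<in> B" "B \<subseteq> A <#>\<^bsub>H\<^esub> generate H {b'}" using cyc by (auto simp: H.cyc_def)
  have c: "A \<subseteq> carrier H" "B \<subseteq> carrier H" using H.normal_subset A B by auto
  obtain b where b: "b \<in> carrier G" "h b = b'" using b'(1) c surj by (metis imageE subsetD)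
  have "x \<in> preim A <#>\<^bsub>G\<^esub> generate G {b}" if x: "x \<in> preim B" for x
  proof -
    have "h x \<in> A <#>\<^bsub>H\<^esub> generate H {b'}" using x b'(2) by blast
    then obtain a u where au: "a \<in> A" "u \<in> generate H {b'}" "h x = a \<otimes>\<^bsub>H\<^esub> u" by (auto simp: H.set_mult_mem)
    obtain v where v: "v \<in> generate G {b}" "u = h v" using generate_img[of "{b}"] b au(2) by auto
    have vc: "v \<in> carrier G" using G.generate_in_carrier[of "{b}"] v b by auto
    let ?a = "x \<otimes>\<^bsub>G\<^esub> inv\<^bsub>G\<^esub> v"
    have "h ?a = a" using x v vc au c by (simp add: H.m_assoc subsetD)
    then have "?a \<in> preim A" using x vc au by simp
    moreover have "x = ?a \<otimes>\<^bsub>G\<^esub> v" using x vc by (simp add: G.m_assoc)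
    ultimately show ?thesis using v(1) unfolding G.set_mult_mem by blast
  qed
  moreover have "b \<in> preim B" using b b'(1) by simp
  ultimately show ?thesis unfolding G.cyc_def by blast
qed

lemma cyc_chain_image: "G.cyc_chain A C \<Longrightarrow> H.cyc_chain (h ` A) (h ` C)"
proof (induction rule: G.cyc_chain.induct)
  case (cyc_chain_refl A)
  then show ?case by (simp add: H.cyc_chain.cyc_chain_refl image_normal)
next
  case (cyc_chain_step A B C)
  show ?case
    using H.cyc_chain.cyc_chain_step[OF image_normal[OF cyc_chain_step(1)] image_normal[OF cyc_chain_step(2)] image_mono[OF cyc_chain_step(3)]
      cyc_image[OF G.normal_subset[OF cyc_chain_step(1)] G.normal_subset[OF cyc_chain_step(2)] cyc_chain_step(4)] cyc_chain_step(6)] .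
qed

lemma cyc_chain_preim: "H.cyc_chain A C \<Longrightarrow> G.cyc_chain (preim A) (preim C)"
proof (induction rule: H.cyc_chain.induct)
  case (cyc_chain_refl A)
  then show ?case by (simp add: G.cyc_chain.cyc_chain_refl preim_normal)
next
  case (cyc_chain_step A B C)
  have "preim A \<subseteq> preim B" using cyc_chain_step(3) by blast
  then show ?case
    using G.cyc_chain.cyc_chain_step[OF preim_normal[OF cyc_chain_step(1)] preim_normal[OF cyc_chain_step(2)] _ cyc_preim[OF cyc_chain_step(1,2,4)] cyc_chain_step(6)] by blast
qed

end

context group
begin

lemma rcos_surj_hom: "A \<lhd> G \<Longrightarrow> surj_hom G (G Mod A) (\<lambda>x. A #> x)"
  by (simp add: surj_hom_def surj_hom_axioms_def rcos_group_hom carrier_FactGroup)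

lemma rcos_eq_self_iff: "subgroup A G \<Longrightarrow> x \<in> carrier G \<Longrightarrow> A #> x = A \<longleftrightarrow> x \<in> A"
  using coset_join1[of A x] coset_join2[of x A] subgroup.subset by blast

lemma cyc_chain_of_quotient:
  assumes A: "A \<lhd> G" and cyc_chain: "group.cyc_chain (G Mod A) {\<one>\<^bsub>G Mod A\<^esub>} (carrier (G Mod A))"
  shows "cyc_chain A (carrier G)"
proof -
  interpret f: surj_hom G "G Mod A" "\<lambda>x. A #> x" using A by (rule rcos_surj_hom)
  have "f.preim {\<one>\<^bsub>G Mod A\<^esub>} = A"
    using rcos_eq_self_iff[OF normal_imp_subgroup[OF A]] normal_subset[OF A] by auto
  moreover have "f.preim (carrier (G Mod A)) = carrier G" using f.hom_closed by blast
  ultimately show ?thesis using f.cyc_chain_preim[OF cyc_chain] by simp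
qed

end

context fin_group
begin

text \<open>Induction on the index of \<open>D\<close>; \<open>D\<close> is kept general so that
  \<open>G\<close> and its maximal subgroups stay fixed. The cyclic factors for maximal subgroups of
  G/D are images of those for their preimages, and nontrivial normal subgroups of G/D have preimages
  larger than \<open>D\<close>, to which the induction hypothesis applies.\<close>

theorem cyc_chain_if_maximal_avoid_cyc:
  assumes sol: "solvable G"
    and good: "\<And>M. maximal_subgroup G M \<Longrightarrow>
      \<exists>A B. A \<lhd> G \<and> B \<lhd> G \<and> A \<subseteq> M \<and> A \<subseteq> B \<and> \<not> B \<subseteq> M \<and> cyc A B"
    and D: "D \<lhd> G"
  shows "cyc_chain D (carrier G)"
  using D
proof (induction "card (carrier G) - card D" arbitrary: D rule: less_induct)
  case less
  interpret f: surj_hom G "G Mod D" "\<lambda>x. D #> x" using less(2) by (rule rcos_surj_hom)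
  interpret Q: fin_group "G Mod D"
    by (simp add: fin_group_def fin_group_axioms_def f.H.is_group carrier_FactGroup fin)
  note Ds = normal_imp_subgroup[OF less(2)]
  have ker: "kernel G (G Mod D) (\<lambda>x. D #> x) = D"
    using rcos_eq_self_iff[OF Ds] normal_subset[OF less(2)] by (auto simp: kernel_def)
  show ?case
  proof (rule cyc_chain_of_quotient[OF less(2)], rule Q.cyc_chain_if_proper_quotients)
    have "solvable_seq (G Mod D) ((\<lambda>x. D #> x) ` carrier G)"
      using f.solvable_imp_solvable_img sol by (simp add: solvable_def)
    then show "solvable (G Mod D)" using f.surj by (simp add: solvable_def)
  next
    fix M assume M: "maximal_subgroup (G Mod D) M"
    then obtain A B where AB: "A \<lhd> G" "B \<lhd> G" "A \<subseteq> f.preim M" "A \<subseteq> B" "\<not> B \<subseteq> f.preim M" "cyc A B"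
      using good[OF f.preim_maximal[OF M]] by blast
    show "\<exists>A B. A \<lhd> G Mod D \<and> B \<lhd> G Mod D \<and> A \<subseteq> M \<and> A \<subseteq> B \<and> \<not> B \<subseteq> M \<and> f.H.cyc A B"
    proof (intro exI conjI)
      show "(\<lambda>x. D #> x) ` A \<lhd> G Mod D" "(\<lambda>x. D #> x) ` B \<lhd> G Mod D"
        using f.image_normal AB by blast+
      show "(\<lambda>x. D #> x) ` A \<subseteq> M" "(\<lambda>x. D #> x) ` A \<subseteq> (\<lambda>x. D #> x) ` B" "\<not> (\<lambda>x. D #> x) ` B \<subseteq> M"
        using AB normal_subset[OF AB(2)] by blast+
      show "f.H.cyc ((\<lambda>x. D #> x) ` A) ((\<lambda>x. D #> x) ` B)"
        using f.cyc_image[OF normal_subset[OF AB(1)] normal_subset[OF AB(2)] AB(6)] .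
    qed
  next
    fix N assume N: "N \<lhd> G Mod D" "N \<noteq> {\<one>\<^bsub>G Mod D\<^esub>}"
    let ?B = "f.preim N"
    have B: "?B \<lhd> G" using f.preim_normal[OF N(1)] .
    have im: "(\<lambda>x. D #> x) ` ?B = N" using f.image_preim[OF f.H.normal_subset[OF N(1)]] .
    have "D \<subseteq> ?B" using f.kernel_subset_preim[OF normal_imp_subgroup[OF N(1)]] ker by simp
    moreover have "?B \<noteq> D"
    proof
      assume "?B = D"
      then have "(\<lambda>x. D #> x) ` D = N" using im by simp
      moreover have "(\<lambda>x. D #> x) ` D \<subseteq> {D}" using rcos_eq_self_iff[OF Ds] normal_subset[OF less(2)] by auto
      ultimately show False using N subgroup.one_closed[OF normal_imp_subgroup[OF N(1)]] by auto
    qed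
    ultimately have "card D < card ?B" using fin_subgroup[OF normal_imp_subgroup[OF B]] by (simp add: psubset_card_mono psubset_eq)
    moreover have "card ?B \<le> card (carrier G)" using fin normal_subset[OF B] by (simp add: card_mono)
    ultimately have "card (carrier G) - card ?B < card (carrier G) - card D" by linarith
    then have "cyc_chain ?B (carrier G)" using less(1) B by blast
    from f.cyc_chain_image[OF this] show "f.H.cyc_chain N (carrier (G Mod D))" unfolding im f.surj .
  qed
qed

end

section \<open>Supersolubility and the hypercentre\<close>

context group
begin

lemma cyclic_group_factor_iff:
  assumes A: "A \<lhd> G" and B: "B \<lhd> G" and AB: "A \<subseteq> B"
  shows "cyclic_group ((sub B) Mod A) \<longleftrightarrow> cyc A B"
proof -
  note Bs = normal_imp_subgroup[OF B]
  note Bc = normal_subset[OF B]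
  have AB': "A \<lhd> (sub B)" using normal_restrict_supergroup[OF Bs A AB] .
  interpret A: normal A "sub B" by (rule AB')
  interpret Q: group "(sub B) Mod A" by (rule A.factorgroup_is_group)
  have car: "carrier ((sub B) Mod A) = (\<lambda>x. A #> x) ` B" by (simp add: carrier_FactGroup)
  have pw: "(A #> b) [^]\<^bsub>(sub B) Mod A\<^esub> (i::int) = A #> (b [^] i)" if "b \<in> B" for b i
    using A.FactGroup_int_pow[of b i] that int_pow_consistent[OF Bs that, of i] by simp
  have bi: "b [^] (i::int) \<in> B" if "b \<in> B" for b i using subgroup_int_pow_closed[OF Bs that] .
  have "(carrier ((sub B) Mod A) = range (\<lambda>i::int. (A #> b) [^]\<^bsub>(sub B) Mod A\<^esub> i))
      \<longleftrightarrow> B \<subseteq> A <#> generate G {b}" if b: "b \<in> B" for b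
  proof -
    have bc: "b \<in> carrier G" using b Bc by blast
    have "range (\<lambda>i::int. A #> (b [^] i)) \<subseteq> (\<lambda>x. A #> x) ` B" using bi[OF b] by blast
    then have "(\<lambda>x. A #> x) ` B = range (\<lambda>i::int. A #> (b [^] i)) \<longleftrightarrow> (\<lambda>x. A #> x) ` B \<subseteq> range (\<lambda>i::int. A #> (b [^] i))"
      by (simp add: set_eq_subset)
    also have "\<dots> \<longleftrightarrow> (\<forall>x\<in>B. \<exists>i::int. A #> x = A #> (b [^] i))"
      by (simp add: image_subset_iff image_iff)
    also have "\<dots> \<longleftrightarrow> (\<forall>x\<in>B. x \<in> A <#> generate G {b})"
      using mem_cyc_gen_iff[OF A bc] Bc by blast
    finally show ?thesis unfolding car pw[OF b] by blast
  qed
  then show ?thesis unfolding Q.cyclic_group cyc_def car by simp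
qed

lemma supersoluble_iff_cyc_chain: "supersoluble G \<longleftrightarrow> cyc_chain {\<one>} (carrier G)"
proof
  assume "supersoluble G"
  then obtain Ns where Ns: "Ns \<noteq> []" "hd Ns = {\<one>}" "last Ns = carrier G" "\<And>i. i < length Ns \<Longrightarrow> Ns ! i \<lhd> G"
    "\<And>i. Suc i < length Ns \<Longrightarrow> Ns ! i \<subseteq> Ns ! Suc i \<and> cyclic_group ((sub (Ns ! Suc i)) Mod (Ns ! i))"
    unfolding supersoluble_def by blast
  let ?l = "length Ns - 1"
  have l: "?l < length Ns" using Ns(1) by simp
  \<comment> \<open>The induction descends from the last entry, because chains grow at the lower
    end.\<close>
  have "cyc_chain (Ns ! i) (Ns ! ?l)" if "i \<le> ?l" for i
    using that
  proof (induction i rule: inc_induct)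
    case base
    show ?case using Ns(4)[OF l] by (rule cyc_chain_refl)
  next
    case (step n)
    then have n: "Suc n < length Ns" using l by simp
    have 1: "Ns ! n \<lhd> G" "Ns ! Suc n \<lhd> G" using Ns(4) n by simp_all
    have "cyc (Ns ! n) (Ns ! Suc n)" using cyclic_group_factor_iff[OF 1] Ns(5)[OF n] by blast
    then show ?case using cyc_chain_step[OF 1 _ _ step(3)] Ns(5)[OF n] by blast
  qed
  from this[of 0] show "cyc_chain {\<one>} (carrier G)" using Ns(1-3) by (simp add: hd_conv_nth last_conv_nth)
next
  have "\<exists>Ns. Ns \<noteq> [] \<and> hd Ns = A \<and> last Ns = C \<and> (\<forall>i < length Ns. Ns ! i \<lhd> G) \<and>
    (\<forall>i. Suc i < length Ns \<longrightarrow> Ns ! i \<subseteq> Ns ! Suc i \<and> cyclic_group ((sub (Ns ! Suc i)) Mod (Ns ! i)))"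
    if "cyc_chain A C" for A C
    using that
  proof (induction rule: cyc_chain.induct)
    case (cyc_chain_refl A)
    then show ?case by (intro exI[of _ "[A]"]) simp
  next
    case (cyc_chain_step A B C)
    then obtain Ns where Ns: "Ns \<noteq> []" "hd Ns = B" "last Ns = C" "\<forall>i < length Ns. Ns ! i \<lhd> G"
      "\<forall>i. Suc i < length Ns \<longrightarrow> Ns ! i \<subseteq> Ns ! Suc i \<and> cyclic_group ((sub (Ns ! Suc i)) Mod (Ns ! i))"
      by blast
    have cy: "cyclic_group ((sub B) Mod A)" using cyclic_group_factor_iff cyc_chain_step by blast
    have N0: "Ns ! 0 = B" using Ns(1,2) by (simp add: hd_conv_nth)
    have "(A # Ns) ! i \<lhd> G" if "i < length (A # Ns)" for i
      using that Ns(4) cyc_chain_step(1) by (cases i) auto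
    moreover have "(A # Ns) ! i \<subseteq> (A # Ns) ! Suc i \<and> cyclic_group ((sub ((A # Ns) ! Suc i)) Mod ((A # Ns) ! i))"
      if "Suc i < length (A # Ns)" for i
      using that Ns(5) cyc_chain_step(3) cy N0 by (cases i) auto
    ultimately show ?case using Ns(1,3) by (intro exI[of _ "A # Ns"]) simp
  qed
  moreover assume "cyc_chain {\<one>} (carrier G)"
  ultimately show "supersoluble G" unfolding supersoluble_def using is_group by blast
qed

text \<open>The two commutators h^-1 g^-1 h g and h g h^-1 g^-1 are conjugate by gh, so both or
  neither lie in the normal subgroup \<open>K\<close>.\<close>

lemma cent_mod_eq_centralizer_factor:
  assumes H: "subgroup H G" and K: "K \<lhd> G"
  shows "centralizer_factor G H K = cent_mod (carrier G) H K"
proof -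
  note Hc = subgroup.subset[OF H]
  have "(inv h \<otimes> inv g \<otimes> h \<otimes> g \<in> K) \<longleftrightarrow> cm h g \<in> K" if "h \<in> H" "g \<in> carrier G" for h g
  proof -
    have hc: "h \<in> carrier G" using that Hc by blast
    have e1: "cj (g \<otimes> h) (inv h \<otimes> inv g \<otimes> h \<otimes> g) = cm h g"
      and e2: "cj (inv (g \<otimes> h)) (cm h g) = inv h \<otimes> inv g \<otimes> h \<otimes> g"
      using hc that(2) by (simp_all add: conj_simps)
    show ?thesis
      using normalD[OF K, of _ "g \<otimes> h"] normalD[OF K, of _ "inv (g \<otimes> h)"] e1 e2 hc that(2)
      by (metis inv_closed m_closed)
  qed
  then show ?thesis unfolding centralizer_factor_def cent_mod_def by blast
qed

text \<open>A normal subgroup of the semidirect product that meets the factor \<open>H/K\<close> nontrivially induces a normal subgroup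
  of \<open>G\<close> between \<open>K\<close> and \<open>H\<close>, hence contains \<open>H/K\<close>.\<close>

lemma U_central_imp_cyc:
  assumes cf: "chief_factor G H K" and U: "U_central G H K"
  shows "cyc K H"
proof -
  have H: "H \<lhd> G" and K: "K \<lhd> G" "K \<subseteq> H" "K \<noteq> H"
    and chief: "\<And>M. M \<lhd> G \<Longrightarrow> K \<subseteq> M \<Longrightarrow> M \<subseteq> H \<Longrightarrow> M = K \<or> M = H"
    using cf by (auto simp: chief_factor_def)
  have Hs: "subgroup H G" and Ks: "subgroup K G" using H K(1) by (simp_all add: normal_imp_subgroup)
  have Hc: "H \<subseteq> carrier G" and Kc: "K \<subseteq> carrier G" using Hs Ks by (simp_all add: subgroup.subset)
  define C where "C = cent_mod (carrier G) H K"
  have Cn: "C \<lhd> G" unfolding C_def using cent_mod_normal[OF normal_self H K(1)] .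
  note Cs = normal_imp_subgroup[OF Cn]
  note Cc = subgroup.subset[OF Cs]
  let ?X = "chief_semidirect G H K"
  have X: "carrier ?X = {K #> h | h. h \<in> H} \<times> rcosets C"
    "\<And>p q. p \<otimes>\<^bsub>?X\<^esub> q = (fst p <#> conj_act G (snd p) (fst q), snd p <#> snd q)"
    "\<one>\<^bsub>?X\<^esub> = (K, C)"
    by (simp_all add: chief_semidirect_def Let_def C_def cent_mod_eq_centralizer_factor[OF Hs K(1)])
  interpret X: group ?X using U by (simp add: U_central_def supersoluble_def)
  \<comment> \<open>Independence of representatives: an element of \<open>C\<close> changes the
    conjugate of h only by a commutator in \<open>K\<close>, so the set of all conjugates is a
    single coset.\<close>
  have act: "conj_act G (C #> g) (K #> h) = K #> cj g h" if g: "g \<in> carrier G" and h: "h \<in> H" for g h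
  proof
    have hc: "h \<in> carrier G" using h Hc by blast
    have h': "cj g h \<in> H" using normalD[OF H h g] .
    have hc': "cj g h \<in> carrier G" using h' Hc by blast
    show "conj_act G (C #> g) (K #> h) \<subseteq> K #> cj g h"
    proof
      fix x assume "x \<in> conj_act G (C #> g) (K #> h)"
      then obtain c k where ck: "c \<in> C" "k \<in> K" "x = cj (c \<otimes> g) (k \<otimes> h)"
        by (auto simp: conj_act_def r_coset_def)
      have cc: "c \<in> carrier G" "k \<in> carrier G" using ck Cc Kc by auto
      have "cm (cj g h) c \<in> K" using ck(1) h' by (simp add: C_def cent_mod_def)
      then have "cm c (cj g h) \<in> K" using cm_sym[OF hc' cc(1) Ks] by blast
      moreover have "cj (c \<otimes> g) k \<in> K" using normalD[OF K(1) ck(2), of "c \<otimes> g"] cc g by simp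
      ultimately have "cj (c \<otimes> g) k \<otimes> cm c (cj g h) \<in> K" using subgroup.m_closed[OF Ks] by blast
      moreover have "x = (cj (c \<otimes> g) k \<otimes> cm c (cj g h)) \<otimes> cj g h"
        using ck(3) cc g hc by (simp add: conj_simps)
      ultimately show "x \<in> K #> cj g h" by (auto simp: r_coset_def)
    qed
    show "K #> cj g h \<subseteq> conj_act G (C #> g) (K #> h)"
    proof
      fix x assume "x \<in> K #> cj g h"
      then obtain k where k: "k \<in> K" "x = k \<otimes> cj g h" by (auto simp: r_coset_def)
      have kc: "k \<in> carrier G" using k Kc by blast
      let ?k = "inv g \<otimes> k \<otimes> g"
      have "?k \<in> K" using normalD[OF K(1) k(1), of "inv g"] g by simp
      then have "?k \<otimes> h \<in> K #> h" by (auto simp: r_coset_def)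
      moreover have "g \<in> C #> g" using rcos_self[OF g Cs] .
      moreover have "x = cj g (?k \<otimes> h)" using k g kc hc by (simp add: conj_simps)
      ultimately show "x \<in> conj_act G (C #> g) (K #> h)" unfolding conj_act_def by force
    qed
  qed
  have C1: "C = C #> \<one>" and K1: "K = K #> \<one>" using Cc Kc by simp_all
  have oneH: "\<one> \<in> H" using subgroup.one_closed[OF Hs] .
  have CC: "C <#> C = C" using subgroup_mult_id[OF Cs] .
  have Kmult: "(K #> x) <#> (K #> y) = K #> (x \<otimes> y)" if "x \<in> carrier G" "y \<in> carrier G" for x y
    using normal.rcos_sum[OF K(1) that] .
  define f where "f h = (K #> h, C)" for h
  have actC: "conj_act G C (K #> h) = K #> h" if "h \<in> H" for h
    using act[OF one_closed that] that Hc Cc by (auto simp: subsetD)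
  have fX: "f h \<in> carrier ?X" if "h \<in> H" for h
    using that subgroup.subgroup_in_rcosets[OF Cs is_group] by (auto simp: X f_def)
  have fm: "f (h \<otimes> k) = f h \<otimes>\<^bsub>?X\<^esub> f k" if "h \<in> H" "k \<in> H" for h k
    using that Hc Kmult[of h k] actC[of k] CC by (auto simp: X f_def subsetD)
  interpret Hg: group "sub H" using Hs by (rule subgroup_imp_group)
  interpret f: group_hom "sub H" ?X f
    by (simp add: group_hom_def group_hom_axioms_def Hg.is_group X.is_group hom_def fX fm Pi_def)
  let ?P = "f ` H"
  have P: "subgroup ?P ?X" using f.subgroup_img_is_subgroup[OF Hg.subgroup_self] by simp
  have f_one: "f h = \<one>\<^bsub>?X\<^esub> \<longleftrightarrow> h \<in> K" if "h \<in> H" for h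
  proof -
    have hc: "h \<in> carrier G" using that Hc by blast
    show ?thesis using rcos_eq_self_iff[OF Ks hc] by (simp add: f_def X)
  qed
  obtain h0 where h0: "h0 \<in> H" "h0 \<notin> K" using K by blast
  have P1: "carrier ?X \<inter> ?P \<noteq> {\<one>\<^bsub>?X\<^esub>}" using h0 f_one fX by blast
  have cyc_chain: "X.cyc_chain {\<one>\<^bsub>?X\<^esub>} (carrier ?X)" using U X.supersoluble_iff_cyc_chain by (simp add: U_central_def)
  have P2: "{\<one>\<^bsub>?X\<^esub>} \<inter> ?P = {\<one>\<^bsub>?X\<^esub>}" using subgroup.one_closed[OF P] by blast
  from X.cyc_chain_jump[OF cyc_chain, of "\<lambda>Z. Z \<inter> ?P = {\<one>\<^bsub>?X\<^esub>}", OF P2 P1]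
  obtain A B where AB: "A \<lhd> ?X" "B \<lhd> ?X" "X.cyc A B" "A \<inter> ?P = {\<one>\<^bsub>?X\<^esub>}" "B \<inter> ?P \<noteq> {\<one>\<^bsub>?X\<^esub>}"
    by (elim exE conjE) (rule that)
  have Bs: "subgroup B ?X" using AB(2) by (rule normal_imp_subgroup)
  have cP: "X.cyc {\<one>\<^bsub>?X\<^esub>} (B \<inter> ?P)" using X.cyc_Int[OF AB(1) Bs AB(3) P] AB(4) by simp
  \<comment> \<open>Conjugation by g on H/K becomes conjugation by the element (K, Cg) of the
    semidirect product, so the preimage \<open>?W\<close> of the normal subgroup \<open>B\<close> is
    normal in \<open>G\<close>. It exceeds \<open>K\<close>, hence it is \<open>H\<close>, and all
    of H/K lies in \<open>B\<close>.\<close>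
  let ?W = "{h \<in> H. f h \<in> B}"
  have W: "?W \<lhd> G"
  proof (rule normal_invI)
    show "subgroup ?W G"
    proof (rule subgroupI)
      show "?W \<subseteq> carrier G" using Hc by blast
      have "\<one> \<in> ?W" using oneH f.hom_one subgroup.one_closed[OF Bs] by simp
      then show "?W \<noteq> {}" by blast
    next
      fix x assume x: "x \<in> ?W"
      then have "f (inv x) = inv\<^bsub>?X\<^esub> (f x)" using f.hom_inv[of x] m_inv_consistent[OF Hs] by simp
      then show "inv x \<in> ?W" using x subgroup.m_inv_closed[OF Bs] subgroup.m_inv_closed[OF Hs] by simp
    next
      fix x y assume "x \<in> ?W" "y \<in> ?W"
      then show "x \<otimes> y \<in> ?W" using fm subgroup.m_closed[OF Bs] subgroup.m_closed[OF Hs] by simp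
    qed
  next
    fix g h assume g: "g \<in> carrier G" and "h \<in> ?W"
    then have h: "h \<in> H" "f h \<in> B" by auto
    have hc: "h \<in> carrier G" using h Hc by blast
    have h': "cj g h \<in> H" using normalD[OF H h(1) g] .
    have hc': "cj g h \<in> carrier G" using h' Hc by blast
    let ?e = "(K, C #> g)"
    have e: "?e \<in> carrier ?X" using K1 oneH rcosetsI[OF Cc g] by (auto simp: X)
    have 1: "?e \<otimes>\<^bsub>?X\<^esub> f h = (K #> cj g h, C #> g)"
      using act[OF g h(1)] Kmult[OF one_closed hc'] K1 normal.rcos_sum[OF Cn g one_closed] C1 g hc'
      by (simp add: X f_def)
    have 2: "f (cj g h) \<otimes>\<^bsub>?X\<^esub> ?e = (K #> cj g h, C #> g)"
      using actC[OF oneH] Kmult[OF hc' one_closed] K1 normal.rcos_sum[OF Cn one_closed g] C1 g hc'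
      by (simp add: X f_def)
    have "f (cj g h) = ?e \<otimes>\<^bsub>?X\<^esub> f h \<otimes>\<^bsub>?X\<^esub> inv\<^bsub>?X\<^esub> ?e"
      using 1 2 X.inv_solve_right[OF fX[OF h'] X.m_closed[OF e fX[OF h(1)]] e] by simp
    then have "f (cj g h) \<in> B" using X.normalD[OF AB(2) h(2) e] by simp
    then show "cj g h \<in> ?W" using h' by blast
  qed
  have "K \<subseteq> ?W"
  proof
    fix k assume k: "k \<in> K"
    then have "k \<in> H" "f k = \<one>\<^bsub>?X\<^esub>" using K(2) f_one by blast+
    then show "k \<in> ?W" using subgroup.one_closed[OF Bs] by simp
  qed
  moreover have "?W \<noteq> K"
  proof
    assume WK: "?W = K"
    have "z = \<one>\<^bsub>?X\<^esub>" if "z \<in> B \<inter> ?P" for z using that WK f_one by blast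
    then show False using AB(5) subgroup.one_closed[OF Bs] subgroup.one_closed[OF P] by blast
  qed
  ultimately have "?W = H" using chief[OF W] by blast
  then have "B \<inter> ?P = ?P" by blast
  then have "X.cyc {\<one>\<^bsub>?X\<^esub>} ?P" using cP by simp
  then obtain b where b: "b \<in> ?P" "?P \<subseteq> {\<one>\<^bsub>?X\<^esub>} <#>\<^bsub>?X\<^esub> generate ?X {b}"
    unfolding X.cyc_def by (elim bexE) (rule that)
  then obtain h1 where h1: "h1 \<in> H" "b = f h1" by blast
  have h1c: "h1 \<in> carrier G" using h1 Hc by blast
  have "h \<in> K <#> generate G {h1}" if h: "h \<in> H" for h
  proof -
    have hc: "h \<in> carrier G" using h Hc by blast
    have "f h \<in> {\<one>\<^bsub>?X\<^esub>} <#>\<^bsub>?X\<^esub> generate ?X {b}" using b h by blast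
    then obtain u where u: "u \<in> generate ?X {b}" "f h = \<one>\<^bsub>?X\<^esub> \<otimes>\<^bsub>?X\<^esub> u" by (auto simp: X.set_mult_mem)
    obtain i :: int where i: "u = b [^]\<^bsub>?X\<^esub> i" using X.mem_generate_singleton[OF fX[OF h1(1)]] u(1) h1(2) by blast
    have "f h = b [^]\<^bsub>?X\<^esub> i" using u(2) i fX[OF h1(1)] h1(2) by simp
    also have "\<dots> = f (h1 [^] i)" using f.hom_int_pow[of h1 i] h1 int_pow_consistent[OF Hs h1(1), of i] by simp
    finally have "K #> h = K #> (h1 [^] i)" by (simp add: f_def)
    then show ?thesis using mem_cyc_gen_iff[OF K(1) h1c hc] by blast
  qed
  then show ?thesis unfolding cyc_def using h1(1) by blast
qed

end

context fin_group
begin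

text \<open>A normal subgroup \<open>B\<close> of \<open>G\<close> minimal among those properly
  above \<open>A\<close> and inside \<open>N\<close> makes B/A a chief factor; it is cyclic and
  becomes the lowest link.\<close>

lemma cyc_chain_if_chief_factors_U_central:
  assumes N: "N \<lhd> G" and U: "\<And>H K. chief_factor G H K \<Longrightarrow> H \<subseteq> N \<Longrightarrow> U_central G H K"
    and A: "A \<lhd> G" "A \<subseteq> N"
  shows "cyc_chain A N"
  using A
proof (induction "card N - card A" arbitrary: A rule: less_induct)
  case less
  show ?case
  proof (cases "A = N")
    case True
    then show ?thesis using cyc_chain_refl N by blast
  next
    case False
    let ?Pr = "\<lambda>B. B \<lhd> G \<and> A \<subset> B \<and> B \<subseteq> N"
    obtain B where B: "?Pr B" "\<And>K. ?Pr K \<Longrightarrow> K \<subseteq> B \<Longrightarrow> K = B"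
      using ex_minimal_set[of ?Pr N] N False less(3) normal_subset by (metis psubsetI subset_refl)
    have "chief_factor G B A"
      unfolding chief_factor_def
    proof (intro conjI allI impI)
      fix M assume M: "M \<lhd> G \<and> A \<subseteq> M \<and> M \<subseteq> B"
      show "M = A \<or> M = B"
      proof (cases "M = A")
        case False
        then have "?Pr M" using M B(1) by blast
        then show ?thesis using B(2) M by blast
      qed simp
    qed (use less(2) B(1) in auto)
    then have cyc: "cyc A B" using U B(1) U_central_imp_cyc by blast
    have Nf: "finite N" using fin_subgroup[OF normal_imp_subgroup[OF N]] .
    have "card A < card B" using B(1) Nf by (meson finite_subset psubset_card_mono)
    moreover have "card B \<le> card N" using B(1) Nf by (simp add: card_mono)
    ultimately have "cyc_chain B N" using less(1)[of B] B(1) by simp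
    then show ?thesis using cyc_chain_step[OF less(2) _ _ cyc] B(1) by blast
  qed
qed

text \<open>Take \<open>W\<close> maximal among the upper ends of chains from 1. For each
  \<open>N\<close> in the definition of the hypercentre, the chain of \<open>N\<close> multiplied by
  \<open>W\<close> leads from \<open>W\<close> to WN, so WN = W by maximality.\<close>

lemma U_hypercentre_subset_cyc_chain:
  obtains W where "cyc_chain {\<one>} W" "U_hypercentre G \<subseteq> W"
proof -
  obtain W where W: "cyc_chain {\<one>} W" and max: "\<And>V. cyc_chain {\<one>} V \<Longrightarrow> W \<subseteq> V \<Longrightarrow> V = W"
    using ex_maximal_set[of "cyc_chain {\<one>}" "{\<one>}"] cyc_chain_refl[OF one_is_normal] cyc_chain_normal normal_subset by metis
  have Wn: "W \<lhd> G" using cyc_chain_normal[OF W] by blast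
  note Ws = normal_imp_subgroup[OF Wn]
  have "N \<subseteq> W" if N: "N \<lhd> G" and U: "\<forall>H K. chief_factor G H K \<and> H \<subseteq> N \<longrightarrow> U_central G H K" for N
  proof -
    note Ns = normal_imp_subgroup[OF N]
    have "cyc_chain {\<one>} N"
      using cyc_chain_if_chief_factors_U_central[OF N _ one_is_normal] U subgroup.one_closed[OF Ns] by blast
    then have "cyc_chain (W <#> {\<one>}) (W <#> N)" using Wn by (rule cyc_chain_join)
    moreover have "W <#> {\<one>} = W" using subgroup.subset[OF Ws] by (force simp: set_mult_def)
    ultimately have "cyc_chain {\<one>} (W <#> N)" using cyc_chain_trans[OF W] by simp
    then have "W <#> N = W" using max set_mult_superset(1)[OF Ws Ns] by blast
    then show ?thesis using set_mult_superset(2)[OF Ws Ns] by blast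
  qed
  then have "U_hypercentre G \<subseteq> W"
    unfolding U_hypercentre_def by (intro generate_subgroup_incl[OF _ Ws] Union_least) blast
  then show thesis using that W by blast
qed

end

section \<open>Supplemented subgroups\<close>

lemma card_image_same_fibres:
  assumes "\<And>x y. x \<in> A \<Longrightarrow> y \<in> A \<Longrightarrow> f x = f y \<longleftrightarrow> g x = g y"
  shows "card (f ` A) = card (g ` A)"
proof -
  have "bij_betw (\<lambda>z. g (inv_into A f z)) (f ` A) (g ` A)"
  proof (rule bij_betw_imageI)
    have i: "inv_into A f (f x) \<in> A" "f (inv_into A f (f x)) = f x" if "x \<in> A" for x
      using that by (auto intro: inv_into_into f_inv_into_f)
    then have gi: "g (inv_into A f (f x)) = g x" if "x \<in> A" for x using assms that by blast
    show "inj_on (\<lambda>z. g (inv_into A f z)) (f ` A)"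
      by (rule inj_onI) (auto simp: gi assms)
    show "(\<lambda>z. g (inv_into A f z)) ` f ` A = g ` A" using gi by (force simp: image_image)
  qed
  then show ?thesis by (rule bij_betw_same_card)
qed

context surj_hom
begin

lemma image_maximal:
  assumes M: "maximal_subgroup G M" and ker: "kernel G H h \<subseteq> M"
  shows "maximal_subgroup H (h ` M)"
proof -
  have Ms: "subgroup M G" "M \<noteq> carrier G" using M by (auto simp: maximal_subgroup_def)
  have pM: "preim (h ` M) = M" using preim_image[OF Ms(1) ker] .
  have "h ` M \<noteq> carrier H" using pM Ms(2) hom_closed by auto
  moreover have "L = h ` M \<or> L = carrier H" if L: "subgroup L H" "h ` M \<subseteq> L" for L
  proof -
    have "M \<subseteq> preim L" using L(2) subgroup.subset[OF Ms(1)] by blast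
    then have "preim L = M \<or> preim L = carrier G"
      using M preim_subgroup[OF L(1)] by (auto simp: maximal_subgroup_def)
    moreover have "h ` preim L = L" using image_preim[OF subgroup.subset[OF L(1)]] .
    ultimately show ?thesis using surj by metis
  qed
  ultimately show ?thesis using subgroup_img_is_subgroup[OF Ms(1)] by (simp add: maximal_subgroup_def)
qed

lemma card_rcosets_preim:
  assumes N: "subgroup N H"
  shows "card (rcosets\<^bsub>G\<^esub> (preim N)) = card (rcosets\<^bsub>H\<^esub> N)"
proof -
  have "preim N #>\<^bsub>G\<^esub> x = preim N #>\<^bsub>G\<^esub> y \<longleftrightarrow> N #>\<^bsub>H\<^esub> h x = N #>\<^bsub>H\<^esub> h y"
    if "x \<in> carrier G" "y \<in> carrier G" for x y
    using that G.rcos_eq_iff[OF preim_subgroup[OF N] that] H.rcos_eq_iff[OF N, of "h x" "h y"] by simp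
  then have "card ((\<lambda>x. preim N #>\<^bsub>G\<^esub> x) ` carrier G) = card ((\<lambda>x. N #>\<^bsub>H\<^esub> h x) ` carrier G)"
    by (rule card_image_same_fibres)
  moreover have "(\<lambda>x. N #>\<^bsub>H\<^esub> h x) ` carrier G = rcosets\<^bsub>H\<^esub> N"
    unfolding RCOSETS_def surj[symmetric] by auto
  moreover have "(\<lambda>x. preim N #>\<^bsub>G\<^esub> x) ` carrier G = rcosets\<^bsub>G\<^esub> (preim N)"
    unfolding RCOSETS_def by auto
  ultimately show ?thesis by simp
qed

end

context fin_group
begin

text \<open>The index p^m of \<open>N\<close> divides |G:Y| |Y : Y \<inter> N| and is prime to
  |G:Y|, so \<open>Y\<close> already meets every coset of \<open>N\<close>.\<close>

lemma p_index_factorization: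
  assumes p: "Factorial_Ring.prime p" and Y: "subgroup Y G" "\<not> p dvd card (rcosets Y)"
    and N: "subgroup N G" "card (rcosets N) = p ^ m" and g: "g \<in> carrier G"
  obtains y n where "y \<in> Y" "n \<in> N" "g = y \<otimes> n"
proof -
  have YN: "subgroup (Y \<inter> N) G" using Y(1) N(1) by (rule subgroups_Inter_pair)
  note Yc = subgroup.subset[OF Y(1)]
  let ?R = "(\<lambda>y. N #> y) ` Y"
  have iff: "(Y \<inter> N) #> x = (Y \<inter> N) #> y \<longleftrightarrow> N #> x = N #> y" if "x \<in> Y" "y \<in> Y" for x y
  proof -
    have "x \<otimes> inv y \<in> Y" using subgroup.m_closed[OF Y(1) that(1) subgroup.m_inv_closed[OF Y(1) that(2)]] .
    then show ?thesis using rcos_eq_iff[OF YN, of x y] rcos_eq_iff[OF N(1), of x y] that Yc by auto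
  qed
  have "rcosets\<^bsub>sub Y\<^esub> (Y \<inter> N) = (\<lambda>y. (Y \<inter> N) #> y) ` Y" by (auto simp: RCOSETS_def)
  then have r: "card ?R * card (Y \<inter> N) = card Y"
    using card_rcosets_subgroup[OF YN Y(1)] card_image_same_fibres[of Y, OF iff] by simp
  obtain s where s: "card N = card (Y \<inter> N) * s" using card_subgroup_dvd[OF YN N(1)] by auto
  have "card (rcosets Y) * card Y = p ^ m * card N"
    using lagrange[OF Y(1)] lagrange[OF N(1)] N(2) by simp
  then have "card (Y \<inter> N) * (card (rcosets Y) * card ?R) = card (Y \<inter> N) * (p ^ m * s)"
    unfolding s r[symmetric] by (simp only: ac_simps)
  then have "card (rcosets Y) * card ?R = p ^ m * s" using card_subgroup_pos[OF YN] by simp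
  then have "p ^ m dvd card (rcosets Y) * card ?R" by simp
  moreover have "coprime (p ^ m) (card (rcosets Y))"
    using p Y(2) prime_imp_coprime_nat by (simp add: coprime_power_left_iff)
  ultimately have d: "p ^ m dvd card ?R" using coprime_dvd_mult_right_iff by blast
  have sub: "?R \<subseteq> rcosets N" using Yc by (auto simp: RCOSETS_def)
  have fR: "finite (rcosets N)" using fin by (simp add: RCOSETS_def)
  have "card ?R > 0" using fin_subgroup[OF Y(1)] subgroup.one_closed[OF Y(1)] by (auto simp: card_gt_0_iff)
  then have "card (rcosets N) \<le> card ?R" using d N(2) dvd_imp_le by simp
  then have "?R = rcosets N" using card_seteq[OF fR sub] by simp
  \<comment> \<open>Right cosets would write g as n times y; passing to the inverse of g puts the
    factors in the order y times n.\<close>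
  moreover have "N #> inv g \<in> rcosets N" using g by (auto simp: RCOSETS_def)
  ultimately obtain y where y: "y \<in> Y" "N #> inv g = N #> y" by auto
  have yc: "y \<in> carrier G" using y Yc by blast
  have n: "inv g \<otimes> inv y \<in> N" using rcos_eq_iff[OF N(1), of "inv g" y] y(2) yc g by simp
  have "g = inv y \<otimes> inv (inv g \<otimes> inv y)" using g yc by (simp add: conj_simps)
  then show thesis
    using that[of "inv y" "inv (inv g \<otimes> inv y)"] subgroup.m_inv_closed[OF Y(1) y(1)] subgroup.m_inv_closed[OF N(1) n] by blast
qed

text \<open>The functor is evaluated on groups of natural numbers, and regularity speaks of
  primitive groups. So \<open>S\<close> is carried to a copy \<open>K\<close> of \<open>G\<close>
  and then, by inductivity, to a copy \<open>L\<close> of the quotient by the core of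
  \<open>M\<close>, which is primitive and into which \<open>P\<close> embeds. The p-power index of
  the normaliser found there is pulled back to \<open>G\<close>, where it forces all conjugates of
  \<open>S\<close> into \<open>H\<close>.\<close>

lemma tau_subgroup_trivial:
  assumes \<tau>: "is_subgroup_functor \<tau>" "inductive_functor \<tau>" "Phi_regular \<tau>"
    and S: "tau_subgroup \<tau> G S" and p: "Factorial_Ring.prime p"
    and P: "minimal_normal G P" "card P = p ^ k" and M: "maximal_subgroup G M" "\<not> P \<subseteq> M"
    and Y: "subgroup Y G" "\<not> p dvd card (rcosets Y)"
    and H: "subgroup H G" "H \<subset> P" "normalizes Y H" and SH: "S \<subseteq> H"
  shows "S \<subseteq> {\<one>}"
proof -
  have Pn: "P \<lhd> G" "P \<noteq> {\<one>}" and Pmin: "\<And>R. R \<lhd> G \<Longrightarrow> R \<subseteq> P \<Longrightarrow> R = {\<one>} \<or> R = P"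
    using P(1) by (auto simp: minimal_normal_def)
  note Ps = normal_imp_subgroup[OF Pn(1)]
  note Pc = subgroup.subset[OF Ps]
  have Ms: "subgroup M G" using M(1) by (simp add: maximal_subgroup_def)
  note Mc = subgroup.subset[OF Ms]
  obtain K :: "nat monoid" and \<theta> where K: "group K" "\<theta> \<in> iso G K" "\<theta> ` S \<in> \<tau> K"
    using S by (auto simp: tau_subgroup_def)
  interpret K: group K by (rule K(1))
  interpret \<theta>: surj_hom G K \<theta>
    using K is_group by (auto simp: surj_hom_def surj_hom_axioms_def group_hom_def group_hom_axioms_def iso_def bij_betw_def)
  have inj: "inj_on \<theta> (carrier G)" using K(2) by (simp add: iso_def bij_betw_def)
  have Kf: "finite (carrier K)" using fin \<theta>.surj by (metis finite_imageI)
  let ?C = "core K (\<theta> ` M)"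
  have Mt: "subgroup (\<theta> ` M) K" using \<theta>.subgroup_img_is_subgroup[OF Ms] .
  have C: "?C \<lhd> K" using K.core_normal[OF Mt] .
  have Cs: "subgroup ?C K" using C by (rule normal_imp_subgroup)
  have "tau_subgroup \<tau> (K Mod ?C) ((\<lambda>s. ?C #>\<^bsub>K\<^esub> s) ` \<theta> ` S)"
    using \<tau>(2) K(1,3) Kf C unfolding inductive_functor_def by blast
  then obtain L :: "nat monoid" and \<psi> where L: "group L" "\<psi> \<in> iso (K Mod ?C) L"
    "\<psi> ` (\<lambda>s. ?C #>\<^bsub>K\<^esub> s) ` \<theta> ` S \<in> \<tau> L"
    unfolding tau_subgroup_def by blast
  interpret q: surj_hom K "K Mod ?C" "\<lambda>s. ?C #>\<^bsub>K\<^esub> s" using C by (rule K.rcos_surj_hom)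
  have \<psi>: "\<psi> \<in> hom (K Mod ?C) L" "inj_on \<psi> (carrier (K Mod ?C))" "\<psi> ` carrier (K Mod ?C) = carrier L"
    using L(2) by (auto simp: iso_def bij_betw_def)
  have "finite (carrier (K Mod ?C))" using Kf by (simp add: carrier_FactGroup)
  then have Lf: "finite (carrier L)" using \<psi>(3) by (metis finite_imageI)
  interpret L: fin_group L using Lf L(1) by (simp add: fin_group_def fin_group_axioms_def)
  interpret \<psi>: group_hom "K Mod ?C" L \<psi>
    using L(1) \<psi>(1) q.H.is_group by (simp add: group_hom_def group_hom_axioms_def)
  \<comment> \<open>The composite of the copy of \<open>G\<close>, the quotient map and the copy of
    the quotient; its kernel is the core of \<open>M\<close>.\<close>
  define f where "f x = \<psi> (?C #>\<^bsub>K\<^esub> \<theta> x)" for x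
  have fhom: "f \<in> hom G L"
    by (rule homI) (simp_all add: f_def \<theta>.hom_mult q.hom_mult del: mult_FactGroup)
  have fim: "f ` A = \<psi> ` (\<lambda>s. ?C #>\<^bsub>K\<^esub> s) ` \<theta> ` A" for A by (auto simp: f_def)
  interpret f: surj_hom G L f
    using fhom L(1) is_group \<theta>.surj q.surj \<psi>(3) fim[of "carrier G"]
    by (simp add: surj_hom_def surj_hom_axioms_def group_hom_def group_hom_axioms_def)
  have fS: "f ` S \<in> \<tau> L" using L(3) fim by simp
  have f1: "f x = \<one>\<^bsub>L\<^esub> \<longleftrightarrow> \<theta> x \<in> ?C" if "x \<in> carrier G" for x
  proof -
    have "f x = \<one>\<^bsub>L\<^esub> \<longleftrightarrow> ?C #>\<^bsub>K\<^esub> \<theta> x = \<one>\<^bsub>K Mod ?C\<^esub>"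
      unfolding f_def using \<psi>.hom_one inj_on_eq_iff[OF \<psi>(2), of "?C #>\<^bsub>K\<^esub> \<theta> x" "\<one>\<^bsub>K Mod ?C\<^esub>"] that
        q.hom_closed[of "\<theta> x"] q.H.one_closed by (metis \<theta>.hom_closed)
    then show ?thesis using K.rcos_eq_self_iff[OF Cs, of "\<theta> x"] that by simp
  qed
  have mem_M: "x \<in> M" if "x \<in> carrier G" "\<theta> x \<in> \<theta> ` M" for x
    using that inj Mc by (metis inj_on_image_mem_iff)
  have kerM: "kernel G L f \<subseteq> M"
  proof
    fix x assume "x \<in> kernel G L f"
    then have x: "x \<in> carrier G" "\<theta> x \<in> ?C" using f1 by (auto simp: kernel_def)
    then show "x \<in> M" using mem_M K.core_subset[OF subgroup.subset[OF Mt]] by blast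
  qed
  have kerP: "P \<inter> kernel G L f = {\<one>}"
    using minimal_normalD[OF P(1) f.normal_kernel] kerM M(2) by blast
  have injP: "inj_on f P"
  proof (rule inj_onI)
    fix x y assume xy: "x \<in> P" "y \<in> P" "f x = f y"
    then have c: "x \<in> carrier G" "y \<in> carrier G" using Pc by auto
    have "x \<otimes> inv y \<in> P" using subgroup.m_closed[OF Ps xy(1) subgroup.m_inv_closed[OF Ps xy(2)]] .
    moreover have "f (x \<otimes> inv y) = \<one>\<^bsub>L\<^esub>" using c xy(3) by simp
    ultimately have "x \<otimes> inv y \<in> P \<inter> kernel G L f" using c by (simp add: kernel_def)
    then have "x \<otimes> inv y = \<one>" unfolding kerP by simp
    then show "x = y" using c inv_equality[of x "inv y"] by simp
  qed
  have pM: "f.preim (f ` M) = M" using f.preim_image[OF Ms kerM] .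
  have maxL: "maximal_subgroup L (f ` M)" using f.image_maximal[OF M(1) kerM] .
  have "core L (f ` M) = {\<one>\<^bsub>L\<^esub>}"
  proof -
    have fMs: "subgroup (f ` M) L" using f.subgroup_img_is_subgroup[OF Ms] .
    have "z = \<one>\<^bsub>L\<^esub>" if z: "z \<in> core L (f ` M)" for z
    proof -
      obtain x where x: "x \<in> carrier G" "z = f x" using z f.surj by (auto simp: core_def)
      have "cj g x \<in> M" if g: "g \<in> carrier G" for g
      proof -
        have "L.cj (f g) (f x) \<in> f ` M"
          using z x g L.mem_core_iff[OF subgroup.subset[OF fMs], of z] by simp
        then have "cj g x \<in> f.preim (f ` M)" using g x by simp
        then show ?thesis using pM by simp
      qed
      then have "K.cj (\<theta> g) (\<theta> x) \<in> \<theta> ` M" if "g \<in> carrier G" for g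
        using that x by (metis \<theta>.hom_inv \<theta>.hom_mult image_eqI inv_closed m_closed)
      then have "\<forall>g\<in>carrier K. K.cj g (\<theta> x) \<in> \<theta> ` M" using \<theta>.surj by (metis imageE)
      then have "\<theta> x \<in> ?C" using K.mem_core_iff[OF subgroup.subset[OF Mt]] x by simp
      then show ?thesis using f1 x by simp
    qed
    then show ?thesis using subgroup.one_closed[OF normal_imp_subgroup[OF L.core_normal[OF fMs]]] by blast
  qed
  then have prim: "primitive_group L" using maxL by (auto simp: primitive_group_def)
  have minL: "minimal_normal L (f ` P)"
    unfolding minimal_normal_def
  proof (intro conjI allI impI)
    show "f ` P \<lhd> L" using f.image_normal[OF Pn(1)] .
    show "f ` P \<noteq> {\<one>\<^bsub>L\<^esub>}"
    proof
      assume "f ` P = {\<one>\<^bsub>L\<^esub>}"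
      then have "P \<subseteq> kernel G L f" using Pc by (auto simp: kernel_def)
      then show False using kerP Pn(2) by blast
    qed
    fix R assume R: "R \<lhd> L \<and> R \<subseteq> f ` P"
    have "P \<inter> f.preim R = {\<one>} \<or> P \<inter> f.preim R = P"
      using Pmin[OF normal_Int[OF Pn(1) f.preim_normal]] R by blast
    then show "R = {\<one>\<^bsub>L\<^esub>} \<or> R = f ` P"
    proof
      assume 1: "P \<inter> f.preim R = {\<one>}"
      have "z = \<one>\<^bsub>L\<^esub>" if z: "z \<in> R" for z
      proof -
        obtain x where "x \<in> P" "z = f x" using z R by blast
        then have "x \<in> P \<inter> f.preim R" using z Pc by blast
        then show ?thesis using 1 \<open>z = f x\<close> f.hom_one by simp
      qed
      moreover have "\<one>\<^bsub>L\<^esub> \<in> R" using R normal_imp_subgroup subgroup.one_closed by metis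
      ultimately show ?thesis by blast
    next
      assume "P \<inter> f.preim R = P"
      then show ?thesis using R by blast
    qed
  qed
  have SP: "S \<subseteq> P" using SH H(2) by blast
  have fSs: "subgroup (f ` S) L" using \<tau>(1) fS L(1) Lf unfolding is_subgroup_functor_def by blast
  have "card (f ` S) dvd card (f ` P)"
    by (rule L.card_subgroup_dvd[OF fSs f.subgroup_img_is_subgroup[OF Ps] image_mono[OF SP]])
  then have "card (f ` S) dvd p ^ k" using P(2) card_image[OF injP] by simp
  then obtain j where j: "card (f ` S) = p ^ j" using divides_primepow_nat[OF p] by blast
  let ?N = "normalizer L (f ` S)"
  have "f ` S \<inter> f ` P = f ` S" using SP by blast
  then obtain m where m: "card (rcosets\<^bsub>L\<^esub> ?N) = p ^ m"
    using \<tau>(3)[unfolded Phi_regular_def, rule_format, of L "f ` S" p j "f ` P"] L(1) Lf prim fS p j minL by auto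
  have Ns: "subgroup ?N L" using L.normalizer_subgroup[OF fSs] .
  let ?N1 = "f.preim ?N"
  have N1: "subgroup ?N1 G" "card (rcosets ?N1) = p ^ m"
    using f.preim_subgroup[OF Ns] f.card_rcosets_preim[OF Ns] m by simp_all
  \<comment> \<open>With g = yn, conjugation by n preserves \<open>S\<close>: it does so after
    \<open>f\<close>, and \<open>f\<close> is injective on \<open>P\<close>. Conjugation by y then
    keeps the result in \<open>H\<close>.\<close>
  have conj: "cj g s \<in> H" if g: "g \<in> carrier G" and s: "s \<in> S" for g s
  proof -
    obtain y n where yn: "y \<in> Y" "n \<in> ?N1" "g = y \<otimes> n"
      using p_index_factorization[OF p Y N1 g] by blast
    have c: "y \<in> carrier G" "n \<in> carrier G" "s \<in> carrier G"
      using yn subgroup.mem_carrier[OF Y(1)] s SP Pc by auto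
    have "L.cj (f n) (f s) \<in> f ` S" using L.normalizer_iff[OF fSs] yn(2) s by blast
    then obtain s' where s': "s' \<in> S" "f (cj n s) = f s'" using c by auto
    have "cj n s \<in> P" using normalD[OF Pn(1) _ c(2)] s SP by blast
    then have "cj n s = s'" using inj_onD[OF injP s'(2)] s' SP by blast
    then have "cj y (cj n s) \<in> H" using normalizesD[OF H(3) yn(1)] s'(1) SH by auto
    then show ?thesis using cj_cj[OF c] yn(3) by simp
  qed
  note Hc = subgroup.subset[OF H(1)]
  have "core G H \<noteq> P" "core G H \<subseteq> P" using core_subset[OF Hc] H(2) by blast+
  then have "core G H = {\<one>}" using Pmin[OF core_normal[OF H(1)]] by blast
  moreover have "S \<subseteq> core G H" using conj SH Hc mem_core_iff[OF Hc] by blast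
  ultimately show ?thesis by simp
qed

text \<open>P \<inter> T is normal because \<open>P\<close> is abelian and G = HT. It is not 1,
  since otherwise P = H(P \<inter> T) = H; so \<open>P\<close> lies in \<open>T\<close> and T = G.
  As \<open>S\<close> is trivial, \<open>H\<close> lies in the hypercentre, hence in the upper end
  \<open>W\<close> of a chain from 1, and \<open>P\<close>, which meets \<open>W\<close>
  nontrivially, is cyclic.\<close>

lemma cyc_if_U_supplemented:
  assumes S: "S \<subseteq> {\<one>}" and cond: "U_supplement_cond G S H"
    and P: "minimal_normal G P" and ab: "\<And>x y. x \<in> P \<Longrightarrow> y \<in> P \<Longrightarrow> cm x y = \<one>"
    and H: "subgroup H G" "H \<subset> P" "H \<noteq> {\<one>}"
  shows "cyc {\<one>} P"
proof -
  have Pn: "P \<lhd> G" and Pmin: "\<And>R. R \<lhd> G \<Longrightarrow> R \<subseteq> P \<Longrightarrow> R = {\<one>} \<or> R = P"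
    using P by (auto simp: minimal_normal_def)
  note Ps = normal_imp_subgroup[OF Pn]
  note Pc = subgroup.subset[OF Ps]
  obtain T where T: "subgroup T G" "H <#> T = carrier G" "H \<inter> T \<subseteq> S <#> U_hypercentre (sub T)"
    using cond by (auto simp: U_supplement_cond_def)
  note Tc = subgroup.subset[OF T(1)]
  have PT: "P \<inter> T \<lhd> G"
    by (rule maximal_Int_normal[OF T(1,2) Pn]) (use H(2) ab subgroup.one_closed[OF T(1)] in auto)
  have "P \<inter> T \<noteq> {\<one>}"
  proof
    assume 1: "P \<inter> T = {\<one>}"
    obtain x where x: "x \<in> P" "x \<notin> H" using H(2) by blast
    then obtain h t where ht: "h \<in> H" "t \<in> T" "x = h \<otimes> t" using T(2) Pc set_mult_mem by blast
    have c: "h \<in> carrier G" "t \<in> carrier G" using ht H(2) Pc Tc by auto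
    have "t = inv h \<otimes> x" using ht c by simp
    then have "t \<in> P" using subgroup.m_closed[OF Ps subgroup.m_inv_closed[OF Ps]] x(1) ht(1) H(2) by blast
    then have "t = \<one>" using 1 ht(2) by blast
    then show False using ht x c by simp
  qed
  then have "P \<subseteq> T" using Pmin[OF PT] by blast
  then have HT: "H \<subseteq> T" using H(2) by blast
  have "carrier G \<subseteq> T" using mono_set_mult[OF HT subset_refl, of G T] T(2) subgroup_mult_id[OF T(1)] by simp
  then have Teq: "T = carrier G" using Tc by blast
  have "H \<subseteq> S <#> U_hypercentre G" using T(3) HT Teq by (simp add: Int_absorb2)
  obtain W where W: "cyc_chain {\<one>} W" "U_hypercentre G \<subseteq> W" using U_hypercentre_subset_cyc_chain .
  have Wn: "W \<lhd> G" using cyc_chain_normal[OF W(1)] by blast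
  have "H \<subseteq> W"
  proof
    fix x assume "x \<in> H"
    then obtain s u where "s \<in> S" "u \<in> U_hypercentre G" "x = s \<otimes> u"
      using \<open>H \<subseteq> S <#> U_hypercentre G\<close> set_mult_mem by blast
    then have "x = \<one> \<otimes> u" "u \<in> W" using S W(2) by blast+
    then show "x \<in> W" using normal_subset[OF Wn] by auto
  qed
  then have "H \<subseteq> P \<inter> W" using H(2) by blast
  then have "P \<inter> W \<noteq> {\<one>}" using H(3) subgroup.one_closed[OF H(1)] by blast
  then have "P \<subseteq> W" using minimal_normalD[OF P Wn] by blast
  moreover have "P \<inter> {\<one>} = {\<one>}" using subgroup.one_closed[OF Ps] by blast
  ultimately show ?thesis using minimal_normal_cyc[OF P W(1)] by blast
qed

theorem cyc_if_U_tau_supplemented: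
  assumes \<tau>: "is_subgroup_functor \<tau>" "inductive_functor \<tau>" "Phi_regular \<tau>"
    and p: "Factorial_Ring.prime p" and P: "P \<lhd> G" "card P = p ^ k"
    and M: "maximal_subgroup G M" "\<not> P \<subseteq> M"
    and supp: "\<And>H. maximal_subgroup (sub P) H \<Longrightarrow> U_tau_supplemented \<tau> G H"
  shows "P \<inter> M \<lhd> G \<and> cyc (P \<inter> M) P"
proof -
  let ?D = "P \<inter> M"
  note Ps = normal_imp_subgroup[OF P(1)]
  note Pc = subgroup.subset[OF Ps]
  have Ms: "subgroup M G" using M(1) by (simp add: maximal_subgroup_def)
  have "nilp_over_maximal P"
    using nilpotent_imp_nilp_over_maximal[OF P(1) nilpotent_p_subgroup[OF p Ps P(2)]] .
  then obtain B where B: "B \<lhd> G" "B \<subseteq> P" "\<not> B \<subseteq> M" "\<forall>b\<in>B. \<forall>k\<in>P. cm b k \<in> M"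
    using M unfolding nilp_over_maximal_def by blast
  have D: "?D \<lhd> G" using maximal_Int_normal[OF Ms maximal_mult[OF M(1) B(1,3)] P(1) B(2)] B(4) by blast
  note Ds = normal_imp_subgroup[OF D]
  have DP: "?D \<subset> P" using M(2) by blast
  have chief: "R = ?D \<or> R = P" if R: "R \<lhd> G" "?D \<subseteq> R" "R \<subseteq> P" for R
  proof (cases "R \<subseteq> M")
    case False
    note Rs = normal_imp_subgroup[OF R(1)]
    have "x \<in> R" if x: "x \<in> P" for x
    proof -
      obtain r m where rm: "r \<in> R" "m \<in> M" "x = r \<otimes> m"
        using maximal_mult[OF M(1) R(1) False] x Pc set_mult_mem by blast
      have c: "r \<in> carrier G" "m \<in> carrier G" using subgroup.mem_carrier[OF Rs rm(1)] subgroup.mem_carrier[OF Ms rm(2)] .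
      have "m = inv r \<otimes> x" using rm c by simp
      then have "m \<in> P" using subgroup.m_closed[OF Ps subgroup.m_inv_closed[OF Ps] x] rm(1) R(3) by blast
      then have "m \<in> R" using rm(2) R(2) by blast
      then show ?thesis using rm subgroup.m_closed[OF Rs] by blast
    qed
    then show ?thesis using R(3) by blast
  qed (use R in blast)
  have nP: "normalizes P ?D" "normalizes P P"
    using normal_imp_normalizes[OF D Pc] normal_imp_normalizes[OF P(1) Pc] .
  \<comment> \<open>P/D has a nontrivial centre, whose preimage is normal in \<open>G\<close>; as
    P/D is a chief factor, it is abelian.\<close>
  have ab: "cm x y \<in> ?D" if "x \<in> P" "y \<in> P" for x y
  proof -
    let ?Z = "cent_mod P P ?D"
    obtain x0 where x0: "x0 \<in> P - ?D" "\<forall>y\<in>P. cm x0 y \<in> ?D"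
      using p_group_central_step[OF p Ps P(2) Ds nP(1) Ps nP(2) DP subset_refl] by blast
    have "x0 \<in> ?Z" using x0 cm_sym[OF _ _ Ds, of x0] Pc by (auto simp: cent_mod_def)
    moreover have "?D \<subseteq> ?Z" using cm_in_normal(2)[OF Ds nP(1) _ _ Pc] by (auto simp: cent_mod_def)
    moreover have "?Z \<subseteq> P" by (auto simp: cent_mod_def)
    ultimately have "?Z = P" using chief[OF cent_mod_normal[OF P(1) P(1) D]] x0(1) by blast
    then have "y \<in> ?Z" using that(2) by simp
    then show ?thesis using that(1) by (simp add: cent_mod_def)
  qed
  obtain Y where Y: "sylow_subgroup G p Y" using ex_sylow[OF p] by blast
  then have Ys: "subgroup Y G" and Yk: "card Y = p ^ multiplicity p (card (carrier G))"
    by (auto simp: sylow_subgroup_def)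
  note Yc = subgroup.subset[OF Ys]
  have PY: "P \<subseteq> Y" using normal_p_subgroup_in_sylow[OF Y P] .
  \<comment> \<open>\<open>V\<close> contains [P, Y], so the maximal subgroup \<open>H\<close>
    chosen above \<open>V\<close> is normalised by \<open>Y\<close>.\<close>
  obtain V where V: "subgroup V G" "?D \<subseteq> V" "V \<subset> P" "\<And>x y. x \<in> P \<Longrightarrow> y \<in> Y \<Longrightarrow> cm x y \<in> V"
    using p_group_descent[OF p Ys Yk Ds normal_imp_normalizes[OF D Yc] Ps normal_imp_normalizes[OF P(1) Yc] DP PY] by metis
  interpret Pg: fin_group "sub P" using Ps by (rule fin_group_subgroup)
  have "subgroup V (sub P)" using subgroup_incl[OF V(1) Ps] V(3) by blast
  then obtain H where Hm: "maximal_subgroup (sub P) H" and VH: "V \<subseteq> H"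
    using Pg.ex_maximal_subgroup[of V] V(3) by auto
  have H: "subgroup H G" "H \<subset> P"
    using Hm incl_subgroup[OF Ps, of H] subgroup.subset[of H "sub P"] by (auto simp: maximal_subgroup_def)
  note Hc = subgroup.subset[OF H(1)]
  have nH: "normalizes Y H" unfolding normalizes_def
  proof (intro ballI)
    fix y h assume y: "y \<in> Y" and h: "h \<in> H"
    have c: "y \<in> carrier G" "h \<in> carrier G" using y h Yc Hc by auto
    have "cm h y \<in> V" using V(4)[of h y] y h H(2) by blast
    then have "cm y h \<in> H" using cm_sym[OF c(2,1) V(1)] VH by blast
    then have "cm y h \<otimes> h \<in> H" using subgroup.m_closed[OF H(1)] h by blast
    then show "cj y h \<in> H" using c by (simp add: m_assoc)
  qed
  have DH: "?D \<subseteq> H" using V(2) VH by blast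
  have "core G H = ?D"
  proof -
    have "core G H \<subseteq> H" using core_subset[OF Hc] .
    then show ?thesis using chief[OF core_normal[OF H(1)] normal_subset_core[OF D DH Hc]] H(2) by blast
  qed
  let ?Q = "G Mod ?D" let ?\<pi> = "\<lambda>x. ?D #> x"
  interpret q: surj_hom G ?Q ?\<pi> using D by (rule rcos_surj_hom)
  interpret Q: fin_group ?Q
    by (simp add: fin_group_def fin_group_axioms_def q.H.is_group carrier_FactGroup fin)
  have ker: "kernel G ?Q ?\<pi> = ?D"
    using rcos_eq_self_iff[OF Ds] normal_subset[OF D] by (auto simp: kernel_def)
  obtain S where S: "tau_subgroup \<tau> ?Q S" "S \<subseteq> ?\<pi> ` H" "U_supplement_cond ?Q S (?\<pi> ` H)"
    using supp[OF Hm] \<open>core G H = ?D\<close> by (auto simp: U_tau_supplemented_def Let_def)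
  have pre: "q.preim (?\<pi> ` J) = J" if "subgroup J G" "?D \<subseteq> J" for J
    using q.preim_image[OF that(1)] that(2) ker by simp
  have pre1: "q.preim {\<one>\<^bsub>?Q\<^esub>} = ?D" using ker by (auto simp: kernel_def)
  have "?\<pi> ` q.preim {\<one>\<^bsub>?Q\<^esub>} = {\<one>\<^bsub>?Q\<^esub>}" using q.H.one_closed by (intro q.image_preim) blast
  then have imD: "?\<pi> ` ?D = {\<one>\<^bsub>?Q\<^esub>}" unfolding pre1 .
  have preP: "q.preim (?\<pi> ` P) = P" using pre[OF Ps] by blast
  show ?thesis
  \<comment> \<open>If \<open>?D\<close> is itself maximal in \<open>P\<close>, any element of
    \<open>P\<close> outside \<open>?D\<close> generates P/D; the argument with the hypercentre
    requires H/D to be nontrivial.\<close>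
  proof (cases "H = ?D")
    case True
    obtain x where x: "x \<in> P" "x \<notin> H" using H(2) by blast
    have xc: "x \<in> carrier G" using x Pc by blast
    let ?J = "?D <#> generate G {x}"
    have J: "subgroup ?J G" using cyc_gen_subgroup[OF D xc] .
    have DJ: "?D \<subseteq> ?J" and xJ: "x \<in> ?J"
      using set_mult_superset[OF Ds generate_singleton_subgroup[OF xc]] by (auto intro: generate.incl)
    have "generate G {x} \<subseteq> P" using x(1) by (intro generate_subgroup_incl[OF _ Ps]) simp
    then have "?J \<subseteq> P <#> P" by (intro mono_set_mult) auto
    then have JP: "?J \<subseteq> P" using subgroup_mult_id[OF Ps] by simp
    have "subgroup ?J (sub P)" using subgroup_incl[OF J Ps JP] .
    then have "?J = P" using Hm DJ xJ x(2) True unfolding maximal_subgroup_def by auto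
    then show ?thesis using D x(1) unfolding cyc_def by blast
  next
    case False
    have Pmin: "minimal_normal ?Q (?\<pi> ` P)"
      unfolding minimal_normal_def
    proof (intro conjI allI impI)
      show "?\<pi> ` P \<lhd> ?Q" using q.image_normal[OF P(1)] .
      show "?\<pi> ` P \<noteq> {\<one>\<^bsub>?Q\<^esub>}" using preP pre1 DP by auto
      fix R assume R: "R \<lhd> ?Q \<and> R \<subseteq> ?\<pi> ` P"
      have "q.preim R \<subseteq> P" using R preP by blast
      moreover have "?D \<subseteq> q.preim R" using q.kernel_subset_preim[of R] ker R normal_imp_subgroup by metis
      ultimately have "q.preim R = ?D \<or> q.preim R = P" using chief[OF q.preim_normal] R by blast
      moreover have "?\<pi> ` q.preim R = R" using q.image_preim[of R] R q.H.normal_subset by blast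
      ultimately show "R = {\<one>\<^bsub>?Q\<^esub>} \<or> R = ?\<pi> ` P" using imD by auto
    qed
    have "rcosets\<^bsub>sub P\<^esub> ?D = ?\<pi> ` P" by (auto simp: RCOSETS_def)
    then have "card (?\<pi> ` P) dvd p ^ k"
      using card_rcosets_subgroup[OF Ds Ps] P(2) by (metis Int_lower1 dvd_triv_left)
    then obtain j where j: "card (?\<pi> ` P) = p ^ j" using divides_primepow_nat[OF p] by blast
    have maxQ: "maximal_subgroup ?Q (?\<pi> ` M)" using q.image_maximal[OF M(1)] ker by simp
    have notM: "\<not> ?\<pi> ` P \<subseteq> ?\<pi> ` M" 
    proof
      assume "?\<pi> ` P \<subseteq> ?\<pi> ` M"
      then have "q.preim (?\<pi> ` P) \<subseteq> q.preim (?\<pi> ` M)" by blast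
      moreover have "q.preim (?\<pi> ` M) = M" by (rule pre[OF Ms]) blast
      ultimately show False using M(2) unfolding preP by simp
    qed
    have YQ: "subgroup (?\<pi> ` Y) ?Q" using q.subgroup_img_is_subgroup[OF Ys] .
    have "?D \<subseteq> Y" using PY by blast
    then have iY: "\<not> p dvd card (rcosets\<^bsub>?Q\<^esub> (?\<pi> ` Y))"
      using q.card_rcosets_preim[OF YQ] pre[OF Ys] sylow_index[OF Y] by simp
    have HQ: "subgroup (?\<pi> ` H) ?Q" using q.subgroup_img_is_subgroup[OF H(1)] .
    have preH: "q.preim (?\<pi> ` H) = H" using pre[OF H(1) DH] .
    have HPQ: "?\<pi> ` H \<subset> ?\<pi> ` P"
    proof
      show "?\<pi> ` H \<subseteq> ?\<pi> ` P" using H(2) by blast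
      show "?\<pi> ` H \<noteq> ?\<pi> ` P" using H(2) preH preP by auto
    qed
    have nHQ: "q.H.normalizes (?\<pi> ` Y) (?\<pi> ` H)"
      unfolding q.H.normalizes_def
    proof (intro ballI)
      fix u v assume "u \<in> ?\<pi> ` Y" "v \<in> ?\<pi> ` H"
      then obtain y h where yh: "y \<in> Y" "h \<in> H" "u = ?\<pi> y" "v = ?\<pi> h" by blast
      have c: "y \<in> carrier G" "h \<in> carrier G" using yh Yc Hc by auto
      have "?\<pi> (cj y h) = q.H.cj u v" using c yh(3,4) by (simp add: q.hom_mult del: mult_FactGroup)
      then show "q.H.cj u v \<in> ?\<pi> ` H" using normalizesD[OF nH yh(1,2)] by (metis image_eqI)
    qed
    have S1: "S \<subseteq> {\<one>\<^bsub>?Q\<^esub>}"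
      by (rule Q.tau_subgroup_trivial[OF \<tau> S(1) p Pmin j maxQ notM YQ iY HQ HPQ nHQ S(2)])
    have abQ: "q.H.cm u v = \<one>\<^bsub>?Q\<^esub>" if uv: "u \<in> ?\<pi> ` P" "v \<in> ?\<pi> ` P" for u v
    proof -
      obtain x y where xy: "x \<in> P" "y \<in> P" "u = ?\<pi> x" "v = ?\<pi> y" using uv by blast
      have c: "x \<in> carrier G" "y \<in> carrier G" using xy Pc by auto
      have "?\<pi> (cm x y) = q.H.cm u v" using c xy(3,4) by (simp add: q.hom_mult del: mult_FactGroup)
      moreover have "?\<pi> (cm x y) \<in> ?\<pi> ` ?D" using ab[OF xy(1,2)] by blast
      ultimately show ?thesis using imD by simp
    qed
    have H1: "?\<pi> ` H \<noteq> {\<one>\<^bsub>?Q\<^esub>}" using preH pre1 False by auto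
    have "q.H.cyc {\<one>\<^bsub>?Q\<^esub>} (?\<pi> ` P)"
      by (rule Q.cyc_if_U_supplemented[OF S1 S(3) Pmin abQ HQ HPQ H1])
    then have "cyc (q.preim {\<one>\<^bsub>?Q\<^esub>}) (q.preim (?\<pi> ` P))"
      using q.cyc_preim[OF q.H.one_is_normal q.image_normal[OF P(1)]] by blast
    then show ?thesis using D pre1 preP by simp
  qed
qed

end

section \<open>The supersolubility criterion\<close>

context fin_group
begin

text \<open>Conjugation by g in \<open>G\<close> permutes the normal p-subgroups of
  \<open>E\<close>, which generate its Fitting subgroup. Accordingly the Fitting subgroup coincides
  with its core in \<open>G\<close>.\<close>

lemma fitting_of_normal:
  assumes E: "E \<lhd> G"
  shows "fitting (sub E) \<lhd> G" "fitting (sub E) \<subseteq> E"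
proof -
  let ?F = "fitting (sub E)"
  note Es = normal_imp_subgroup[OF E]
  note Ec = subgroup.subset[OF Es]
  interpret E: fin_group "sub E" using Es by (rule fin_group_subgroup)
  have F: "?F \<lhd> (sub E)" by (rule E.fitting_normal)
  show FE: "?F \<subseteq> E" using E.normal_subset[OF F] by simp
  have Fs: "subgroup ?F G" using incl_subgroup[OF Es normal_imp_subgroup[OF F]] .
  have Fc: "?F \<subseteq> carrier G" using FE Ec by blast
  have inv: "inv\<^bsub>sub E\<^esub> x = inv x" if "x \<in> E" for x using m_inv_consistent[OF Es that] .
  have hom: "group_hom G G (cj g)" if "g \<in> carrier G" for g
    unfolding group_hom_def group_hom_axioms_def using that by (auto intro!: homI simp: is_group cj_mult)
  let ?S = "core G ?F"
  have core: "subgroup ?S (sub E)"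
    using subgroup_incl[OF normal_imp_subgroup[OF core_normal[OF Fs]] Es] core_subset[OF Fc] FE by blast
  have "?F \<subseteq> ?S"
  proof (rule E.fitting_subset[OF core])
    fix N p k assume N: "N \<lhd> (sub E)" and p: "Factorial_Ring.prime (p::nat)" "card N = p ^ k"
    have Ns: "subgroup N G" using incl_subgroup[OF Es normal_imp_subgroup[OF N]] .
    have NE: "N \<subseteq> E" using E.normal_subset[OF N] by simp
    have "cj g ` N \<subseteq> ?F" if g: "g \<in> carrier G" for g
    proof (rule E.normal_p_subgroup_subset_fitting[OF _ p(1)])
      have c: "N \<subseteq> carrier G" using NE Ec by blast
      have "inj_on (cj g) N" using g c by (auto intro!: inj_onI simp: subsetD)
      then show "card (cj g ` N) = p ^ k" using p(2) by (simp add: card_image)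
      show "cj g ` N \<lhd> (sub E)"
      proof (rule E.normal_invI)
        have "cj g ` N \<subseteq> E" using normalD[OF E _ g] NE by blast
        then show "subgroup (cj g ` N) (sub E)"
          by (rule subgroup_incl[OF group_hom.subgroup_img_is_subgroup[OF hom[OF g] Ns] Es])
        fix e y assume "e \<in> carrier (sub E)" and "y \<in> cj g ` N"
        then obtain x where x: "e \<in> E" "x \<in> N" "y = cj g x" by auto
        have ec: "e \<in> carrier G" "x \<in> carrier G" using x Ec c by auto
        let ?e = "cj (inv g) e"
        have e': "?e \<in> E" using normalD[OF E x(1), of "inv g"] g by simp
        have "?e \<otimes>\<^bsub>sub E\<^esub> x \<otimes>\<^bsub>sub E\<^esub> inv\<^bsub>sub E\<^esub> ?e \<in> N"
          using E.normalD[OF N x(2)] e' by simp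
        then have "cj ?e x \<in> N" using inv[OF e'] by simp
        moreover have "cj e y = cj g (cj ?e x)" unfolding x(3) using g ec by (simp add: conj_simps)
        ultimately have "cj e y \<in> cj g ` N" by blast
        then show "e \<otimes>\<^bsub>sub E\<^esub> y \<otimes>\<^bsub>sub E\<^esub> inv\<^bsub>sub E\<^esub> e \<in> cj g ` N"
          using inv[OF x(1)] by simp
      qed
    qed
    then have "\<forall>g\<in>carrier G. cj g x \<in> ?F" if "x \<in> N" for x using that by blast
    then show "N \<subseteq> ?S" using mem_core_iff[OF Fc] NE Ec by blast
  qed
  then have "?F = ?S" using core_subset[OF Fc] by blast
  then show "?F \<lhd> G" using core_normal[OF Fs] by simp
qed

text \<open>\<open>Q\<close> is normal in \<open>E\<close>, and by the Frattini argument
  \<open>G\<close> is the product of the Fitting subgroup of \<open>E\<close> and the normaliser of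
  \<open>Q\<close>.\<close>

lemma sylow_fitting_of_normal:
  assumes E: "E \<lhd> G" and Q: "sylow_subgroup (sub (fitting (sub E))) p Q"
  shows "Q \<lhd> G"
proof -
  let ?F = "fitting (sub E)"
  note F = fitting_of_normal[OF E]
  note Es = normal_imp_subgroup[OF E]
  interpret E: fin_group "sub E" using Es by (rule fin_group_subgroup)
  have QE: "Q \<lhd> (sub E)" using E.sylow_fitting_normal[of p Q] Q by simp
  note Qs = sylow_subgroup_carrierD[OF normal_imp_subgroup[OF F(1)] Q]
  have "cj g x \<in> Q" if g: "g \<in> carrier G" and x: "x \<in> Q" for g x
  proof -
    obtain k n where kn: "k \<in> ?F" "n \<in> normalizer G Q" "g = k \<otimes> n" using frattini[OF F(1) Q g] by blast
    have k: "k \<in> E" using kn(1) F(2) by blast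
    have c: "k \<in> carrier G" "n \<in> carrier G" "x \<in> carrier G"
      using subgroup.mem_carrier[OF Es k] kn(2) normalizer_iff[OF Qs(2)] subgroup.mem_carrier[OF Qs(2) x] by auto
    have "cj n x \<in> Q" using kn(2) normalizer_iff[OF Qs(2)] x by blast
    then have "k \<otimes>\<^bsub>sub E\<^esub> cj n x \<otimes>\<^bsub>sub E\<^esub> inv\<^bsub>sub E\<^esub> k \<in> Q"
      using E.normalD[OF QE] k by simp
    then have "cj k (cj n x) \<in> Q" using m_inv_consistent[OF Es k] by simp
    then show ?thesis using cj_cj[OF c] kn(3) by simp
  qed
  then show ?thesis by (rule normal_invI[OF Qs(2)])
qed

theorem supersoluble_if_U_tau_supplemented:
  assumes sol: "solvable G" and E: "E \<lhd> G" and GE: "supersoluble (G Mod E)"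
    and \<tau>: "is_subgroup_functor \<tau>" "inductive_functor \<tau>" "Phi_regular \<tau>"
    and supp: "\<And>p P H. sylow_subgroup (sub (fitting (sub E))) p P \<Longrightarrow>
      maximal_subgroup (sub P) H \<Longrightarrow> U_tau_supplemented \<tau> G H"
  shows "supersoluble G"
proof -
  let ?F = "fitting (sub E)"
  let ?G' = "derived G (carrier G)"
  note Es = normal_imp_subgroup[OF E]
  note Ec = subgroup.subset[OF Es]
  interpret E: fin_group "sub E" using Es by (rule fin_group_subgroup)
  note F = fitting_of_normal[OF E]
  note Fs = normal_imp_subgroup[OF F(1)]
  have G': "?G' \<lhd> G" by (rule derived_self_is_normal)
  have G'c: "?G' \<subseteq> carrier G" using G' by (rule normal_subset)
  have factor: "Q \<inter> M \<lhd> G \<and> cyc (Q \<inter> M) Q"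
    if M: "maximal_subgroup G M" and Q: "sylow_subgroup (sub ?F) p Q" "\<not> Q \<subseteq> M" for M p Q
    using cyc_if_U_tau_supplemented[OF \<tau> sylow_subgroup_carrierD(1)[OF Fs Q(1)] sylow_fitting_of_normal[OF E Q(1)]
        sylow_subgroup_carrierD(4)[OF Fs Q(1)] M Q(2) supp[OF Q(1)]] .
  \<comment> \<open>For a Sylow subgroup Q of \<open>?F\<close> inside \<open>M\<close>, its
    commutators with the derived subgroup stay in the normal subgroup Q; otherwise Q/(Q \<inter> M)
    is cyclic and the derived subgroup centralises it.\<close>
  have FG': "cm k b \<in> M" if M: "maximal_subgroup G M" and b: "b \<in> ?F" and k: "k \<in> ?G'" for M b k
  proof -
    have Ms: "subgroup M G" using M by (simp add: maximal_subgroup_def)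
    note Mc = subgroup.subset[OF Ms]
    let ?C = "core G M"
    have C: "?C \<lhd> G" using core_normal[OF Ms] .
    note Cs = normal_imp_subgroup[OF C]
    have "?F \<subseteq> cent_mod (carrier G) ?G' ?C"
    proof (rule subgroup_subset_if_sylow_subset[OF Fs])
      show "subgroup (cent_mod (carrier G) ?G' ?C) G"
        using cent_mod_normal[OF normal_self G' C] by (rule normal_imp_subgroup)
      fix p :: nat assume "Factorial_Ring.prime p"
      then obtain Q where Q: "sylow_subgroup (sub ?F) p Q" using ex_sylow_in[OF Fs] by blast
      have Qn: "Q \<lhd> G" using sylow_fitting_of_normal[OF E Q] .
      have "cm x k \<in> ?C" if x: "x \<in> Q" and k: "k \<in> ?G'" for x k
      proof (cases "Q \<subseteq> M")
        case True
        have c: "x \<in> carrier G" "k \<in> carrier G" using x k normal_subset[OF Qn] G'c by auto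
        have "cm x k \<in> Q" using cm_in_normal_subgroup[OF Qn c] x by blast
        then show ?thesis using normal_subset_core[OF Qn True Mc] by blast
      next
        case False
        note D = factor[OF M Q False]
        have "cm x k \<in> Q \<inter> M" using derived_centralizes_cyc[OF _ Qn _ x k] D by blast
        then show ?thesis using normal_subset_core[OF _ _ Mc, of "Q \<inter> M"] D by blast
      qed
      then have "cm k x \<in> ?C" if "x \<in> Q" "k \<in> ?G'" for x k
        using cm_sym[OF _ _ Cs, of x k] that normal_subset[OF Qn] G'c by blast
      then have "Q \<subseteq> cent_mod (carrier G) ?G' ?C" using normal_subset[OF Qn] by (auto simp: cent_mod_def)
      then show "\<exists>Q. sylow_subgroup (sub ?F) p Q \<and> Q \<subseteq> cent_mod (carrier G) ?G' ?C" using Q by blast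
    qed
    then have "cm k b \<in> ?C" using b k by (auto simp: cent_mod_def)
    then show ?thesis using core_subset[OF Mc] by blast
  qed
  let ?D = "\<lambda>i. (derived G ^^ i) (carrier G)"
  have D: "?D i \<lhd> G" for i
  proof (induction i)
    case (Suc i)
    then show ?case using derived_is_normal by simp
  qed (simp add: normal_self)
  have Dmono: "?D (Suc i) \<subseteq> ?D i" for i
    using derived_incl[OF _ normal_imp_subgroup[OF D[of i]]] by simp
  have DG': "?D (Suc i) \<subseteq> ?G'" for i
  proof (induction i)
    case (Suc i)
    then show ?case using Dmono[of "Suc i"] by blast
  qed simp
  have Dcm: "cm x y \<in> ?D (Suc i)" if "x \<in> ?D i" "y \<in> ?D i" for x y i
  proof -
    have "cm x y \<in> derived G (?D i)" using that by (rule cm_in_derived)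
    then show ?thesis by simp
  qed
  obtain n where n: "?D n = {\<one>}" using sol solvable_iff_trivial_derived_seq by blast
  \<comment> \<open>Downward induction from the trivial term. For K = E \<inter>
    \<open>?D (Suc i)\<close>, commutators of K lie in \<open>?F\<close> by the induction
    hypothesis, and those of \<open>?F\<close> with K lie in every maximal subgroup, because
    \<open>Suc i\<close> keeps K inside the derived subgroup. So the Sylow subgroups of K are normal
    in \<open>G\<close> and lie in \<open>?F\<close>.\<close>
  have "E \<inter> ?D (Suc i) \<subseteq> ?F" if "i \<le> n" for i
    using that
  proof (induction i rule: inc_induct)
    case base
    have "?D (Suc n) \<subseteq> {\<one>}" using Dmono[of n] unfolding n .
    then show ?case using subgroup.one_closed[OF Fs] by auto
  next
    case (step i)
    let ?K = "E \<inter> ?D (Suc i)"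
    have K: "?K \<lhd> G" using E D by (rule normal_Int)
    note Ks = normal_imp_subgroup[OF K]
    note Kc = subgroup.subset[OF Ks]
    have KK: "cm x y \<in> ?F \<inter> ?K" if xy: "x \<in> ?K" "y \<in> ?K" for x y
    proof -
      have c: "x \<in> carrier G" "y \<in> carrier G" using xy Kc by auto
      have "cm x y \<in> ?K" using cm_in_normal_subgroup[OF K c] xy by blast
      moreover have "cm x y \<in> ?D (Suc (Suc i))" using Dcm xy by blast
      ultimately show ?thesis using step(3) by blast
    qed
    have "nilp_over_maximal ?K"
      unfolding nilp_over_maximal_def
    proof (intro allI impI)
      fix M assume M: "maximal_subgroup G M \<and> \<not> ?K \<subseteq> M"
      show "\<exists>B. B \<lhd> G \<and> B \<subseteq> ?K \<and> \<not> B \<subseteq> M \<and> (\<forall>b\<in>B. \<forall>k\<in>?K. cm b k \<in> M)"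
      \<comment> \<open>The witness is \<open>?K\<close> itself if its commutators already lie in
        \<open>M\<close>, and \<open>?F \<inter> ?K\<close> otherwise.\<close>
      proof (cases "?F \<inter> ?K \<subseteq> M")
        case True
        then show ?thesis using K KK M by blast
      next
        case False
        have Ms: "subgroup M G" using M by (simp add: maximal_subgroup_def)
        have "cm b k \<in> M" if bk: "b \<in> ?F \<inter> ?K" "k \<in> ?K" for b k
        proof -
          have c: "b \<in> carrier G" "k \<in> carrier G" using bk Kc by auto
          have "k \<in> ?G'" using bk(2) DG' by blast
          then have "cm k b \<in> M" using FG' M bk(1) by blast
          then show ?thesis using cm_sym[OF c(2,1) Ms] by blast
        qed
        then show ?thesis using normal_Int[OF F(1) K] False by blast
      qed
    qed
    note nil = this
    show "?K \<subseteq> ?F"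
    proof (rule subgroup_subset_if_sylow_subset[OF Ks Fs])
      fix p :: nat assume p: "Factorial_Ring.prime p"
      obtain Q where Q: "sylow_subgroup (sub ?K) p Q" using ex_sylow_in[OF Ks p] by blast
      note Qs = sylow_subgroup_carrierD[OF Ks Q]
      have QE: "Q \<subseteq> E" using Qs(3) by blast
      have "Q \<lhd> (sub E)" using normal_restrict_supergroup[OF Es sylow_normal[OF K nil Q] QE] .
      then have "Q \<subseteq> ?F" using E.normal_p_subgroup_subset_fitting[OF _ p Qs(4)] by blast
      then show "\<exists>Q. sylow_subgroup (sub ?K) p Q \<and> Q \<subseteq> ?F" using Q by blast
    qed
  qed
  from this[of 0] have EG': "E \<inter> ?G' \<subseteq> ?F" by simp
  have "\<exists>A B. A \<lhd> G \<and> B \<lhd> G \<and> A \<subseteq> M \<and> A \<subseteq> B \<and> \<not> B \<subseteq> M \<and> cyc A B"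
    if M: "maximal_subgroup G M" for M
  proof -
    have Ms: "subgroup M G" "M \<noteq> carrier G" using M by (auto simp: maximal_subgroup_def)
    \<comment> \<open>The cyclic factor is sought below \<open>?F\<close>, between \<open>?F\<close>
      and \<open>E\<close>, or above \<open>E\<close>, according to which of \<open>?F\<close>,
      \<open>E\<close> and \<open>G\<close> is the first not contained in \<open>M\<close>.\<close>
    consider "\<not> ?F \<subseteq> M" | "?F \<subseteq> M" "\<not> E \<subseteq> M" | "E \<subseteq> M" by blast
    then show ?thesis
    proof cases
      case 1
      then obtain p where p: "Factorial_Ring.prime p" "\<nexists>Q. sylow_subgroup (sub ?F) p Q \<and> Q \<subseteq> M"
        using subgroup_subset_if_sylow_subset[OF Fs Ms(1)] by blast
      then obtain Q where Q: "sylow_subgroup (sub ?F) p Q" "\<not> Q \<subseteq> M"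
        using ex_sylow_in[OF Fs p(1)] by blast
      then show ?thesis using factor[OF M Q] sylow_fitting_of_normal[OF E Q(1)] by blast
    next
      case 2
      then obtain x where x: "x \<in> E" "x \<notin> M" by blast
      have xc: "x \<in> carrier G" using x Ec by blast
      \<comment> \<open>For g in \<open>G\<close> and z in \<open>?B\<close>, [g, z] lies in
        \<open>E \<inter> ?G'\<close>, hence in \<open>?F\<close>; so this extension of
        \<open>?F\<close> by one element is normal in \<open>G\<close>.\<close>
      let ?B = "?F <#> generate G {x}"
      have Bs: "subgroup ?B G" using cyc_gen_subgroup[OF F(1) xc] .
      have FB: "?F \<subseteq> ?B" and xB: "x \<in> ?B"
        using set_mult_superset[OF Fs generate_singleton_subgroup[OF xc]] by (auto intro: generate.incl)
      have "generate G {x} \<subseteq> E" using x(1) by (intro generate_subgroup_incl[OF _ Es]) simp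
      then have "?B \<subseteq> E <#> E" using F(2) by (intro mono_set_mult)
      then have BE: "?B \<subseteq> E" using subgroup_mult_id[OF Es] by simp
      have "?B \<lhd> G"
      proof (rule normal_invI[OF Bs])
        fix g z assume g: "g \<in> carrier G" and z: "z \<in> ?B"
        have zc: "z \<in> carrier G" using z BE Ec by blast
        have "cm g z \<in> ?G'" using g zc by (rule cm_in_derived)
        moreover have "cm g z \<in> E" using cm_in_normal_subgroup[OF E g zc] z BE by blast
        ultimately have "cm g z \<in> ?B" using EG' FB by blast
        then have "cm g z \<otimes> z \<in> ?B" using subgroup.m_closed[OF Bs _ z] by blast
        then show "cj g z \<in> ?B" using g zc by (simp add: m_assoc)
      qed
      moreover have "cyc ?F ?B" using xB unfolding cyc_def by blast
      ultimately show ?thesis using F(1) 2(1) FB xB x(2) by blast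
    next
      case 3
      have QE: "group (G Mod E)" using E by (rule normal.factorgroup_is_group)
      have "cyc_chain E (carrier G)" using cyc_chain_of_quotient[OF E] GE group.supersoluble_iff_cyc_chain[OF QE] by blast
      moreover have "\<not> carrier G \<subseteq> M" using Ms subgroup.subset by blast
      ultimately show ?thesis using cyc_chain_jump[of E "carrier G" "\<lambda>Z. Z \<subseteq> M"] 3 by blast
    qed
  qed
  then have "cyc_chain {\<one>} (carrier G)" using cyc_chain_if_maximal_avoid_cyc[OF sol _ one_is_normal] by blast
  then show ?thesis using supersoluble_iff_cyc_chain by blast
qed

end

section \<open>The functor of trivial subgroups and the converse direction\<close>

lemma ex_iso_nat_group:
  assumes "group G" "finite (carrier G)"
  shows "\<exists>(K :: nat monoid) \<theta>. group K \<and> \<theta> \<in> iso G K"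
proof -
  obtain f :: "'a \<Rightarrow> nat" where f: "inj_on f (carrier G)"
    using finite_imp_inj_to_nat_seg[OF assms(2)] by blast
  then show ?thesis
    using group.inj_imp_image_group_is_group[OF assms(1) f] inj_imp_image_group_iso[OF f] by blast
qed

definition trivial_functor :: subgroup_functor where
  "trivial_functor K = {{\<one>\<^bsub>K\<^esub>}}"

lemma trivial_functor_is_subgroup_functor: "is_subgroup_functor trivial_functor"
  unfolding is_subgroup_functor_def trivial_functor_def
proof (intro conjI allI impI)
  fix K K' :: "nat monoid" and \<theta>
  assume "group K \<and> finite (carrier K) \<and> group K' \<and> \<theta> \<in> iso K K'"
  then have "\<theta> \<one>\<^bsub>K\<^esub> = \<one>\<^bsub>K'\<^esub>" using hom_one by (auto simp: iso_def)
  then show "(\<lambda>S. \<theta> ` S) ` {{\<one>\<^bsub>K\<^esub>}} = {{\<one>\<^bsub>K'\<^esub>}}" by simp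
qed (auto intro: group.triv_subgroup)

lemma trivial_functor_inductive: "inductive_functor trivial_functor"
  unfolding inductive_functor_def
proof (intro allI impI)
  fix K :: "nat monoid" and N S
  assume K: "group K \<and> finite (carrier K) \<and> N \<lhd> K \<and> S \<in> trivial_functor K"
  interpret K: group K using K by blast
  have N: "N \<lhd> K" using K by blast
  have Q: "group (K Mod N)" using N by (rule normal.factorgroup_is_group)
  have "finite (carrier (K Mod N))" using K by (simp add: carrier_FactGroup)
  \<comment> \<open>The elements of the quotient are sets, so a copy on the natural numbers is
    required before the functor can be evaluated.\<close>
  then obtain L :: "nat monoid" and \<theta> where L: "group L" "\<theta> \<in> iso (K Mod N) L"
    using ex_iso_nat_group[OF Q] by blast
  have S: "(\<lambda>s. N #>\<^bsub>K\<^esub> s) ` S = {\<one>\<^bsub>K Mod N\<^esub>}"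
    using K K.normal_subset[OF N] by (simp add: trivial_functor_def)
  have "\<theta> \<one>\<^bsub>K Mod N\<^esub> = \<one>\<^bsub>L\<^esub>" using L Q hom_one[of \<theta> "K Mod N" L] by (simp add: iso_def del: one_FactGroup)
  then have "\<theta> ` {\<one>\<^bsub>K Mod N\<^esub>} \<in> trivial_functor L" by (simp add: trivial_functor_def del: one_FactGroup)
  then show "tau_subgroup trivial_functor (K Mod N) ((\<lambda>s. N #>\<^bsub>K\<^esub> s) ` S)"
    unfolding tau_subgroup_def S using L monoid.one_closed[OF group.is_monoid[OF Q]] by blast
qed

lemma trivial_functor_Phi_regular: "Phi_regular trivial_functor"
  unfolding Phi_regular_def
proof (intro allI impI)
  fix K :: "nat monoid" and S p k N
  assume K: "group K \<and> finite (carrier K) \<and> primitive_group K \<and> S \<in> trivial_functor K \<and>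
    Factorial_Ring.prime p \<and> card S = p ^ k \<and> minimal_normal K N"
  then interpret K: fin_group K by (simp add: fin_group_def fin_group_axioms_def)
  have "N \<lhd> K" using K by (simp add: minimal_normal_def)
  then have "\<one>\<^bsub>K\<^esub> \<in> N" using subgroup.one_closed[OF normal_imp_subgroup] by blast
  then have SN: "S \<inter> N = {\<one>\<^bsub>K\<^esub>}" using K by (auto simp: trivial_functor_def)
  have "normalizer K {\<one>\<^bsub>K\<^esub>} = carrier K" by (auto simp: K.normalizer_iff[OF K.triv_subgroup])
  moreover have "rcosets\<^bsub>K\<^esub> (carrier K) = {carrier K}"
    using K.coset_join2[OF _ K.subgroup_self] K.one_closed by (auto simp: RCOSETS_def)
  ultimately have "card (rcosets\<^bsub>K\<^esub> (normalizer K (S \<inter> N))) = p ^ 0" using SN by simp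
  then show "\<exists>m. card (rcosets\<^bsub>K\<^esub> (normalizer K (S \<inter> N))) = p ^ m" by blast
qed

text \<open>With E = 1 the Sylow subgroups in question are trivial, and a trivial group has no
  maximal subgroup, because maximal subgroups are proper.\<close>

lemma (in fin_group) supersoluble_imp_ex_functor:
  assumes "supersoluble G"
  shows "{\<one>} \<lhd> G \<and> supersoluble (G Mod {\<one>}) \<and>
    (\<forall>p P H. sylow_subgroup (G\<lparr>carrier := fitting (G\<lparr>carrier := {\<one>}\<rparr>)\<rparr>) p P \<and>
      maximal_subgroup (G\<lparr>carrier := P\<rparr>) H \<longrightarrow> U_tau_supplemented \<tau> G H)"
proof (intro conjI allI impI)
  show one: "{\<one>} \<lhd> G" by (rule one_is_normal)
  interpret q: surj_hom G "G Mod {\<one>}" "\<lambda>x. {\<one>} #> x" using one by (rule rcos_surj_hom)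
  have "cyc_chain {\<one>} (carrier G)" using assms supersoluble_iff_cyc_chain by blast
  from q.cyc_chain_image[OF this] have "q.H.cyc_chain ((\<lambda>x. {\<one>} #> x) ` {\<one>}) (carrier (G Mod {\<one>}))"
    unfolding q.surj .
  then have "q.H.cyc_chain {\<one>\<^bsub>G Mod {\<one>}\<^esub>} (carrier (G Mod {\<one>}))" by (simp add: r_coset_def)
  then show "supersoluble (G Mod {\<one>})" using q.H.supersoluble_iff_cyc_chain by blast
next
  fix p P H
  assume a: "sylow_subgroup (G\<lparr>carrier := fitting (G\<lparr>carrier := {\<one>}\<rparr>)\<rparr>) p P \<and> maximal_subgroup (G\<lparr>carrier := P\<rparr>) H"
  note F = fitting_of_normal[OF one_is_normal]
  note P = sylow_subgroup_carrierD[OF normal_imp_subgroup[OF F(1)], of p P]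
  have P1: "subgroup P G" "P \<subseteq> {\<one>}" using P a F(2) by auto
  have H: "subgroup H (G\<lparr>carrier := P\<rparr>)" "H \<noteq> P" using a by (auto simp: maximal_subgroup_def)
  have "H \<subseteq> P" using subgroup.subset[OF H(1)] by simp
  moreover have "\<one> \<in> H" using subgroup.one_closed[OF H(1)] by simp
  ultimately have False using P1(2) H(2) by blast
  then show "U_tau_supplemented \<tau> G H" by blast
qed

theorem theorem1p11:
  fixes G :: "('a, 'b) monoid_scheme"
  assumes "group G" and "finite (carrier G)" and "solvable G"
  shows "supersoluble G \<longleftrightarrow>
    (\<exists>E \<tau>. E \<lhd> G \<and> supersoluble (G Mod E) \<and>
       is_subgroup_functor \<tau> \<and> inductive_functor \<tau> \<and> Phi_regular \<tau> \<and>
       (\<forall>p P H. sylow_subgroup (G\<lparr>carrier := fitting (G\<lparr>carrier := E\<rparr>)\<rparr>) p P \<and>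
                maximal_subgroup (G\<lparr>carrier := P\<rparr>) H \<longrightarrow> U_tau_supplemented \<tau> G H))"
proof (rule iffI, goal_cases)
  interpret fin_group G using assms by (simp add: fin_group_def fin_group_axioms_def)
  case 1
  then show ?case
    using supersoluble_imp_ex_functor[of trivial_functor] trivial_functor_is_subgroup_functor
      trivial_functor_inductive trivial_functor_Phi_regular by blast
next
  interpret fin_group G using assms by (simp add: fin_group_def fin_group_axioms_def)
  case 2
  then show ?case using supersoluble_if_U_tau_supplemented[OF assms(3)] by blast
qed

end
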